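(* Let $n=3$ and $\lambda=((1)|(2))\in\Lambda_3$. Consider the Kazhdan--Lusztig basis of $\mathcal{H}_3$, the left cells of $W_3$ and the left cell modules defined with respect to the weighted lexicographic order on monomials given by $$V^iv^j<V^{i'}v^{j'}\iff i+j<i'+j'\ \text{ or }\ (i+j=i'+j'\text{ and }i<i').$$ Then the Specht module $\tilde S^\lambda$ is not isomorphic, as an $\mathcal{H}_3$-module, to $[\mathfrak{C}]_A$ for any left cell $\mathfrak{C}$ of $W_3$ with respect to this order.
   Context: **Group and algebra.** $W_n$ ($n\ge2$) is the Coxeter group of type $B_n$ with generators $t,s_1,\dots,s_{n-1}$ ($ts_1$ of order 4, $s_is_{i+1}$ of order 3, all other pairs of distinct generators commute), length function $\ell$. $\mathfrak{S}_n=\langle s_1,\dots,s_{n-1}\rangle$ is identified with the symmetric group, $s_i=(i,i+1)$. $A=\mathbb{Z}[V^{\pm1},v^{\pm1}]$ with independent indeterminates $V,v$. $\mathcal{H}_n$ is the free $A$-algebra with basis $T_w$ ($w\in W_n$) and multiplication, for a generator $s$: $T_sT_w=T_{sw}$ if $\ell(sw)>\ell(w)$, and $T_sT_w=T_{sw}+(v_s-v_s^{-1})T_w$ if $\ell(sw)<\ell(w)$, where $v_t=V$ and $v_{s_i}=v$. **Kazhdan--Lusztig basis and left cells with respect to a monomial order $\le$** (a total order on the monomials $V^iv^j$, $i,j\in\mathbb{Z}$, compatible with multiplication, with $V>1$, $v>1$). Let $A_{<0}$ be the $\mathbb{Z}$-span of the monomials $<1$. $C_w$ is the unique element of $T_w+\sum_{y<w}A_{<0}T_y$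 (here $y<w$ in the Bruhat--Chevalley order) fixed by the ring involution of $\mathcal{H}_n$ with $V\mapsto V^{-1}$, $v\mapsto v^{-1}$, $T_w\mapsto T_{w^{-1}}^{-1}$; $\{C_w\}$ is an $A$-basis of $\mathcal{H}_n$. $\le_{\mathcal{L}}$ is the pre-order (reflexive, transitive) on $W_n$ generated by: $z\le_{\mathcal L}y$ if $C_z$ occurs with non-zero coefficient in $C_sC_y$ for some generator $s$. Left cells are the equivalence classes of the associated equivalence relation. For a left cell $\mathfrak{C}$, let $\mathfrak{I}_{\mathfrak C}$ be the $A$-span of all $C_y$ with $y\le_{\mathcal L}w$ for some $w\in\mathfrak{C}$, and $\hat{\mathfrak I}_{\mathfrak C}$ the $A$-span of those such $C_y$ with $y\notin\mathfrak{C}$; both are left ideals, and the left cell module is $[\mathfrak{C}]_A=\mathfrak{I}_{\mathfrak C}/\hat{\mathfrak I}_{\mathfrak C}$. **Combinatorics.** $\Lambda_n$ is the set of bipartitions $\lambda=(\lambda_1|\lambda_2)$ with $|\lambda_1|+|\lambda_2|=n$; $l=|\lambda_1|$. $\lambda$-bitableaux are filled by $1,\dots,n$ (each once); $\mathbb{T}(\lambda)$ is the set of standard ones (in each component, rows and columns increase). $\mathfrak{t}^\lambda$ is the bitableau whose first component has its rows filled in order, left to right, by $1,\dots,l$ and whose second component has its rows filled in order by $l+1,\dots,n$. $\mathfrak{S}_n$ acts on the left on bitableaux by permuting entries; $d(\mathfrak{t})\in\mathfrak{S}_n$ is defined by $d(\mathfrak{t}).\mathfrak{t}^\lambda=\mathfrak{t}$.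 $\mathfrak{S}_\lambda\subseteq\mathfrak{S}_n$ is the row stabilizer of $\mathfrak{t}^\lambda$. Dominance order: $\lambda\trianglelefteq\mu$ iff $\sum_{i\le j}\lambda_1^{(i)}\le\sum_{i\le j}\mu_1^{(i)}$ and $|\lambda_1|+\sum_{i\le j}\lambda_2^{(i)}\le|\mu_1|+\sum_{i\le j}\mu_2^{(i)}$ for all $j$ (where $\lambda_k^{(i)}$ is the $i$-th part of $\lambda_k$); $\lambda\triangleleft\mu$ means $\lambda\trianglelefteq\mu$, $\lambda\ne\mu$. **Specht modules (Dipper--James--Murphy).** With $t_i=s_{i-1}\cdots s_1ts_1\cdots s_{i-1}$, put $u_l^+=\prod_{i=1}^l\bigl(v^{2(i-1)}+Vv^{2(i-1)}T_{t_i}\bigr)$ (commuting factors) and $x_\lambda=u_l^+\sum_{w\in\mathfrak{S}_\lambda}v^{\ell(w)}T_w$ (the two factors commute). For $\mathfrak{s},\mathfrak{t}\in\mathbb{T}(\lambda)$ put $x_{\mathfrak{s}\mathfrak{t}}=T_{d(\mathfrak{s})}x_\lambda T_{d(\mathfrak{t})^{-1}}$. $\hat N^\lambda$ is the $A$-span of all $x_{\mathfrak{s}\mathfrak{t}}$ with $\mathfrak{s},\mathfrak{t}\in\mathbb{T}(\mu)$, $\lambda\triangleleft\mu$; it is a two-sided ideal. $M^\lambda=\mathcal{H}_nx_\lambda$ and $\tilde S^\lambda=M^\lambda/(M^\lambda\cap\hat N^\lambda)$. *)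

theory Defs
  imports
    Complex_Main
    "HOL-Library.Poly_Mapping"
    "HOL-Library.Product_Plus"
    "HOL-Library.Sublist"
    "HOL-Combinatorics.Permutations"
    "HOL-Algebra.Group"
begin

section \<open>The Coxeter group of type B\<close>

text \<open>Words in the generators are lists over \<open>{..<n}\<close>; the letter \<open>0\<close> is $t$ and the
  letter \<open>i \<ge> 1\<close> is $s_i$. The group is given by its Coxeter presentation, so that its
  elements are congruence classes of words.\<close>

definition coxeter_m :: "nat \<Rightarrow> nat \<Rightarrow> nat" where
  "coxeter_m i j =
     (if i = j then 1
      else if {i, j} = {0, 1} then 4
      else if i = Suc j \<or> j = Suc i then 3
      else 2)"

inductive word_eq :: "nat \<Rightarrow> nat list \<Rightarrow> nat list \<Rightarrow> bool" for n :: nat where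
  rel: "\<lbrakk>xs \<in> lists {..<n}; ys \<in> lists {..<n}; i < n; j < n\<rbrakk> \<Longrightarrow>
          word_eq n (xs @ concat (replicate (coxeter_m i j) [i, j]) @ ys) (xs @ ys)"
| refl: "xs \<in> lists {..<n} \<Longrightarrow> word_eq n xs xs"
| sym: "word_eq n xs ys \<Longrightarrow> word_eq n ys xs"
| trans: "\<lbrakk>word_eq n xs ys; word_eq n ys zs\<rbrakk> \<Longrightarrow> word_eq n xs zs"

type_synonym cox = "nat list set"

definition word_class :: "nat \<Rightarrow> nat list \<Rightarrow> cox" where
  "word_class n xs = {ys. word_eq n xs ys}"

definition W :: "nat \<Rightarrow> cox monoid" where
  "W n = \<lparr>carrier = lists {..<n} // {(xs, ys). word_eq n xs ys},
          monoid.mult = (\<lambda>x y. {zs. \<exists>xs\<in>x. \<exists>ys\<in>y. word_eq n (xs @ ys) zs}),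
          one = word_class n []\<rparr>"

definition gen :: "nat \<Rightarrow> nat \<Rightarrow> cox" where
  "gen n i = word_class n [i]"

definition len :: "cox \<Rightarrow> nat" where
  "len w = (LEAST k. \<exists>xs\<in>w. length xs = k)"

definition reduced :: "cox \<Rightarrow> nat list \<Rightarrow> bool" where
  "reduced w xs \<longleftrightarrow> xs \<in> w \<and> length xs = len w"

text \<open>Bruhat--Chevalley order: \<open>y\<close> is obtained by omitting factors from a reduced
  expression of \<open>w\<close>.\<close>

definition bruhat_less :: "cox \<Rightarrow> cox \<Rightarrow> bool" where
  "bruhat_less y w \<longleftrightarrow> y \<noteq> w \<and> (\<exists>xs. reduced w xs \<and> (\<exists>ys\<in>y. subseq ys xs))"

section \<open>Laurent polynomials in two indeterminates\<close>

text \<open>$\mathbb{Z}[V^{\pm1},v^{\pm1}]$ is the group ring of \<open>int \<times> int\<close>: the exponent pair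
  \<open>(i, j)\<close> stands for the monomial $V^i v^j$, and multiplication is convolution.\<close>

type_synonym laurent = "(int \<times> int) \<Rightarrow>\<^sub>0 int"

definition monom :: "int \<Rightarrow> int \<Rightarrow> laurent" where
  "monom i j = Poly_Mapping.single (i, j) 1"

definition laurent_bar :: "laurent \<Rightarrow> laurent" where
  "laurent_bar a = Poly_Mapping.map_key uminus a"

text \<open>A monomial order is given by its strict part on exponent pairs.\<close>

type_synonym monom_order = "int \<times> int \<Rightarrow> int \<times> int \<Rightarrow> bool"

definition wlex_less :: monom_order where
  "wlex_less = (\<lambda>(i, j) (i', j'). i + j < i' + j' \<or> (i + j = i' + j' \<and> i < i'))"

definition A_neg :: "monom_order \<Rightarrow> laurent set" where
  "A_neg lt = {a. \<forall>k\<in>Poly_Mapping.keys a. lt k (0, 0)}"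

section \<open>The Iwahori--Hecke algebra\<close>

text \<open>Elements are formal $A$-linear combinations of group elements; the underlying type
  does not depend on \<open>n\<close>, so the algebra is singled out by its carrier.\<close>

type_synonym hecke = "cox \<Rightarrow>\<^sub>0 laurent"

definition hecke_carrier :: "nat \<Rightarrow> hecke set" where
  "hecke_carrier n = {h. Poly_Mapping.keys h \<subseteq> carrier (W n)}"

definition T :: "cox \<Rightarrow> hecke" where
  "T w = Poly_Mapping.single w 1"

definition smul :: "laurent \<Rightarrow> hecke \<Rightarrow> hecke" where
  "smul a h = Poly_Mapping.map ((*) a) h"

lemma lookup_smul: "Poly_Mapping.lookup (smul a h) w = a * Poly_Mapping.lookup h w"
  by (simp add: smul_def Poly_Mapping.map.rep_eq when_def)

global_interpretation hecke: Modules.module smul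
  defines A_span = hecke.span
  by unfold_locales
    (auto intro!: poly_mapping_eqI simp: lookup_smul lookup_add algebra_simps)

definition v_gen :: "nat \<Rightarrow> laurent" where
  "v_gen i = (if i = 0 then monom 1 0 else monom 0 1)"

definition v_gen_inv :: "nat \<Rightarrow> laurent" where
  "v_gen_inv i = (if i = 0 then monom (-1) 0 else monom 0 (-1))"

definition T_gen_T :: "nat \<Rightarrow> nat \<Rightarrow> cox \<Rightarrow> hecke" where
  "T_gen_T n i w =
     (let sw = gen n i \<otimes>\<^bsub>W n\<^esub> w in
      if len sw > len w then T sw
      else T sw + smul (v_gen i - v_gen_inv i) (T w))"

definition T_gen_act :: "nat \<Rightarrow> nat \<Rightarrow> hecke \<Rightarrow> hecke" where
  "T_gen_act n i h =
     (\<Sum>w\<in>Poly_Mapping.keys h. smul (Poly_Mapping.lookup h w) (T_gen_T n i w))"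

text \<open>The product is the bilinear extension of
  $T_w h = T_{i_1}(T_{i_2}(\cdots(T_{i_k} h)))$ for a reduced expression $i_1 \cdots i_k$ of $w$;
  by Matsumoto's theorem the choice of the reduced expression is immaterial. This is the
  associative product with unit $T_1$ determined by the rule for $T_s T_w$.\<close>

definition hecke_mult :: "nat \<Rightarrow> hecke \<Rightarrow> hecke \<Rightarrow> hecke" where
  "hecke_mult n g h =
     (\<Sum>w\<in>Poly_Mapping.keys g.
        smul (Poly_Mapping.lookup g w) (foldr (T_gen_act n) (SOME xs. reduced w xs) h))"

definition hecke_one :: "nat \<Rightarrow> hecke" where
  "hecke_one n = T \<one>\<^bsub>W n\<^esub>"

definition hecke_inv :: "nat \<Rightarrow> hecke \<Rightarrow> hecke" where
  "hecke_inv n h =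
     (THE g. g \<in> hecke_carrier n \<and> hecke_mult n g h = hecke_one n \<and> hecke_mult n h g = hecke_one n)"

definition hecke_bar :: "nat \<Rightarrow> hecke \<Rightarrow> hecke" where
  "hecke_bar n h =
     (\<Sum>w\<in>Poly_Mapping.keys h.
        smul (laurent_bar (Poly_Mapping.lookup h w)) (hecke_inv n (T (inv\<^bsub>W n\<^esub> w))))"

section \<open>Kazhdan--Lusztig basis and left cells\<close>

definition KL :: "monom_order \<Rightarrow> nat \<Rightarrow> cox \<Rightarrow> hecke" where
  "KL lt n w =
     (THE h. (\<exists>g \<in> hecke_carrier n. h = T w + g \<and>
                (\<forall>y\<in>Poly_Mapping.keys g. bruhat_less y w \<and> Poly_Mapping.lookup g y \<in> A_neg lt))
             \<and> hecke_bar n h = h)"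

definition left_step :: "monom_order \<Rightarrow> nat \<Rightarrow> cox \<Rightarrow> cox \<Rightarrow> bool" where
  "left_step lt n z y \<longleftrightarrow> z \<in> carrier (W n) \<and> y \<in> carrier (W n) \<and>
     (\<exists>i<n. \<exists>c. hecke_mult n (KL lt n (gen n i)) (KL lt n y)
                   = (\<Sum>w\<in>carrier (W n). smul (c w) (KL lt n w)) \<and> c z \<noteq> 0)"

definition left_le :: "monom_order \<Rightarrow> nat \<Rightarrow> cox \<Rightarrow> cox \<Rightarrow> bool" where
  "left_le lt n = (left_step lt n)\<^sup>*\<^sup>*"

definition left_cells :: "monom_order \<Rightarrow> nat \<Rightarrow> cox set set" where
  "left_cells lt n =
     carrier (W n) // {(x, y). x \<in> carrier (W n) \<and> y \<in> carrier (W n) \<and>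
                               left_le lt n x y \<and> left_le lt n y x}"

definition cell_ideal :: "monom_order \<Rightarrow> nat \<Rightarrow> cox set \<Rightarrow> hecke set" where
  "cell_ideal lt n C =
     A_span {KL lt n y | y. y \<in> carrier (W n) \<and> (\<exists>w\<in>C. left_le lt n y w)}"

definition cell_ideal_hat :: "monom_order \<Rightarrow> nat \<Rightarrow> cox set \<Rightarrow> hecke set" where
  "cell_ideal_hat lt n C =
     A_span {KL lt n y | y. y \<in> carrier (W n) \<and> (\<exists>w\<in>C. left_le lt n y w) \<and> y \<notin> C}"

section \<open>Left modules over the Hecke algebra\<close>

record 'm left_module =
  elts :: "'m set"
  plus_op :: "'m \<Rightarrow> 'm \<Rightarrow> 'm"
  action :: "hecke \<Rightarrow> 'm \<Rightarrow> 'm"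

definition add_coset :: "hecke set \<Rightarrow> hecke \<Rightarrow> hecke set" where
  "add_coset N x = {x + y | y. y \<in> N}"

text \<open>The quotient of a left ideal \<open>M\<close> by a left ideal \<open>N \<subseteq> M\<close>.\<close>

definition quotient_module :: "nat \<Rightarrow> hecke set \<Rightarrow> hecke set \<Rightarrow> hecke set left_module" where
  "quotient_module n M N =
     \<lparr>elts = add_coset N ` M,
      plus_op = (\<lambda>X Y. {x + y | x y. x \<in> X \<and> y \<in> Y}),
      action = (\<lambda>h X. {hecke_mult n h x + y | x y. x \<in> X \<and> y \<in> N})\<rparr>"

text \<open>The scalars act through the algebra (as $a T_1$), so that compatibility with the action
  includes $A$-linearity.\<close>

definition module_iso :: "nat \<Rightarrow> 'm left_module \<Rightarrow> 'k left_module \<Rightarrow> bool" where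
  "module_iso n P Q \<longleftrightarrow>
     (\<exists>f. bij_betw f (elts P) (elts Q) \<and>
          (\<forall>x\<in>elts P. \<forall>y\<in>elts P. f (plus_op P x y) = plus_op Q (f x) (f y)) \<and>
          (\<forall>h\<in>hecke_carrier n. \<forall>x\<in>elts P. f (action P h x) = action Q h (f x)))"

definition cell_module :: "monom_order \<Rightarrow> nat \<Rightarrow> cox set \<Rightarrow> hecke set left_module" where
  "cell_module lt n C = quotient_module n (cell_ideal lt n C) (cell_ideal_hat lt n C)"

section \<open>Bipartitions and bitableaux\<close>

type_synonym bipartition = "nat list \<times> nat list"

text \<open>A tableau is the list of its rows.\<close>

type_synonym bitableau = "nat list list \<times> nat list list"

definition is_partition :: "nat list \<Rightarrow> bool" where
  "is_partition p \<longleftrightarrow> sorted_wrt (\<ge>) p \<and> (\<forall>k\<in>set p. k > 0)"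

definition bipartitions :: "nat \<Rightarrow> bipartition set" where
  "bipartitions n =
     {(p, q). is_partition p \<and> is_partition q \<and> sum_list p + sum_list q = n}"

definition dominated :: "bipartition \<Rightarrow> bipartition \<Rightarrow> bool" where
  "dominated la mu \<longleftrightarrow>
     (\<forall>j. sum_list (take j (fst la)) \<le> sum_list (take j (fst mu)) \<and>
          sum_list (fst la) + sum_list (take j (snd la))
            \<le> sum_list (fst mu) + sum_list (take j (snd mu)))"

definition strictly_dominated :: "bipartition \<Rightarrow> bipartition \<Rightarrow> bool" where
  "strictly_dominated la mu \<longleftrightarrow> dominated la mu \<and> la \<noteq> mu"

definition standard_rows :: "nat list list \<Rightarrow> bool" where
  "standard_rows rs \<longleftrightarrow>
     (\<forall>r\<in>set rs. sorted_wrt (<) r) \<and>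
     (\<forall>i j. Suc i < length rs \<and> j < length (rs ! Suc i) \<longrightarrow> rs ! i ! j < rs ! Suc i ! j)"

definition std_bitableaux :: "nat \<Rightarrow> bipartition \<Rightarrow> bitableau set" where
  "std_bitableaux n la =
     {(r1, r2). map length r1 = fst la \<and> map length r2 = snd la \<and>
                distinct (concat r1 @ concat r2) \<and> set (concat r1 @ concat r2) = {1..n} \<and>
                standard_rows r1 \<and> standard_rows r2}"

fun fill_rows :: "nat \<Rightarrow> nat list \<Rightarrow> nat list list" where
  "fill_rows k [] = []"
| "fill_rows k (p # ps) = [k..<k + p] # fill_rows (k + p) ps"

definition t_super :: "bipartition \<Rightarrow> bitableau" where
  "t_super la = (fill_rows 1 (fst la), fill_rows (1 + sum_list (fst la)) (snd la))"

definition act_bitableau :: "(nat \<Rightarrow> nat) \<Rightarrow> bitableau \<Rightarrow> bitableau" where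
  "act_bitableau \<sigma> tt = (map (map \<sigma>) (fst tt), map (map \<sigma>) (snd tt))"

text \<open>Identification of the symmetric group with the parabolic subgroup generated by
  $s_1,\dots,s_{n-1}$, where $s_i$ is the transposition of $i$ and $i+1$.\<close>

fun word_perm :: "nat list \<Rightarrow> nat \<Rightarrow> nat" where
  "word_perm [] = id"
| "word_perm (i # xs) = transpose i (Suc i) \<circ> word_perm xs"

definition sym_elt :: "nat \<Rightarrow> (nat \<Rightarrow> nat) \<Rightarrow> cox" where
  "sym_elt n \<sigma> =
     (THE w. w \<in> carrier (W n) \<and> (\<exists>xs\<in>w. set xs \<subseteq> {1..<n} \<and> word_perm xs = \<sigma>))"

definition d_elt :: "nat \<Rightarrow> bipartition \<Rightarrow> bitableau \<Rightarrow> cox" where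
  "d_elt n la tt =
     sym_elt n (THE \<sigma>. \<sigma> permutes {1..n} \<and> act_bitableau \<sigma> (t_super la) = tt)"

definition row_stabilizer :: "nat \<Rightarrow> bipartition \<Rightarrow> cox set" where
  "row_stabilizer n la =
     {sym_elt n \<sigma> | \<sigma>. \<sigma> permutes {1..n} \<and>
        (\<forall>r \<in> set (fst (t_super la)) \<union> set (snd (t_super la)). \<sigma> ` set r = set r)}"

section \<open>Specht modules\<close>

definition t_elt :: "nat \<Rightarrow> nat \<Rightarrow> cox" where
  "t_elt n i = word_class n (rev [1..<i] @ [0] @ [1..<i])"

definition u_plus :: "nat \<Rightarrow> nat \<Rightarrow> hecke" where
  "u_plus n l =
     foldr (hecke_mult n)
       (map (\<lambda>i. smul (monom 0 (2 * (int i - 1))) (hecke_one n)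
                 + smul (monom 1 (2 * (int i - 1))) (T (t_elt n i))) [1..<Suc l])
       (hecke_one n)"

definition x_elt :: "nat \<Rightarrow> bipartition \<Rightarrow> hecke" where
  "x_elt n la =
     hecke_mult n (u_plus n (sum_list (fst la)))
       (\<Sum>w\<in>row_stabilizer n la. smul (monom 0 (int (len w))) (T w))"

definition x_st :: "nat \<Rightarrow> bipartition \<Rightarrow> bitableau \<Rightarrow> bitableau \<Rightarrow> hecke" where
  "x_st n la s t =
     hecke_mult n (hecke_mult n (T (d_elt n la s)) (x_elt n la))
       (T (inv\<^bsub>W n\<^esub> (d_elt n la t)))"

definition N_hat :: "nat \<Rightarrow> bipartition \<Rightarrow> hecke set" where
  "N_hat n la =
     A_span {x_st n mu s t | mu s t. mu \<in> bipartitions n \<and> strictly_dominated la mu \<and>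
                                     s \<in> std_bitableaux n mu \<and> t \<in> std_bitableaux n mu}"

definition M_ideal :: "nat \<Rightarrow> bipartition \<Rightarrow> hecke set" where
  "M_ideal n la = (\<lambda>h. hecke_mult n h (x_elt n la)) ` hecke_carrier n"

definition specht_module :: "nat \<Rightarrow> bipartition \<Rightarrow> hecke set left_module" where
  "specht_module n la = quotient_module n (M_ideal n la) (M_ideal n la \<inter> N_hat n la)"

end

theory Submission
  imports Defs
begin

text \<open>
  The Specht module is free of rank three, with basis $X$, $T_1 X$, $T_2 T_1 X$ for the class $X$ of
  the generator. It contains the vector $m = X + v T_1 X + v^2 T_2 T_1 X$, which is killed by
  $T_1 - v$ and $T_2 - v$ and satisfies $(T_t + V^{-1}) m = (V + V^{-1} v^4) X$. If the module were
  isomorphic to a left cell module, the vectors killed by $T_1 - v$ and $T_2 - v$ would be spanned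
  by those $C_w$ in the cell with $s_1, s_2$ in the left descent set of $w$, so for some such $w$
  all coefficients of $C_t C_w$ within the cell would be divisible by $V + V^{-1} v^4$. The explicit
  Kazhdan--Lusztig basis shows that the nonzero ones among these coefficients are $1$,
  $V v^{-1} + V^{-1} v$ and $V + V^{-1}$, none of which is divisible.
\<close>

section \<open>Tables for the group\<close>

text \<open>The group is a quotient of words, and the product, the inverses and the Kazhdan-Lusztig
  elements come from choice or description operators, so nothing computes by itself. One
  braid-exchange argument, stated for arbitrary operators satisfying the braid relations, identifies
  the group with the table, frees the product from the choice of reduced words, and yields the bar
  involution and the representation \<open>rho\<close>. The Kazhdan-Lusztig basis is only verified:
  a table is checked for triangularity and for its products with generators, and bar invariance
  follows by induction.

  The Specht module enters in one form: \<open>h \<star> X\<close> lies in \<open>N\<close> exactly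
  when \<open>act h (1, 0, 0) = 0\<close>. One direction holds because \<open>N\<close> acts by zero
  under \<open>rho\<close>, the other because a left ideal \<open>Q\<close> inside \<open>N\<close>
  already contains the relations that define \<open>rho\<close>. An isomorphism then amounts to a
  generator of the cell module with the annihilator of (1, 0, 0). Divisibility by V + V^-1 v^4 is
  refuted by evaluating at V = 4i, v = 2, where V^2 = -16 = -v^4.\<close>

text \<open>The 48 group elements are numbered by increasing length: \<open>word_table ! k\<close> is a reduced word
  of the element \<open>k\<close> (with \<open>0\<close> standing for \<open>t\<close>), and \<open>lmul_table ! i ! k\<close> is the number of the
  product of the generator \<open>i\<close> and the element \<open>k\<close>.\<close>

definition indices :: "nat list" where
  "indices = [
   0, 1, 2, 3, 4, 5, 6, 7, 8, 9, 10, 11, 12, 13, 14, 15, 16, 17, 18, 19, 20, 21, 22, 23, 24, 25,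
   26, 27, 28, 29, 30, 31, 32, 33, 34, 35, 36, 37, 38, 39, 40, 41, 42, 43, 44, 45, 46, 47]"

definition word_table :: "nat list list" where
  "word_table = [
   [], [0], [1], [2], [1, 0], [2, 0], [0, 1], [2, 1], [1, 2], [0, 1, 0], [2, 1, 0], [1, 2, 0],
   [1, 0, 1], [2, 0, 1], [1, 2, 1], [0, 1, 2], [1, 0, 1, 0], [2, 0, 1, 0], [1, 2, 1, 0],
   [0, 1, 2, 0], [2, 1, 0, 1], [1, 2, 0, 1], [0, 1, 2, 1], [1, 0, 1, 2], [2, 1, 0, 1, 0],
   [1, 2, 0, 1, 0], [0, 1, 2, 1, 0], [1, 0, 1, 2, 0], [1, 2, 1, 0, 1], [0, 1, 2, 0, 1],
   [1, 0, 1, 2, 1], [2, 1, 0, 1, 2], [1, 2, 1, 0, 1, 0], [0, 1, 2, 0, 1, 0], [1, 0, 1, 2, 1, 0],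
   [2, 1, 0, 1, 2, 0], [0, 1, 2, 1, 0, 1], [1, 0, 1, 2, 0, 1], [2, 1, 0, 1, 2, 1],
   [0, 1, 2, 1, 0, 1, 0], [1, 0, 1, 2, 0, 1, 0], [2, 1, 0, 1, 2, 1, 0], [1, 0, 1, 2, 1, 0, 1],
   [2, 1, 0, 1, 2, 0, 1], [1, 0, 1, 2, 1, 0, 1, 0], [2, 1, 0, 1, 2, 0, 1, 0],
   [2, 1, 0, 1, 2, 1, 0, 1], [2, 1, 0, 1, 2, 1, 0, 1, 0]]"

definition lmul_table :: "nat list list" where
  "lmul_table = [
   [1, 0, 6, 5, 9, 3, 2, 13, 15, 4, 17, 19, 16, 7, 22, 8, 12, 10, 26, 11, 24, 29, 14, 27, 20,
   33, 18, 23, 36, 21, 37, 35, 39, 25, 40, 31, 28, 30, 43, 32, 34, 45, 44, 38, 42, 41, 47, 46],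
   [2, 4, 0, 8, 1, 11, 12, 14, 3, 16, 18, 5, 6, 21, 7, 23, 9, 25, 10, 27, 28, 13, 30, 15, 32,
   17, 34, 19, 20, 37, 22, 38, 24, 40, 26, 41, 42, 29, 31, 44, 33, 35, 36, 46, 39, 47, 43, 45],
   [3, 5, 7, 0, 10, 1, 13, 2, 14, 17, 4, 18, 20, 6, 8, 22, 24, 9, 11, 26, 12, 28, 15, 31, 16,
   32, 19, 35, 21, 36, 38, 23, 25, 39, 41, 27, 29, 43, 30, 33, 45, 34, 46, 37, 47, 40, 42, 44]]"

definition word :: "nat \<Rightarrow> nat list" where
  "word k = word_table ! k"

definition lmul :: "nat \<Rightarrow> nat \<Rightarrow> nat" where
  "lmul i k = lmul_table ! i ! k"

definition wlen :: "nat \<Rightarrow> nat" where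
  "wlen k = length (word k)"

lemma word_simps:
  "word 0 = []" "word 1 = [0]" "word 2 = [1]" "word 3 = [2]" "word 4 = [1, 0]" "word 5 = [2, 0]"
  "word 6 = [0, 1]" "word 7 = [2, 1]" "word 8 = [1, 2]" "word 9 = [0, 1, 0]"
  "word 10 = [2, 1, 0]" "word 11 = [1, 2, 0]" "word 12 = [1, 0, 1]" "word 13 = [2, 0, 1]"
  "word 14 = [1, 2, 1]" "word 15 = [0, 1, 2]" "word 16 = [1, 0, 1, 0]" "word 17 = [2, 0, 1, 0]"
  "word 18 = [1, 2, 1, 0]" "word 19 = [0, 1, 2, 0]" "word 20 = [2, 1, 0, 1]"
  "word 21 = [1, 2, 0, 1]" "word 22 = [0, 1, 2, 1]" "word 23 = [1, 0, 1, 2]"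
  "word 24 = [2, 1, 0, 1, 0]" "word 25 = [1, 2, 0, 1, 0]" "word 26 = [0, 1, 2, 1, 0]"
  "word 27 = [1, 0, 1, 2, 0]" "word 28 = [1, 2, 1, 0, 1]" "word 29 = [0, 1, 2, 0, 1]"
  "word 30 = [1, 0, 1, 2, 1]" "word 31 = [2, 1, 0, 1, 2]" "word 32 = [1, 2, 1, 0, 1, 0]"
  "word 33 = [0, 1, 2, 0, 1, 0]" "word 34 = [1, 0, 1, 2, 1, 0]" "word 35 = [2, 1, 0, 1, 2, 0]"
  "word 36 = [0, 1, 2, 1, 0, 1]" "word 37 = [1, 0, 1, 2, 0, 1]" "word 38 = [2, 1, 0, 1, 2, 1]"
  "word 39 = [0, 1, 2, 1, 0, 1, 0]" "word 40 = [1, 0, 1, 2, 0, 1, 0]"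
  "word 41 = [2, 1, 0, 1, 2, 1, 0]" "word 42 = [1, 0, 1, 2, 1, 0, 1]"
  "word 43 = [2, 1, 0, 1, 2, 0, 1]" "word 44 = [1, 0, 1, 2, 1, 0, 1, 0]"
  "word 45 = [2, 1, 0, 1, 2, 0, 1, 0]" "word 46 = [2, 1, 0, 1, 2, 1, 0, 1]"
  "word 47 = [2, 1, 0, 1, 2, 1, 0, 1, 0]"
  by (simp_all add: word_def word_table_def)

lemma lmul_simps:
  "lmul 0 0 = 1" "lmul 0 1 = 0" "lmul 0 2 = 6" "lmul 0 3 = 5" "lmul 0 4 = 9" "lmul 0 5 = 3"
  "lmul 0 6 = 2" "lmul 0 7 = 13" "lmul 0 8 = 15" "lmul 0 9 = 4" "lmul 0 10 = 17"
  "lmul 0 11 = 19" "lmul 0 12 = 16" "lmul 0 13 = 7" "lmul 0 14 = 22" "lmul 0 15 = 8"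
  "lmul 0 16 = 12" "lmul 0 17 = 10" "lmul 0 18 = 26" "lmul 0 19 = 11" "lmul 0 20 = 24"
  "lmul 0 21 = 29" "lmul 0 22 = 14" "lmul 0 23 = 27" "lmul 0 24 = 20" "lmul 0 25 = 33"
  "lmul 0 26 = 18" "lmul 0 27 = 23" "lmul 0 28 = 36" "lmul 0 29 = 21" "lmul 0 30 = 37"
  "lmul 0 31 = 35" "lmul 0 32 = 39" "lmul 0 33 = 25" "lmul 0 34 = 40" "lmul 0 35 = 31"
  "lmul 0 36 = 28" "lmul 0 37 = 30" "lmul 0 38 = 43" "lmul 0 39 = 32" "lmul 0 40 = 34"
  "lmul 0 41 = 45" "lmul 0 42 = 44" "lmul 0 43 = 38" "lmul 0 44 = 42" "lmul 0 45 = 41"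
  "lmul 0 46 = 47" "lmul 0 47 = 46" "lmul 1 0 = 2" "lmul 1 1 = 4" "lmul 1 2 = 0" "lmul 1 3 = 8"
  "lmul 1 4 = 1" "lmul 1 5 = 11" "lmul 1 6 = 12" "lmul 1 7 = 14" "lmul 1 8 = 3" "lmul 1 9 = 16"
  "lmul 1 10 = 18" "lmul 1 11 = 5" "lmul 1 12 = 6" "lmul 1 13 = 21" "lmul 1 14 = 7"
  "lmul 1 15 = 23" "lmul 1 16 = 9" "lmul 1 17 = 25" "lmul 1 18 = 10" "lmul 1 19 = 27"
  "lmul 1 20 = 28" "lmul 1 21 = 13" "lmul 1 22 = 30" "lmul 1 23 = 15" "lmul 1 24 = 32"
  "lmul 1 25 = 17" "lmul 1 26 = 34" "lmul 1 27 = 19" "lmul 1 28 = 20" "lmul 1 29 = 37"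
  "lmul 1 30 = 22" "lmul 1 31 = 38" "lmul 1 32 = 24" "lmul 1 33 = 40" "lmul 1 34 = 26"
  "lmul 1 35 = 41" "lmul 1 36 = 42" "lmul 1 37 = 29" "lmul 1 38 = 31" "lmul 1 39 = 44"
  "lmul 1 40 = 33" "lmul 1 41 = 35" "lmul 1 42 = 36" "lmul 1 43 = 46" "lmul 1 44 = 39"
  "lmul 1 45 = 47" "lmul 1 46 = 43" "lmul 1 47 = 45" "lmul 2 0 = 3" "lmul 2 1 = 5"
  "lmul 2 2 = 7" "lmul 2 3 = 0" "lmul 2 4 = 10" "lmul 2 5 = 1" "lmul 2 6 = 13" "lmul 2 7 = 2"
  "lmul 2 8 = 14" "lmul 2 9 = 17" "lmul 2 10 = 4" "lmul 2 11 = 18" "lmul 2 12 = 20"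
  "lmul 2 13 = 6" "lmul 2 14 = 8" "lmul 2 15 = 22" "lmul 2 16 = 24" "lmul 2 17 = 9"
  "lmul 2 18 = 11" "lmul 2 19 = 26" "lmul 2 20 = 12" "lmul 2 21 = 28" "lmul 2 22 = 15"
  "lmul 2 23 = 31" "lmul 2 24 = 16" "lmul 2 25 = 32" "lmul 2 26 = 19" "lmul 2 27 = 35"
  "lmul 2 28 = 21" "lmul 2 29 = 36" "lmul 2 30 = 38" "lmul 2 31 = 23" "lmul 2 32 = 25"
  "lmul 2 33 = 39" "lmul 2 34 = 41" "lmul 2 35 = 27" "lmul 2 36 = 29" "lmul 2 37 = 43"
  "lmul 2 38 = 30" "lmul 2 39 = 33" "lmul 2 40 = 45" "lmul 2 41 = 34" "lmul 2 42 = 46"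
  "lmul 2 43 = 37" "lmul 2 44 = 47" "lmul 2 45 = 40" "lmul 2 46 = 42" "lmul 2 47 = 44"
  by (simp_all add: lmul_def lmul_table_def)

lemmas word_eval = word_simps [unfolded One_nat_def]
  and lmul_eval = lmul_simps [unfolded One_nat_def]

lemma set_indices: "set indices = {..<48}"
  by (auto simp: indices_def lessThan_nat_numeral)

lemma all_indices: "list_all P indices \<Longrightarrow> k < 48 \<Longrightarrow> P k"
  using set_indices by (auto simp: list_all_iff)

lemma all_gens: "list_all P [0, 1, 2] \<Longrightarrow> i < 3 \<Longrightarrow> P (i :: nat)"
  by (auto simp: less_Suc_eq numeral_eq_Suc)

section \<open>Finite checks on the multiplication table, and exchange of reduced words\<close>

definition ascent :: "nat \<Rightarrow> nat \<Rightarrow> bool" where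
  "ascent i k \<longleftrightarrow> wlen k < wlen (lmul i k)"

text \<open>For distinct generators the sum of the labels tells the three pairs apart: 1 is {t, s_1}
  of order 4, 3 is {s_1, s_2} of order 3, and 2 is the commuting pair. The one-letter word for
  \<open>i = j\<close> makes the braid relation trivial there, so that later statements can range
  over all \<open>i\<close> and \<open>j\<close>.\<close>

definition braid :: "nat \<Rightarrow> nat \<Rightarrow> nat list" where
  "braid i j = (if i = j then [i] else if i + j = 1 then [i, j, i, j]
     else if i + j = 3 then [i, j, i] else [i, j])"

text \<open>Since the elements are numbered by length, an ascent is visible as a comparison of two
  numbers; the list computations rely on this.\<close>

definition lmul_ok :: "nat \<Rightarrow> nat \<Rightarrow> bool" where
  "lmul_ok i k \<longleftrightarrow> lmul i k < 48 \<and> lmul i (lmul i k) = k \<and>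
     (ascent i k \<longleftrightarrow> k < lmul i k) \<and>
     (if ascent i k then wlen (lmul i k) = Suc (wlen k) else wlen k = Suc (wlen (lmul i k)))"

text \<open>The last clause closes the chosen words under removal of the first letter, so that
  inductions along a word stay inside the table.\<close>

definition word_ok :: "nat \<Rightarrow> bool" where
  "word_ok k \<longleftrightarrow> list_all (\<lambda>i. i < 3) (word k) \<and> foldr lmul (word k) 0 = k \<and>
     (k \<noteq> 0 \<longrightarrow> word k = hd (word k) # word (lmul (hd (word k)) k))"

text \<open>Here \<open>u\<close> is the short factor: \<open>lmul i k\<close> is
  \<open>braid i j\<close> applied to \<open>u\<close>, and equally \<open>braid j i\<close> applied
  to \<open>u\<close>. Dropping the leading letter \<open>i\<close> or \<open>j\<close> leads to
  \<open>k\<close> or to \<open>lmul j (lmul i k)\<close>, with lengths adding up.\<close>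

definition dihedral_ok :: "nat \<Rightarrow> nat \<Rightarrow> nat \<Rightarrow> nat \<Rightarrow> bool" where
  "dihedral_ok i j k u \<longleftrightarrow> u < 48 \<and> foldr lmul (tl (braid i j)) u = k \<and>
     foldr lmul (tl (braid j i)) u = lmul j (lmul i k) \<and>
     wlen k = wlen u + length (tl (braid i j))"

text \<open>Generators are involutions, so applying the reversed tail strips
  \<open>tl (braid i j)\<close> from the left of \<open>k\<close>.\<close>

definition ascent_ok :: "nat \<Rightarrow> nat \<Rightarrow> nat \<Rightarrow> bool" where
  "ascent_ok i k j \<longleftrightarrow> i = j \<or> dihedral_ok i j k (foldr lmul (rev (tl (braid i j))) k)"

lemma table_checks:
  "list_all (\<lambda>i. list_all (lmul_ok i) indices) [0, 1, 2]"
  "list_all word_ok indices"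
  "list_all (\<lambda>i. list_all (\<lambda>k. ascent i k \<longrightarrow> ascent_ok i k (hd (word (lmul i k)))) indices) [0, 1, 2]"
  "list_all (\<lambda>i. list_all (\<lambda>j. list_all (\<lambda>k.
     foldr lmul (braid i j) k = foldr lmul (braid j i) k) indices) [0, 1, 2]) [0, 1, 2]"
  by (simp_all add: indices_def lmul_ok_def word_ok_def ascent_ok_def dihedral_ok_def ascent_def
      wlen_def braid_def lmul_eval word_eval)

lemma
  assumes "i < 3" and "k < 48"
  shows lmul_less: "lmul i k < 48"
    and lmul_lmul: "lmul i (lmul i k) = k"
    and wlen_lmul: "wlen (lmul i k) = (if ascent i k then Suc (wlen k) else wlen k - 1)"
    and ascent_lmul: "ascent i (lmul i k) \<longleftrightarrow> \<not> ascent i k"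
    and ascent_iff_less: "ascent i k \<longleftrightarrow> k < lmul i k"
    and not_ascent_wlen: "\<not> ascent i k \<Longrightarrow> wlen k = Suc (wlen (lmul i k))"
  using all_indices [OF all_gens [OF table_checks(1) assms(1)] assms(2)]
  by (auto simp: lmul_ok_def ascent_def split: if_splits)

lemma
  assumes "k < 48"
  shows letters_word: "word k \<in> lists {..<3}"
    and foldr_lmul_word: "foldr lmul (word k) 0 = k"
    and word_Cons: "k \<noteq> 0 \<Longrightarrow> word k = hd (word k) # word (lmul (hd (word k)) k)"
  using all_indices [OF table_checks(2) assms]
  by (auto simp: word_ok_def list_all_iff)

lemma foldr_lmul_less: "xs \<in> lists {..<3} \<Longrightarrow> k < 48 \<Longrightarrow> foldr lmul xs k < 48"
  by (induction xs) (auto simp: lmul_less)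

lemma lmul_braid:
  "i < 3 \<Longrightarrow> j < 3 \<Longrightarrow> k < 48 \<Longrightarrow> foldr lmul (braid i j) k = foldr lmul (braid j i) k"
  using all_indices [OF all_gens [OF all_gens [OF table_checks(4)]]] by blast

lemma wlen_foldr_lmul_le:
  "xs \<in> lists {..<3} \<Longrightarrow> k < 48 \<Longrightarrow> wlen (foldr lmul xs k) \<le> wlen k + length xs"
  by (induction xs) (auto simp: wlen_lmul foldr_lmul_less intro: le_SucI)

lemma word_0 [simp]: "word 0 = []" and wlen_0 [simp]: "wlen 0 = 0"
  by (simp_all add: word_simps wlen_def)

lemma word_lmul:
  assumes "i < 3" "k < 48" "ascent i k"
  defines "j \<equiv> hd (word (lmul i k))"
  shows "j < 3" "word (lmul i k) = j # word (lmul j (lmul i k))"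
proof -
  have 1: "lmul i k < 48" using assms lmul_less by blast
  have "lmul i k \<noteq> 0"
    using assms(3) by (metis ascent_def not_less_zero wlen_0)
  then show *: "word (lmul i k) = j # word (lmul j (lmul i k))"
    using word_Cons 1 unfolding j_def by blast
  show "j < 3"
    using letters_word [OF 1] by (subst (asm) *) auto
qed

lemma braid_Cons: "braid i j = i # tl (braid i j)"
  by (simp add: braid_def)

lemma letters_braid: "i < 3 \<Longrightarrow> j < 3 \<Longrightarrow> braid i j \<in> lists {..<3}"
  by (simp add: braid_def)

text \<open>If an ascent \<open>i\<close> of \<open>k\<close> is not the first letter \<open>j\<close> of the chosen word of
  \<open>lmul i k\<close>, then that element is the longest element of the parabolic subgroup of \<open>i\<close> and
  \<open>j\<close> times a shorter element \<open>u\<close>; a single braid relation applied on top of \<open>u\<close>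
  then trades \<open>i\<close> for \<open>j\<close>.\<close>

lemma foldr_word_step:
  fixes F :: "nat \<Rightarrow> 'a \<Rightarrow> 'a"
  assumes D: "x \<in> D" "\<And>i y. i < 3 \<Longrightarrow> y \<in> D \<Longrightarrow> F i y \<in> D"
    and braid: "\<And>i j y. i < 3 \<Longrightarrow> j < 3 \<Longrightarrow> y \<in> D \<Longrightarrow> foldr F (braid i j) y = foldr F (braid j i) y"
    and "i < 3" "k < 48" "ascent i k"
  shows "F i (foldr F (word k) x) = foldr F (word (lmul i k)) x"
  using assms(4-6)
proof (induction "wlen k" arbitrary: i k rule: less_induct)
  case less
  let ?f = "\<lambda>k. foldr F (word k) x"
  have fD: "?f k \<in> D" if "k < 48" for k
  proof -
    have "foldr F xs x \<in> D" if "xs \<in> lists {..<3}" for xs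
      using that by (induction xs) (auto simp: D)
    then show ?thesis using letters_word [OF that] by blast
  qed
  \<comment> \<open>Each letter of \<open>ys\<close> is an ascent and acts on an element strictly
    shorter than \<open>k\<close>, so the induction hypothesis moves it into the chosen word one
    letter at a time.\<close>
  have chain: "foldr F ys (?f u) = ?f (foldr lmul ys u)"
    if "ys \<in> lists {..<3}" "u < 48" "wlen (foldr lmul ys u) = wlen u + length ys"
       "wlen u + length ys \<le> wlen k" for ys u
    using that
  proof (induction ys rule: list.induct)
    case (Cons y ys)
    let ?v = "foldr lmul ys u"
    have v: "?v < 48" using foldr_lmul_less [of ys u] Cons.prems(1,2) by simp
    have le: "wlen ?v \<le> wlen u + length ys"
      using Cons.prems by (intro wlen_foldr_lmul_le) auto
    have asc: "ascent y ?v" and eq: "wlen ?v = wlen u + length ys"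
      using Cons.prems le v wlen_lmul [of y ?v] by (auto split: if_splits)
    have "F y (?f ?v) = ?f (lmul y ?v)"
      using Cons.prems v asc eq by (intro less.hyps) auto
    then show ?case using Cons eq by simp
  qed auto
  let ?k' = "lmul i k"
  define j where "j = hd (word ?k')"
  note j = word_lmul [OF less.prems, folded j_def]
  have k': "?k' < 48" "wlen ?k' = Suc (wlen k)" "lmul i ?k' = k"
    using less.prems lmul_less lmul_lmul wlen_lmul by auto
  show ?case
  proof (cases "i = j")
    case True
    then show ?thesis using j k' by simp
  next
    case False
    let ?u = "foldr lmul (rev (tl (braid i j))) k"
    have "ascent_ok i k j"
      using all_indices [OF all_gens [OF table_checks(3) less.prems(1)] less.prems(2)] less.prems(3)
      by (simp add: j_def)
    then have u: "dihedral_ok i j k ?u"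
      using False by (simp add: ascent_ok_def)
    have lists: "tl (braid i j) \<in> lists {..<3}" "tl (braid j i) \<in> lists {..<3}"
      using letters_braid [OF less.prems(1) j(1)] letters_braid [OF j(1) less.prems(1)]
      by (metis braid_Cons Cons_in_lists_iff)+
    have len: "length (tl (braid i j)) = length (tl (braid j i))"
      by (simp add: braid_def)
    have "wlen (lmul j ?k') = wlen k"
      using j k' unfolding wlen_def by (metis length_Cons old.nat.inject)
    then have 1: "foldr F (tl (braid i j)) (?f ?u) = ?f k"
      and 2: "foldr F (tl (braid j i)) (?f ?u) = ?f (lmul j ?k')"
      using u lists len by (auto simp: dihedral_ok_def chain)
    have "F i (?f k) = foldr F (braid i j) (?f ?u)"
      unfolding 1 [symmetric] by (subst (2) braid_Cons) simp
    also have "\<dots> = foldr F (braid j i) (?f ?u)"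
      using u by (intro braid less.prems j fD) (simp add: dihedral_ok_def)
    also have "\<dots> = F j (?f (lmul j ?k'))"
      unfolding 2 [symmetric] by (subst braid_Cons) simp
    also have "\<dots> = ?f ?k'"
      by (subst j(2)) simp
    finally show ?thesis .
  qed
qed

text \<open>Matsumoto's theorem for this group: the length bound says that \<open>xs\<close> is
  reduced, hence every letter is an ascent for what follows it, and \<open>foldr_word_step\<close>
  rewrites letter by letter. The set \<open>D\<close> is where the braid relations of
  \<open>F\<close> are known to hold.\<close>

lemma foldr_reduced_word:
  fixes F :: "nat \<Rightarrow> 'a \<Rightarrow> 'a"
  assumes D: "x \<in> D" "\<And>i y. i < 3 \<Longrightarrow> y \<in> D \<Longrightarrow> F i y \<in> D"
    and braid: "\<And>i j y. i < 3 \<Longrightarrow> j < 3 \<Longrightarrow> y \<in> D \<Longrightarrow> foldr F (braid i j) y = foldr F (braid j i) y"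
    and "xs \<in> lists {..<3}" "length xs \<le> wlen (foldr lmul xs 0)"
  shows "foldr F xs x = foldr F (word (foldr lmul xs 0)) x"
  using assms(4,5)
proof (induction xs rule: list.induct)
  case (Cons i xs)
  let ?k = "foldr lmul xs 0"
  have k: "i < 3" "?k < 48" "wlen ?k \<le> length xs" 
    using Cons.prems foldr_lmul_less [of xs 0] wlen_foldr_lmul_le [of xs 0] by auto
  then have "ascent i ?k" "length xs \<le> wlen ?k"
    using Cons.prems wlen_lmul [of i ?k] by (auto split: if_splits)
  then show ?case
    using Cons k foldr_word_step [OF D braid, of i ?k] by simp
qed simp

text \<open>An element with both \<open>i\<close> and \<open>j\<close> as ascents is shortest in its
  coset of the dihedral subgroup, so the whole braid word adds its full length.\<close>

definition minimal_ok :: "nat \<Rightarrow> nat \<Rightarrow> nat \<Rightarrow> bool" where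
  "minimal_ok i j k \<longleftrightarrow> (ascent i k \<and> ascent j k \<longrightarrow>
     wlen (foldr lmul (braid i j) k) = wlen k + length (braid i j))"

lemma minimal_checks:
  "list_all (\<lambda>i. list_all (\<lambda>j. list_all (minimal_ok i j) indices) [0, 1, 2]) [0, 1, 2]"
  by (simp add: indices_def minimal_ok_def ascent_def wlen_def braid_def lmul_eval word_eval)

lemma wlen_braid_minimal:
  assumes "i < 3" "j < 3" "k < 48" "ascent i k" "ascent j k"
  shows "wlen (foldr lmul (braid i j) k) = wlen k + length (braid i j)"
  using all_indices [OF all_gens [OF all_gens [OF minimal_checks]]] assms
  by (auto simp: minimal_ok_def)

section \<open>The Coxeter group\<close>

lemma coxeter_m_simps:
  "i < 3 \<Longrightarrow> j < 3 \<Longrightarrow> coxeter_m i j = (if i = j then 1 else if i + j = 1 then 4 else if i + j = 3 then 3 else 2)"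
  by (auto simp: coxeter_m_def doubleton_eq_iff less_Suc_eq numeral_eq_Suc)

lemma word_eq_lists:
  "word_eq n xs ys \<Longrightarrow> xs \<in> lists {..<n} \<and> ys \<in> lists {..<n}"
  by (induction rule: word_eq.induct) (auto split: if_splits)

lemma word_eq_append:
  assumes "word_eq n xs ys" "us \<in> lists {..<n}" "zs \<in> lists {..<n}"
  shows "word_eq n (us @ xs @ zs) (us @ ys @ zs)"
  using assms
proof (induction rule: word_eq.induct)
  case (rel xs ys i j)
  then show ?case
    using word_eq.rel [of "us @ xs" n "ys @ zs" i j] by simp
next
  case (refl xs)
  then show ?case by (intro word_eq.refl) auto
qed (blast intro: word_eq.sym word_eq.trans)+

lemmas word_eq_Cons = word_eq_append [where us = "[i]" and zs = "[]", simplified] for i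

lemma word_eq_append2:
  assumes "word_eq n xs ys" "word_eq n us zs"
  shows "word_eq n (xs @ us) (ys @ zs)"
  using word_eq_append [OF assms(1), of "[]" us] word_eq_append [OF assms(2), of ys "[]"]
    word_eq_lists [OF assms(1)] word_eq_lists [OF assms(2)]
  by (auto intro: word_eq.trans)

lemma word_eq_rev: "xs \<in> lists {..<n} \<Longrightarrow> word_eq n (xs @ rev xs) []"
proof (induction xs)
  case (Cons i xs)
  have "word_eq n ([i] @ (xs @ rev xs) @ [i]) ([i] @ [] @ [i])"
    using Cons by (intro word_eq_append) auto
  moreover have "word_eq n [i, i] []"
    using word_eq.rel [of "[]" n "[]" i i] Cons.prems by (simp add: coxeter_m_def)
  ultimately show ?case
    by (auto intro: word_eq.trans)
qed (simp add: word_eq.refl)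

lemma word_eq_rev': "xs \<in> lists {..<n} \<Longrightarrow> word_eq n (rev xs @ xs) []"
  using word_eq_rev [of "rev xs" n] by (simp add: in_lists_conv_set)

text \<open>For \<open>i \<noteq> j\<close> the defining relator is \<open>braid i j\<close>
  followed by the reverse of \<open>braid j i\<close>; cancelling the latter turns it into a braid
  relation.\<close>

lemma word_eq_braid:
  assumes "i < 3" "j < 3"
  shows "word_eq 3 (braid i j) (braid j i)"
proof (cases "i = j")
  case False
  let ?b = "braid i j" and ?b' = "braid j i"
  have b: "?b \<in> lists {..<3}" "?b' \<in> lists {..<3}"
    using assms letters_braid by auto
  have "word_eq 3 (?b @ rev ?b') []"
    using word_eq.rel [of "[]" 3 "[]" i j] assms False
    by (auto simp: coxeter_m_simps braid_def numeral_eq_Suc)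
  then have "word_eq 3 ((?b @ rev ?b') @ ?b') ([] @ ?b')"
    using b by (intro word_eq_append2) (auto intro: word_eq.refl)
  moreover have "word_eq 3 (?b @ (rev ?b' @ ?b')) (?b @ [])"
    using b by (intro word_eq_append2 word_eq_rev') (auto intro: word_eq.refl)
  ultimately show ?thesis
    by (auto intro: word_eq.trans word_eq.sym)
qed (use assms in \<open>auto simp: braid_def intro: word_eq.refl\<close>)

definition index :: "nat list \<Rightarrow> nat" where
  "index xs = foldr lmul xs 0"

lemma index_less: "xs \<in> lists {..<3} \<Longrightarrow> index xs < 48"
  by (simp add: index_def foldr_lmul_less)

lemma index_word: "k < 48 \<Longrightarrow> index (word k) = k"
  by (simp add: index_def foldr_lmul_word)

lemma index_Cons: "index (i # xs) = lmul i (index xs)"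
  by (simp add: index_def)

lemma relation_checks:
  "list_all (\<lambda>i. list_all (\<lambda>j. list_all (\<lambda>k.
     foldr lmul (concat (replicate (coxeter_m i j) [i, j])) k = k) indices) [0, 1, 2]) [0, 1, 2]"
proof -
  have "coxeter_m i j = (if i = j then Suc 0 else if i + j = 1 then Suc (Suc (Suc (Suc 0)))
      else if i + j = 3 then Suc (Suc (Suc 0)) else Suc (Suc 0))" if "i < 3" "j < 3" for i j
    using that by (simp add: coxeter_m_simps)
  then show ?thesis
    by (simp add: indices_def lmul_eval)
qed

text \<open>The table satisfies the Coxeter relations on all 48 points, hence is an action of the
  presented group. This separates the 48 classes; \<open>word_eq_word_index\<close> shows that there
  are no others.\<close>

lemma word_eq_index: "word_eq 3 xs ys \<Longrightarrow> index xs = index ys"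
proof (induction rule: word_eq.induct)
  case (rel xs ys i j)
  have "foldr lmul (concat (replicate (coxeter_m i j) [i, j])) (index ys) = index ys"
    using all_indices [OF all_gens [OF all_gens [OF relation_checks]]] rel index_less by blast
  then show ?case by (simp add: index_def)
qed auto

lemma word_eq_braid_append:
  "i < 3 \<Longrightarrow> j < 3 \<Longrightarrow> xs \<in> lists {..<3} \<Longrightarrow> word_eq 3 (braid i j @ xs) (braid j i @ xs)"
  by (auto intro: word_eq_append2 word_eq_braid word_eq.refl)

lemma word_class_eqI: "word_eq n xs ys \<Longrightarrow> word_class n xs = word_class n ys"
  by (auto simp: word_class_def intro: word_eq.trans word_eq.sym)

lemma mem_word_class: "xs \<in> lists {..<n} \<Longrightarrow> xs \<in> word_class n xs"
  by (simp add: word_class_def word_eq.refl)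

lemma word_class_eqD: "xs \<in> lists {..<n} \<Longrightarrow> word_class n ys = word_class n xs \<Longrightarrow> word_eq n ys xs"
  using mem_word_class by (fastforce simp: word_class_def)

definition cls :: "nat \<Rightarrow> cox" where
  "cls k = word_class 3 (word k)"

lemma word_class_Cons:
  "xs \<in> lists {..<n} \<Longrightarrow> i < n \<Longrightarrow> {zs. \<exists>ys\<in>word_class n xs. word_eq n (i # ys) zs} = word_class n (i # xs)"
  by (auto simp: word_class_def intro: word_eq.refl word_eq.trans word_eq_Cons)

text \<open>The exchange argument is applied to left multiplication by a letter on classes of words,
  where the braid relations hold by the presentation.\<close>

lemma word_eq_ascent:
  assumes "i < 3" "k < 48" "ascent i k"
  shows "word_eq 3 (i # word k) (word (lmul i k))"
proof -
  define F where "F = (\<lambda>i X. {zs. \<exists>ys\<in>X. word_eq 3 (i # ys) zs})"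
  have F: "foldr F xs (word_class 3 ys) = word_class 3 (xs @ ys)"
    if "xs \<in> lists {..<3}" "ys \<in> lists {..<3}" for xs ys
    using that(1) by (induction xs) (use that(2) in \<open>auto simp: F_def word_class_Cons\<close>)
  have "F i (foldr F (word k) (word_class 3 [])) = foldr F (word (lmul i k)) (word_class 3 [])"
  proof (rule foldr_word_step [where D = "word_class 3 ` lists {..<3}"])
    show "foldr F (braid i j) y = foldr F (braid j i) y"
      if ij: "i < 3" "j < 3" and y: "y \<in> word_class 3 ` lists {..<3}" for i j y
    proof -
      obtain xs where "xs \<in> lists {..<3}" "y = word_class 3 xs"
        using y by (rule imageE)
      then show ?thesis
        using ij word_class_eqI [OF word_eq_braid_append [of i j xs]] by (simp add: F letters_braid)
    qed
    show "F i y \<in> word_class 3 ` lists {..<3}" if "i < 3" and y: "y \<in> word_class 3 ` lists {..<3}" for i y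
    proof -
      obtain xs where "xs \<in> lists {..<3}" "y = word_class 3 xs"
        using y by (rule imageE)
      then show ?thesis
        using \<open>i < 3\<close> by (simp add: F_def word_class_Cons)
    qed
  qed (use assms in auto)
  moreover have "lmul i k < 48"
    using assms by (simp add: lmul_less)
  ultimately have "word_class 3 (i # word k) = word_class 3 (word (lmul i k))"
    using assms F [of "i # word k" "[]"] F [of "word (lmul i k)" "[]"] letters_word by simp
  then show ?thesis
    using \<open>lmul i k < 48\<close> letters_word word_class_eqD by blast
qed

lemma word_eq_word_index: "xs \<in> lists {..<3} \<Longrightarrow> word_eq 3 xs (word (index xs))"
proof (induction xs)
  case (Cons i xs)
  let ?k = "index xs"
  have k: "i < 3" "?k < 48" "lmul i ?k < 48"
    using Cons index_less lmul_less by auto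
  have 1: "word_eq 3 (i # xs) (i # word ?k)"
    using Cons by (intro word_eq_Cons) auto
  show ?case
  proof (cases "ascent i ?k")
    case True
    then show ?thesis
      using 1 word_eq_ascent [OF k(1,2)] by (auto simp: index_Cons intro: word_eq.trans)
  next
    case False
    \<comment> \<open>At a descent, \<open>word ?k\<close> is traded for a word starting with
      \<open>i\<close>, and the two adjacent letters \<open>i\<close> cancel.\<close>
    then have "word_eq 3 (i # word (lmul i ?k)) (word ?k)"
      using k word_eq_ascent [OF k(1,3)] by (simp add: ascent_lmul lmul_lmul)
    then have "word_eq 3 (i # i # word (lmul i ?k)) (i # word ?k)"
      using k by (intro word_eq_Cons) auto
    moreover have "word_eq 3 ([i, i] @ word (lmul i ?k)) ([] @ word (lmul i ?k))"
      using word_eq_rev [of "[i]" 3] k letters_word by (intro word_eq_append2 word_eq.refl) auto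
    ultimately show ?thesis
      unfolding index_Cons using 1 by (metis append.simps word_eq.trans word_eq.sym)
  qed
qed (simp add: index_def word_eq.refl)

lemma word_eq_iff_index:
  "xs \<in> lists {..<3} \<Longrightarrow> ys \<in> lists {..<3} \<Longrightarrow> word_eq 3 xs ys \<longleftrightarrow> index xs = index ys"
  by (metis word_eq_index word_eq_word_index word_eq.sym word_eq.trans)

lemma word_class_index: "xs \<in> lists {..<3} \<Longrightarrow> word_class 3 xs = cls (index xs)"
  unfolding cls_def by (intro word_class_eqI word_eq_word_index)

lemma mem_cls: "k < 48 \<Longrightarrow> xs \<in> cls k \<longleftrightarrow> xs \<in> lists {..<3} \<and> index xs = k"
  unfolding cls_def word_class_def
  using word_eq_iff_index [of "word k" xs] word_eq_lists [of 3 "word k" xs]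
  by (auto simp: letters_word index_word)

lemma cls_inject: "j < 48 \<Longrightarrow> k < 48 \<Longrightarrow> cls j = cls k \<longleftrightarrow> j = k"
  by (metis index_word letters_word mem_cls)

lemma carrier_W: "carrier (W n) = word_class n ` lists {..<n}"
  by (auto simp: W_def quotient_def word_class_def)

lemma carrier_W3: "carrier (W 3) = cls ` {..<48}"
proof
  show "carrier (W 3) \<subseteq> cls ` {..<48}"
    unfolding carrier_W using word_class_index index_less by blast
  show "cls ` {..<48} \<subseteq> carrier (W 3)"
    unfolding carrier_W using letters_word by (auto simp: cls_def)
qed

lemma mult_W:
  assumes "xs \<in> lists {..<n}" "ys \<in> lists {..<n}"
  shows "word_class n xs \<otimes>\<^bsub>W n\<^esub> word_class n ys = word_class n (xs @ ys)"
  unfolding W_def word_class_def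
  using assms by (auto intro: word_eq.refl word_eq.trans word_eq_append2)

lemma one_W3: "\<one>\<^bsub>W 3\<^esub> = cls 0"
  by (simp add: W_def cls_def)

lemma gen_index: "i < 3 \<Longrightarrow> gen 3 i = cls (index [i])"
  by (simp add: gen_def word_class_index)

lemma gen_mult: "i < 3 \<Longrightarrow> k < 48 \<Longrightarrow> gen 3 i \<otimes>\<^bsub>W 3\<^esub> cls k = cls (lmul i k)"
  using mult_W [of "[i]" 3 "word k"] letters_word [of k] word_class_index [of "i # word k"]
  by (simp add: gen_def cls_def index_Cons index_word)

lemma group_W: "Group.group (W n)"
proof (rule groupI)
  have one: "\<one>\<^bsub>W n\<^esub> = word_class n []" by (simp add: W_def)
  fix x assume "x \<in> carrier (W n)"
  then obtain xs where xs: "xs \<in> lists {..<n}" "x = word_class n xs" by (auto simp: carrier_W)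
  have rev: "rev xs \<in> lists {..<n}" using xs by (simp add: in_lists_conv_set)
  show "\<one>\<^bsub>W n\<^esub> \<otimes>\<^bsub>W n\<^esub> x = x"
    using xs by (simp add: one mult_W)
  show "\<exists>y\<in>carrier (W n). y \<otimes>\<^bsub>W n\<^esub> x = \<one>\<^bsub>W n\<^esub>"
    using xs rev word_class_eqI [OF word_eq_rev'] by (auto simp: carrier_W one mult_W)
  fix y assume "y \<in> carrier (W n)"
  then obtain ys where ys: "ys \<in> lists {..<n}" "y = word_class n ys" by (auto simp: carrier_W)
  show "x \<otimes>\<^bsub>W n\<^esub> y \<in> carrier (W n)"
    unfolding xs ys mult_W [OF xs(1) ys(1)] carrier_W
    by (rule imageI) (use xs ys in simp)
  fix z assume "z \<in> carrier (W n)"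
  then obtain zs where zs: "zs \<in> lists {..<n}" "z = word_class n zs" by (auto simp: carrier_W)
  show "x \<otimes>\<^bsub>W n\<^esub> y \<otimes>\<^bsub>W n\<^esub> z = x \<otimes>\<^bsub>W n\<^esub> (y \<otimes>\<^bsub>W n\<^esub> z)"
    using xs ys zs by (simp add: mult_W)
next
  show "\<one>\<^bsub>W n\<^esub> \<in> carrier (W n)"
    unfolding carrier_W by (simp add: W_def)
qed

lemma inv_cls:
  assumes "k < 48"
  shows "inv\<^bsub>W 3\<^esub> (cls k) = cls (index (rev (word k)))"
proof (rule group.inv_equality [OF group_W])
  have rev: "rev (word k) \<in> lists {..<3}" and k: "word k \<in> lists {..<3}"
    using letters_word [OF assms] by (simp_all add: in_lists_conv_set)
  then have "cls (index (rev (word k))) \<otimes>\<^bsub>W 3\<^esub> cls k = word_class 3 (rev (word k) @ word k)"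
    by (metis cls_def mult_W word_class_index)
  then show "cls (index (rev (word k))) \<otimes>\<^bsub>W 3\<^esub> cls k = \<one>\<^bsub>W 3\<^esub>"
    using word_class_eqI [OF word_eq_rev' [OF k]] by (simp add: one_W3 cls_def)
  show "cls k \<in> carrier (W 3)" "cls (index (rev (word k))) \<in> carrier (W 3)"
    using assms rev index_less by (auto simp: carrier_W3)
qed

lemma wlen_index_le: "xs \<in> lists {..<3} \<Longrightarrow> wlen (index xs) \<le> length xs"
  using wlen_foldr_lmul_le [of xs 0] by (simp add: index_def)

lemma len_cls: "k < 48 \<Longrightarrow> len (cls k) = wlen k"
  unfolding len_def
proof (rule Least_equality)
  assume "k < 48"
  then show "\<exists>xs\<in>cls k. length xs = wlen k"
    by (intro bexI [of _ "word k"]) (auto simp: mem_cls letters_word index_word wlen_def)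
next
  fix m assume "k < 48" "\<exists>xs\<in>cls k. length xs = m"
  then obtain xs where "xs \<in> cls k" "length xs = m" by (elim bexE)
  then show "wlen k \<le> m"
    using wlen_index_le [of xs] mem_cls [OF \<open>k < 48\<close>] by simp
qed

lemma reduced_iff:
  "k < 48 \<Longrightarrow> reduced (cls k) xs \<longleftrightarrow> xs \<in> lists {..<3} \<and> index xs = k \<and> length xs = wlen k"
  by (auto simp: reduced_def mem_cls len_cls)

lemma reduced_word: "k < 48 \<Longrightarrow> reduced (cls k) (word k)"
  by (simp add: reduced_iff letters_word index_word wlen_def)

text \<open>A subword of a reduced word that represents a different element omits at least one
  letter. Length thus refines the Bruhat order, and the later triangularity arguments use length
  alone.\<close>

lemma bruhat_less_wlen:
  assumes "j < 48" "k < 48" "bruhat_less (cls j) (cls k)"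
  shows "wlen j < wlen k"
proof -
  obtain xs ys where *: "reduced (cls k) xs" "ys \<in> cls j" "subseq ys xs" "j \<noteq> k"
    using assms by (auto simp: bruhat_less_def)
  have "length ys \<le> length xs" "length ys = length xs \<Longrightarrow> ys = xs"
    using list_emb_length [OF *(3)] subseq_same_length [OF *(3)] by simp_all
  moreover have ne: "ys \<noteq> xs"
    using *(1,2,4) assms by (auto simp: reduced_iff mem_cls)
  moreover have "wlen j \<le> length ys"
    using *(2) mem_cls [OF assms(1)] wlen_index_le [of ys] by simp
  ultimately show ?thesis
    using *(1) ne assms(2) by (fastforce simp: reduced_iff)
qed

section \<open>The Iwahori--Hecke algebra\<close>

abbreviation lookup where "lookup \<equiv> Poly_Mapping.lookup"
abbreviation keys where "keys \<equiv> Poly_Mapping.keys"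

lemma smul_module: "Modules.module smul"
  by (rule hecke.module_axioms)

text \<open>Linear extension from the basis T_w to an arbitrary module \<open>s\<close>. Keeping
  \<open>s\<close> general covers the generator action, the product, the semilinear bar map and the
  representation on triples.\<close>

lemma module_hom_ext:
  assumes "Modules.module s"
  shows "module_hom smul s (\<lambda>h. \<Sum>w\<in>keys h. s (lookup h w) (F w))"
proof -
  interpret s: Modules.module s by fact
  show ?thesis
    unfolding module_hom_iff
  proof (intro conjI allI smul_module assms)
    fix x y
    show "(\<Sum>w\<in>keys (x + y). s (lookup (x + y) w) (F w)) =
        (\<Sum>w\<in>keys x. s (lookup x w) (F w)) + (\<Sum>w\<in>keys y. s (lookup y w) (F w))"
      by (rule setsum_keys_plus_distrib) (simp_all add: s.scale_left_distrib)
  next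
    fix c x
    have "(\<Sum>w\<in>keys (smul c x). s (lookup (smul c x) w) (F w)) =
        (\<Sum>w\<in>keys x. s (lookup (smul c x) w) (F w))"
      by (rule sum.mono_neutral_left) (auto simp: in_keys_iff lookup_smul)
    then show "(\<Sum>w\<in>keys (smul c x). s (lookup (smul c x) w) (F w)) =
        s c (\<Sum>w\<in>keys x. s (lookup x w) (F w))"
      by (simp add: lookup_smul s.scale_sum_right)
  qed
qed

lemma ext_T:
  assumes "Modules.module s"
  shows "(\<Sum>w\<in>keys (T x). s (lookup (T x) w) (F w)) = F x"
proof -
  interpret s: Modules.module s by fact
  show ?thesis by (simp add: T_def)
qed

abbreviation hecke_linear :: "(hecke \<Rightarrow> hecke) \<Rightarrow> bool" where
  "hecke_linear \<equiv> module_hom smul smul"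

lemma hecke_linearD:
  assumes "hecke_linear f"
  shows "f (x + y) = f x + f y" "f (smul c x) = smul c (f x)" "f 0 = 0" "f (x - y) = f x - f y"
    "f (sum g A) = (\<Sum>a\<in>A. f (g a))"
proof -
  interpret module_hom smul smul f by fact
  show "f (x + y) = f x + f y" "f (smul c x) = smul c (f x)" "f 0 = 0" "f (x - y) = f x - f y"
    "f (sum g A) = (\<Sum>a\<in>A. f (g a))"
    by (simp_all add: add scale zero diff sum)
qed

lemma hecke_linear_foldr: "(\<And>i. hecke_linear (F i)) \<Longrightarrow> hecke_linear (foldr F xs)"
proof (induction xs)
  case Nil
  then show ?case using hecke.module_hom_id by (simp add: id_def)
next
  case (Cons i xs)
  then show ?case
    using module_hom_compose [of smul smul "foldr F xs" smul "F i"] by (simp add: comp_def)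
qed

definition e :: "nat \<Rightarrow> hecke" where
  "e k = T (cls k)"

abbreviation H3 :: "hecke set" where
  "H3 \<equiv> hecke_carrier 3"

lemma H3_iff: "h \<in> H3 \<longleftrightarrow> keys h \<subseteq> cls ` {..<48}"
  by (simp add: hecke_carrier_def carrier_W3)

lemma lookup_e: "j < 48 \<Longrightarrow> k < 48 \<Longrightarrow> lookup (e j) (cls k) = (if j = k then 1 else 0)"
  by (simp add: e_def T_def lookup_single cls_inject when_def)

lemma hecke_sum_e:
  assumes "h \<in> H3"
  shows "h = (\<Sum>k<48. smul (lookup h (cls k)) (e k))"
proof (rule poly_mapping_eqI)
  fix w
  show "lookup h w = lookup (\<Sum>k<48. smul (lookup h (cls k)) (e k)) w"
  proof (cases "w \<in> cls ` {..<48}")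
    case True
    then obtain j where "j < 48" "w = cls j" by auto
    then show ?thesis
      by (simp add: lookup_sum lookup_smul lookup_e sum.delta' if_distrib cong: if_cong)
  next
    case False
    then have "lookup h w = 0" using assms by (auto simp: H3_iff in_keys_iff)
    moreover have "lookup (e k) w = 0" if "k < 48" for k
      using False that by (auto simp: e_def T_def lookup_single when_def)
    ultimately show ?thesis by (simp add: lookup_sum lookup_smul)
  qed
qed

lemma H3_span: "H3 = A_span (e ` {..<48})"
proof
  show "H3 \<subseteq> A_span (e ` {..<48})"
  proof
    fix h assume "h \<in> H3"
    then show "h \<in> A_span (e ` {..<48})"
      by (subst hecke_sum_e, assumption)
        (intro hecke.span_sum hecke.span_scale hecke.span_base imageI, simp)
  qed
  have "hecke.subspace H3"
    unfolding hecke.subspace_def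
  proof (intro conjI ballI allI)
    fix x y c assume *: "x \<in> H3" "y \<in> H3"
    show "x + y \<in> H3"
      using * Poly_Mapping.keys_add [of x y] unfolding H3_iff by (meson Un_least order_trans)
    have "keys (smul c x) \<subseteq> keys x"
      by (auto simp: in_keys_iff lookup_smul)
    then show "smul c x \<in> H3"
      using * unfolding H3_iff by (meson order_trans)
  qed (simp add: H3_iff)
  moreover have "e ` {..<48} \<subseteq> H3"
    by (auto simp: H3_iff e_def T_def)
  ultimately show "A_span (e ` {..<48}) \<subseteq> H3"
    by (simp add: hecke.span_minimal)
qed

lemma H3_simps [simp]:
  "0 \<in> H3" "g \<in> H3 \<Longrightarrow> h \<in> H3 \<Longrightarrow> g + h \<in> H3" "h \<in> H3 \<Longrightarrow> smul c h \<in> H3"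
  "g \<in> H3 \<Longrightarrow> h \<in> H3 \<Longrightarrow> g - h \<in> H3" "k < 48 \<Longrightarrow> e k \<in> H3"
  by (auto simp: H3_span intro: hecke.span_zero hecke.span_add hecke.span_scale
      hecke.span_diff hecke.span_base)

lemma H3_sum: "(\<And>a. a \<in> A \<Longrightarrow> f a \<in> H3) \<Longrightarrow> sum f A \<in> H3"
  by (auto simp: H3_span intro: hecke.span_sum)

lemma hecke_linear_eqI:
  assumes "module_hom smul s f" "module_hom smul s g" "\<And>k. k < 48 \<Longrightarrow> f (e k) = g (e k)" "h \<in> H3"
  shows "f h = g h"
proof -
  interpret module_pair smul s
    using assms(1) by (simp add: module_hom_iff module_pair_def)
  show ?thesis
    by (rule module_hom_eq_on_span [OF assms(1,2), where B = "e ` {..<48}"])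
      (use assms(3,4) in \<open>auto simp: H3_span A_span_def\<close>)
qed

lemma hecke_linear_H3:
  assumes "hecke_linear f" "\<And>k. k < 48 \<Longrightarrow> f (e k) \<in> H3" "h \<in> H3"
  shows "f h \<in> H3"
  by (subst hecke_sum_e [OF assms(3)])
    (auto simp: hecke_linearD [OF assms(1)] intro!: H3_sum assms(2) H3_simps)

subsection \<open>Multiplication by a generator\<close>

definition vv :: "nat \<Rightarrow> laurent" where
  "vv i = v_gen i - v_gen_inv i"

abbreviation L :: "nat \<Rightarrow> hecke \<Rightarrow> hecke" where
  "L \<equiv> T_gen_act 3"

lemma L_linear: "hecke_linear (L i)"
  using module_hom_ext [OF smul_module, of "T_gen_T 3 i"] by (simp add: T_gen_act_def [abs_def])

lemmas L_simps = hecke_linearD [OF L_linear]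
lemmas foldr_L_simps = hecke_linearD [OF hecke_linear_foldr [OF L_linear]]

lemma L_e:
  assumes "i < 3" "k < 48"
  shows "L i (e k) = (if ascent i k then e (lmul i k) else e (lmul i k) + smul (vv i) (e k))"
proof -
  have "L i (e k) = T_gen_T 3 i (cls k)"
    using ext_T [OF smul_module, of "cls k" "T_gen_T 3 i"] by (simp add: T_gen_act_def e_def)
  then show ?thesis
    using assms by (simp add: T_gen_T_def gen_mult len_cls lmul_less ascent_def e_def vv_def)
qed

lemma L_H3 [simp]: "i < 3 \<Longrightarrow> h \<in> H3 \<Longrightarrow> L i h \<in> H3"
  by (rule hecke_linear_H3 [OF L_linear]) (auto simp: L_e lmul_less)

lemma foldr_L_H3: "xs \<in> lists {..<3} \<Longrightarrow> h \<in> H3 \<Longrightarrow> foldr L xs h \<in> H3"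
  by (induction xs) auto

lemma L_quadratic:
  assumes "i < 3" "h \<in> H3"
  shows "L i (L i h) = h + smul (vv i) (L i h)"
proof (rule hecke_linear_eqI [OF _ _ _ assms(2)])
  show "hecke_linear (\<lambda>h. L i (L i h))"
    using module_hom_compose [OF L_linear [of i] L_linear [of i]] by (simp add: comp_def)
  show "hecke_linear (\<lambda>h. h + smul (vv i) (L i h))"
    by (auto simp: module_hom_iff smul_module L_simps hecke.scale_right_distrib ac_simps)
qed (use assms in \<open>auto simp: L_e lmul_less lmul_lmul ascent_lmul L_simps hecke.scale_right_distrib ac_simps\<close>)

text \<open>The vectors on which a braid relation holds are stable under the two generators involved;
  hence it suffices to check it on shortest coset representatives, where no quadratic
  relation intervenes.\<close>

lemma braid_stable:
  assumes ij: "i < 3" "j < 3" and x: "x \<in> H3" and eq: "foldr L (braid i j) x = foldr L (braid j i) x"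
  shows "foldr L (braid i j) (L i x) = foldr L (braid j i) (L i x)"
proof -
  consider "i = j" | "i + j = 1" | "i + j = 3" "i \<noteq> j" | "i + j = 2" "i \<noteq> j"
    using ij by linarith
  then show ?thesis
  proof cases
    case 2
    moreover from this have "i \<noteq> j" by presburger
    ultimately have b: "foldr L (braid i j) y = L i (L j (L i (L j y)))"
      "foldr L (braid j i) y = L j (L i (L j (L i y)))" for y
      by (auto simp: braid_def)
    have "L i (L j (L i (L j (L i x)))) = L i (L i (L j (L i (L j x))))"
      using eq by (simp add: b)
    also have "\<dots> = L j (L i (L j x)) + smul (vv i) (L i (L j (L i (L j x))))"
      using ij x by (simp add: L_quadratic)
    also have "\<dots> = L j (L i (L j x)) + smul (vv i) (L j (L i (L j (L i x))))"
      using eq by (simp add: b)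
    also have "\<dots> = L j (L i (L j (L i (L i x))))"
      using ij x by (simp add: L_quadratic L_simps)
    finally show ?thesis by (simp add: b)
  next
    case 3
    then have *: "vv i = vv j"
      using ij by (auto simp: vv_def v_gen_def v_gen_inv_def)
    from 3 have b: "foldr L (braid i j) y = L i (L j (L i y))"
      "foldr L (braid j i) y = L j (L i (L j y))" for y
      by (auto simp: braid_def)
    have "L i (L j (L i (L i x))) = L i (L j x) + smul (vv j) (L j (L i (L j x)))"
      using ij x eq by (simp add: b L_quadratic L_simps *)
    also have "\<dots> = L j (L j (L i (L j x)))"
      using ij x by (simp add: L_quadratic)
    also have "\<dots> = L j (L i (L j (L i x)))"
      using eq by (simp add: b)
    finally show ?thesis by (simp add: b)
  next
    case 4
    then have b: "foldr L (braid i j) y = L i (L j y)" "foldr L (braid j i) y = L j (L i y)" for y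
      by (auto simp: braid_def)
    have "L i (L j (L i x)) = L i (L i (L j x))"
      using eq by (simp add: b)
    also have "\<dots> = L j x + smul (vv i) (L i (L j x))"
      using ij x by (simp add: L_quadratic)
    also have "\<dots> = L j x + smul (vv i) (L j (L i x))"
      using eq by (simp add: b)
    also have "\<dots> = L j (L i (L i x))"
      using ij x by (simp add: L_quadratic L_simps)
    finally show ?thesis by (simp add: b)
  qed auto
qed

lemma foldr_L_ascents:
  assumes "xs \<in> lists {..<3}" "k < 48" "wlen (foldr lmul xs k) = wlen k + length xs"
  shows "foldr L xs (e k) = e (foldr lmul xs k)"
  using assms
proof (induction xs rule: list.induct)
  case (Cons i xs)
  let ?j = "foldr lmul xs k"
  have "i < 3" "?j < 48" "wlen ?j \<le> wlen k + length xs"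
    using Cons.prems foldr_lmul_less [of xs k] wlen_foldr_lmul_le [of xs k] by auto
  then show ?case
    using Cons wlen_lmul [of i ?j] by (auto simp: L_e split: if_splits)
qed simp

lemma L_braid_e:
  assumes "i < 3" "j < 3" "k < 48"
  shows "foldr L (braid i j) (e k) = foldr L (braid j i) (e k)"
  using assms
proof (induction "wlen k" arbitrary: i j k rule: less_induct)
  case less
  have *: "foldr L (braid i j) (e k) = foldr L (braid j i) (e k)"
    if "\<not> ascent i k" "i < 3" "j < 3" for i j
  proof -
    have k: "lmul i k < 48" "wlen k = Suc (wlen (lmul i k))"
      using that less.prems by (auto simp: lmul_less not_ascent_wlen)
    have "e k = L i (e (lmul i k))"
      using that less.prems k by (simp add: L_e ascent_lmul lmul_lmul)
    moreover have "foldr L (braid i j) (e (lmul i k)) = foldr L (braid j i) (e (lmul i k))"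
      using that k by (intro less.hyps) auto
    then have "foldr L (braid i j) (L i (e (lmul i k))) = foldr L (braid j i) (L i (e (lmul i k)))"
      using that k by (intro braid_stable) auto
    ultimately show ?thesis by simp
  qed
  show ?case
  proof (cases "ascent i k \<and> ascent j k")
    case True
    then show ?thesis
      using less.prems wlen_braid_minimal [of i j k] wlen_braid_minimal [of j i k]
        foldr_L_ascents [OF letters_braid, of i j k] foldr_L_ascents [OF letters_braid, of j i k]
      by (simp add: lmul_braid [of i j])
  next
    case False
    then show ?thesis
      using * [of i j] * [of j i] less.prems by auto
  qed
qed

lemma L_braid:
  assumes "i < 3" "j < 3" "h \<in> H3"
  shows "foldr L (braid i j) h = foldr L (braid j i) h"
  by (rule hecke_linear_eqI [OF hecke_linear_foldr hecke_linear_foldr _ assms(3)])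
    (use assms in \<open>auto simp: L_linear intro: L_braid_e\<close>)

text \<open>This removes the choice of a reduced word from the definition of the product.\<close>

lemma foldr_L_reduced:
  assumes "k < 48" "reduced (cls k) xs" "h \<in> H3"
  shows "foldr L xs h = foldr L (word k) h"
  using assms foldr_reduced_word [where F = L and D = H3 and x = h and xs = xs]
  by (auto simp: reduced_iff index_def L_braid simp del: in_lists_conv_set)

subsection \<open>The product\<close>

abbreviation hmult :: "hecke \<Rightarrow> hecke \<Rightarrow> hecke"  (infixl "\<star>" 70) where
  "g \<star> h \<equiv> hecke_mult 3 g h"

lemma hmult_linear: "hecke_linear (\<lambda>g. g \<star> h)"
  unfolding hecke_mult_def by (rule module_hom_ext [OF smul_module])

lemmas hmult_simps = hecke_linearD [OF hmult_linear]

lemma hmult_e: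
  assumes "k < 48" "h \<in> H3"
  shows "e k \<star> h = foldr L (word k) h"
proof -
  have "e k \<star> h = foldr L (SOME xs. reduced (cls k) xs) h"
    unfolding hecke_mult_def e_def by (rule ext_T [OF smul_module])
  moreover have "reduced (cls k) (SOME xs. reduced (cls k) xs)"
    using reduced_word [OF assms(1)] by (rule someI)
  ultimately show ?thesis
    using foldr_L_reduced assms by simp
qed

lemma hmult_H3 [simp]: "g \<in> H3 \<Longrightarrow> h \<in> H3 \<Longrightarrow> g \<star> h \<in> H3"
  by (rule hecke_linear_H3 [OF hmult_linear]) (auto simp: hmult_e foldr_L_H3 letters_word)

lemma hmult_linear2: "hecke_linear ((\<star>) g)"
proof -
  have lin: "hecke_linear (foldr L xs)" for xs
    by (rule hecke_linear_foldr [OF L_linear])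
  show ?thesis
    unfolding hecke_mult_def module_hom_iff
    by (simp add: smul_module hecke_linearD [OF lin] hecke.scale_right_distrib sum.distrib
        hecke.scale_sum_right mult.commute)
qed

lemmas hmult_simps2 = hecke_linearD [OF hmult_linear2]

lemma hmult_one [simp]: "h \<in> H3 \<Longrightarrow> e 0 \<star> h = h"
  by (simp add: hmult_e)

lemma foldr_L_word: "k < 48 \<Longrightarrow> foldr L (word k) (e 0) = e k"
  using foldr_L_ascents [of "word k" 0] by (simp add: letters_word foldr_lmul_word wlen_def)

lemma hmult_one2 [simp]:
  assumes "h \<in> H3"
  shows "h \<star> e 0 = h"
  by (rule hecke_linear_eqI [OF hmult_linear hecke.module_hom_ident _ assms])
    (simp add: hmult_e foldr_L_word)

text \<open>Associativity with a generator in front. At an ascent it is the exchange argument for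
  \<open>L\<close>; at a descent T_k is written as T_i times a shorter basis element and the
  quadratic relation is used on both sides.\<close>

lemma L_hmult:
  assumes "i < 3" "g \<in> H3" "h \<in> H3"
  shows "L i g \<star> h = L i (g \<star> h)"
proof (rule hecke_linear_eqI [OF _ _ _ assms(2)])
  show "hecke_linear (\<lambda>g. L i g \<star> h)" "hecke_linear (\<lambda>g. L i (g \<star> h))"
    using module_hom_compose [OF L_linear [of i] hmult_linear [of h]]
      module_hom_compose [OF hmult_linear [of h] L_linear [of i]] by (simp_all add: comp_def)
  have asc: "e (lmul i k) \<star> h = L i (e k \<star> h)" if "k < 48" "ascent i k" for k
    using that assms foldr_word_step [where F = L and D = H3 and x = h]
    by (simp add: hmult_e lmul_less L_braid)
  show "L i (e k) \<star> h = L i (e k \<star> h)" if k: "k < 48" for k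
  proof (cases "ascent i k")
    case True
    then show ?thesis using k assms by (simp add: L_e asc)
  next
    case False
    let ?j = "lmul i k"
    have j: "?j < 48" "ascent i ?j" "lmul i ?j = k"
      using k assms False by (simp_all add: lmul_less ascent_lmul lmul_lmul)
    have "e k \<star> h = L i (e ?j \<star> h)"
      using asc [OF j(1,2)] j(3) by simp
    then show ?thesis
      using False assms j k by (simp add: L_e hmult_simps L_quadratic)
  qed
qed

lemma foldr_L_hmult:
  "xs \<in> lists {..<3} \<Longrightarrow> g \<in> H3 \<Longrightarrow> h \<in> H3 \<Longrightarrow> foldr L xs g \<star> h = foldr L xs (g \<star> h)"
proof (induction xs rule: list.induct)
  case (Cons i xs)
  then show ?case using foldr_L_H3 [of xs g] by (simp add: L_hmult)
qed simp

lemma hmult_assoc: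
  assumes "f \<in> H3" "g \<in> H3" "h \<in> H3"
  shows "f \<star> g \<star> h = f \<star> (g \<star> h)"
proof (rule hecke_linear_eqI [OF _ hmult_linear _ assms(1)])
  show "hecke_linear (\<lambda>f. f \<star> g \<star> h)"
    using module_hom_compose [OF hmult_linear [of g] hmult_linear [of h]] by (simp add: comp_def)
qed (use assms in \<open>simp add: hmult_e foldr_L_hmult letters_word\<close>)

section \<open>Computing with Laurent polynomials and Hecke algebra elements\<close>

text \<open>The triple \<open>(a, b, c)\<close> stands for $c V^a v^b$; lists of triples are kept sorted by
  exponents. Dense lists of 48 such polynomials stand for elements of the Hecke algebra.\<close>

type_synonym lpol = "(int \<times> int \<times> int) list"

definition pval :: "lpol \<Rightarrow> laurent" where
  "pval p = (\<Sum>(a, b, c)\<leftarrow>p. Poly_Mapping.single (a, b) c)"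

text \<open>Vanishing coefficients are dropped, so that sorted lists act as normal forms and
  polynomial identities can be tested as equality of lists.\<close>

fun padd :: "lpol \<Rightarrow> lpol \<Rightarrow> lpol" where
  "padd [] q = q"
| "padd p [] = p"
| "padd ((a, b, c) # p) ((a', b', c') # q) =
     (if a = a' \<and> b = b' then (if c + c' = 0 then padd p q else (a, b, c + c') # padd p q)
      else if a < a' \<or> (a = a' \<and> b < b') then (a, b, c) # padd p ((a', b', c') # q)
      else (a', b', c') # padd ((a, b, c) # p) q)"

fun pshift :: "int \<times> int \<times> int \<Rightarrow> lpol \<Rightarrow> lpol" where
  "pshift m [] = []"
| "pshift (a, b, c) ((a', b', c') # p) = (a + a', b + b', c * c') # pshift (a, b, c) p"

fun pmul :: "lpol \<Rightarrow> lpol \<Rightarrow> lpol" where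
  "pmul [] q = []"
| "pmul (m # p) q = padd (pshift m q) (pmul p q)"

lemma pval_Nil [simp]: "pval [] = 0"
  and pval_Cons: "pval ((a, b, c) # p) = Poly_Mapping.single (a, b) c + pval p"
  by (simp_all add: pval_def)

lemma pval_padd: "pval (padd p q) = pval p + pval q"
proof (induction p q rule: padd.induct)
  case (3 a b c p a' b' c' q)
  show ?case
  proof (cases "a = a' \<and> b = b'")
    case True
    then have "pval (padd ((a, b, c) # p) ((a', b', c') # q)) =
        Poly_Mapping.single (a, b) (c + c') + (pval p + pval q)"
      using 3(1,2) by (cases "c + c' = 0") (simp_all add: pval_Cons)
    also have "\<dots> = pval ((a, b, c) # p) + pval ((a', b', c') # q)"
      using True by (simp add: pval_Cons single_add algebra_simps)
    finally show ?thesis .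
  next
    case False
    then show ?thesis
      using 3(3,4) by (cases "a < a' \<or> a = a' \<and> b < b'") (auto simp: pval_Cons algebra_simps)
  qed
qed simp_all

lemma pval_pshift: "pval (pshift (a, b, c) p) = Poly_Mapping.single (a, b) c * pval p"
  by (induction p) (auto simp: pval_Cons mult_single distrib_left)

lemma pval_pmul: "pval (pmul p q) = pval p * pval q"
proof (induction p)
  case (Cons m p)
  then show ?case by (cases m) (simp add: pval_padd pval_pshift pval_Cons distrib_right)
qed simp

subsection \<open>The bar involution of the coefficient ring\<close>

lemma laurent_induct [case_names zero single add]:
  assumes "P 0" "\<And>k c. P (Poly_Mapping.single k c)" "\<And>a b. P a \<Longrightarrow> P b \<Longrightarrow> P (a + b)"
  shows "P (a :: laurent)"
proof (induction a rule: Poly_Mapping.update_induct)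
  case (update f k c)
  have "Poly_Mapping.update k c f = Poly_Mapping.single k c + f"
    using update by (intro poly_mapping_eqI)
      (auto simp: lookup_update lookup_add lookup_single when_def in_keys_iff)
  then show ?case
    using update assms by metis
qed (use assms in auto)

lemma lookup_laurent_bar: "lookup (laurent_bar a) k = lookup a (- k)"
  by (simp add: laurent_bar_def map_key.rep_eq)

lemma laurent_bar_add: "laurent_bar (a + b) = laurent_bar a + laurent_bar b"
  and laurent_bar_0: "laurent_bar 0 = 0"
  by (rule poly_mapping_eqI, simp add: lookup_laurent_bar lookup_add)+

lemma laurent_bar_single: "laurent_bar (Poly_Mapping.single k c) = Poly_Mapping.single (- k) c"
  by (rule poly_mapping_eqI, cases k) (auto simp: lookup_laurent_bar lookup_single when_def)

lemma laurent_bar_mult: "laurent_bar (a * b) = laurent_bar a * laurent_bar b"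
proof (induction a rule: laurent_induct)
  case (single k c)
  show ?case
    by (induction b rule: laurent_induct)
      (simp_all add: laurent_bar_single laurent_bar_add laurent_bar_0 mult_single distrib_left)
qed (simp_all add: laurent_bar_add laurent_bar_0 distrib_right)

lemma laurent_bar_1: "laurent_bar 1 = 1"
  using laurent_bar_single [of 0 1] by simp

lemma laurent_bar_diff: "laurent_bar (a - b) = laurent_bar a - laurent_bar b"
  by (rule poly_mapping_eqI) (simp add: lookup_laurent_bar lookup_minus)

lemma laurent_bar_v: "laurent_bar (v_gen i) = v_gen_inv i" "laurent_bar (v_gen_inv i) = v_gen i"
  by (simp_all add: v_gen_def v_gen_inv_def monom_def laurent_bar_single)

lemma single_00: "Poly_Mapping.single (0, 0) 1 = (1 :: laurent)"
  by (metis single_one zero_prod_def)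

lemma v_gen_inv_mult: "v_gen_inv i * v_gen i = 1"
  by (simp add: v_gen_def v_gen_inv_def monom_def mult_single single_00)

fun pbar :: "lpol \<Rightarrow> lpol" where
  "pbar [] = []"
| "pbar ((a, b, c) # p) = (- a, - b, c) # pbar p"

lemma pval_pbar: "pval (pbar p) = laurent_bar (pval p)"
  by (induction p rule: pbar.induct)
    (simp_all add: pval_Cons laurent_bar_add laurent_bar_single laurent_bar_0)

subsection \<open>Dense lists\<close>

definition hval :: "lpol list \<Rightarrow> hecke" where
  "hval xs = (\<Sum>k<48. smul (pval (xs ! k)) (e k))"

lemma hval_H3 [simp]: "hval xs \<in> H3"
  unfolding hval_def by (intro H3_sum) simp

lemma lookup_hval: "k < 48 \<Longrightarrow> lookup (hval xs) (cls k) = pval (xs ! k)"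
  by (simp add: hval_def lookup_sum lookup_smul lookup_e if_distrib cong: if_cong)

fun hadd :: "lpol list \<Rightarrow> lpol list \<Rightarrow> lpol list" where
  "hadd (p # ps) (q # qs) = padd p q # hadd ps qs"
| "hadd _ _ = []"

lemma hadd_nth: "length ps = length qs \<Longrightarrow> length (hadd ps qs) = length ps \<and>
    (\<forall>k<length ps. hadd ps qs ! k = padd (ps ! k) (qs ! k))"
  by (induction ps qs rule: hadd.induct) (auto simp: nth_Cons split: nat.split)

lemma hval_hadd: "length ps = 48 \<Longrightarrow> length qs = 48 \<Longrightarrow> hval (hadd ps qs) = hval ps + hval qs"
  using hadd_nth [of ps qs]
  by (simp add: hval_def pval_padd hecke.scale_left_distrib sum.distrib)

definition hscale :: "lpol \<Rightarrow> lpol list \<Rightarrow> lpol list" where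
  "hscale p = map (pmul p)"

lemma hval_hscale: "length ps = 48 \<Longrightarrow> hval (hscale p ps) = smul (pval p) (hval ps)"
  by (simp add: hval_def hscale_def pval_pmul hecke.scale_sum_right)

definition hzero :: "lpol list" where
  "hzero = replicate 48 []"

lemma hval_hzero: "hval hzero = 0"
  by (simp add: hval_def hzero_def)

definition hunit :: "nat \<Rightarrow> lpol list" where
  "hunit k = map (\<lambda>j. if j = k then [(0, 0, 1)] else []) indices"

lemma nth_indices: "k < 48 \<Longrightarrow> indices ! k = k"
  by (rule all_indices [of "\<lambda>k. indices ! k = k"]) (simp_all add: indices_def)

lemma length_indices: "length indices = 48"
  by (simp add: indices_def)

lemma hval_hunit: "k < 48 \<Longrightarrow> hval (hunit k) = e k"
  by (simp add: hval_def hunit_def nth_indices length_indices pval_Cons single_00 if_distrib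
      [where f = "\<lambda>x. smul (pval x) y" for y] cong: if_cong)

text \<open>The coefficient at a position collects the one at its image under the generator plus a
  multiple of itself: \<open>p\<close> at an ascent, and at a descent \<open>q\<close>, which
  exceeds \<open>p\<close> by v_i - v_i^-1. The test \<open>j < k\<close> recognizes the
  ascent.\<close>

definition hgen :: "nat \<Rightarrow> lpol \<Rightarrow> lpol \<Rightarrow> lpol list \<Rightarrow> lpol list" where
  "hgen i p q xs = map (\<lambda>(j, k). padd (xs ! k) (pmul (if j < k then p else q) (xs ! j)))
     (zip indices (lmul_table ! i))"

lemma length_lmul_table: "i < 3 \<Longrightarrow> length (lmul_table ! i) = 48"
  using all_gens [of "\<lambda>i. length (lmul_table ! i) = 48"] by (simp add: lmul_table_def)

lemma length_hgen: "i < 3 \<Longrightarrow> length (hgen i p q xs) = 48"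
  by (simp add: hgen_def length_indices length_lmul_table)

lemma nth_hgen: "i < 3 \<Longrightarrow> k < 48 \<Longrightarrow> hgen i p q xs ! k =
    padd (xs ! lmul i k) (pmul (if ascent i k then p else q) (xs ! k))"
  by (simp add: hgen_def length_indices length_lmul_table nth_indices lmul_def ascent_iff_less)

lemma sum_lmul:
  assumes "i < 3"
  shows "(\<Sum>k<48. f (lmul i k)) = (\<Sum>k<48. f k)"
  by (rule sum.reindex_bij_witness [of _ "lmul i" "lmul i"])
    (use assms in \<open>auto simp: lmul_lmul lmul_less\<close>)

text \<open>With \<open>p = 0\<close> this is multiplication by $T_i$, with $p = v_i^{-1}$
  multiplication by $T_i + v_i^{-1}$.\<close>

lemma hval_hgen:
  assumes i: "i < 3" and q: "pval q = pval p + vv i"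
  shows "hval (hgen i p q xs) = L i (hval xs) + smul (pval p) (hval xs)"
proof -
  let ?x = "\<lambda>k. pval (xs ! k)"
  have "L i (hval xs) = (\<Sum>k<48. smul (?x k) (e (lmul i k)) +
      smul (if ascent i k then 0 else ?x k * vv i) (e k))"
    unfolding hval_def L_simps
    by (rule sum.cong) (use i in \<open>auto simp: L_e hecke.scale_right_distrib\<close>)
  also have "\<dots> = (\<Sum>k<48. smul (?x (lmul i k)) (e k)) +
      (\<Sum>k<48. smul (if ascent i k then 0 else ?x k * vv i) (e k))"
    unfolding sum.distrib
    by (subst sum_lmul [OF i, symmetric, where f = "\<lambda>k. smul (?x k) (e (lmul i k))"])
      (use i in \<open>simp add: lmul_lmul\<close>)
  finally have "L i (hval xs) + smul (pval p) (hval xs) =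
      (\<Sum>k<48. smul (?x (lmul i k) + (if ascent i k then 0 else ?x k * vv i) + pval p * ?x k) (e k))"
    by (simp add: hval_def hecke.scale_sum_right sum.distrib hecke.scale_left_distrib)
  also have "\<dots> = hval (hgen i p q xs)"
    unfolding hval_def
    by (rule sum.cong) (use i q in \<open>auto simp: nth_hgen pval_padd pval_pmul algebra_simps\<close>)
  finally show ?thesis ..
qed

section \<open>The bar involution\<close>

lemma lmul_neq: "i < 3 \<Longrightarrow> k < 48 \<Longrightarrow> lmul i k \<noteq> k"
  using ascent_lmul by metis

lemma lookup_L:
  assumes "i < 3" "k < 48" "h \<in> H3"
  shows "lookup (L i h) (cls k) =
    lookup h (cls (lmul i k)) + (if ascent i k then 0 else vv i * lookup h (cls k))"
proof (rule hecke_linear_eqI [OF _ _ _ assms(3)])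
  have mod: "Modules.module ((*) :: laurent \<Rightarrow> _)"
    by unfold_locales (simp_all add: algebra_simps)
  show "module_hom smul (*) (\<lambda>h. lookup (L i h) (cls k))"
    "module_hom smul (*) (\<lambda>h. lookup h (cls (lmul i k)) + (if ascent i k then 0 else vv i * lookup h (cls k)))"
    by (simp_all add: module_hom_iff smul_module mod L_simps lookup_add lookup_smul algebra_simps)
  show "lookup (L i (e j)) (cls k) =
      lookup (e j) (cls (lmul i k)) + (if ascent i k then 0 else vv i * lookup (e j) (cls k))"
    if "j < 48" for j
  proof -
    have "lmul i j = k \<longleftrightarrow> j = lmul i k"
      using assms that lmul_lmul by metis
    then show ?thesis
      using assms that lmul_neq [OF assms(1) that]
      by (auto simp: L_e lookup_add lookup_smul lookup_e lmul_less ascent_lmul)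
  qed
qed

definition Linv :: "nat \<Rightarrow> hecke \<Rightarrow> hecke" where
  "Linv i h = L i h - smul (vv i) h"

lemma Linv_linear: "hecke_linear (Linv i)"
  by (simp add: module_hom_iff smul_module Linv_def L_simps hecke.scale_right_distrib
      hecke.scale_right_diff_distrib ac_simps)

lemma Linv_H3 [simp]: "i < 3 \<Longrightarrow> h \<in> H3 \<Longrightarrow> Linv i h \<in> H3"
  by (simp add: Linv_def)

lemma foldr_Linv_H3: "xs \<in> lists {..<3} \<Longrightarrow> h \<in> H3 \<Longrightarrow> foldr Linv xs h \<in> H3"
  by (induction xs rule: list.induct) auto

lemma L_Linv: "i < 3 \<Longrightarrow> h \<in> H3 \<Longrightarrow> L i (Linv i h) = h"
  and Linv_L: "i < 3 \<Longrightarrow> h \<in> H3 \<Longrightarrow> Linv i (L i h) = h"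
  by (simp_all add: Linv_def L_simps L_quadratic)

lemma foldr_L_Linv: "xs \<in> lists {..<3} \<Longrightarrow> h \<in> H3 \<Longrightarrow> foldr L (rev xs) (foldr Linv xs h) = h"
  by (induction xs arbitrary: h rule: list.induct) (simp_all add: L_Linv foldr_Linv_H3)

lemma foldr_Linv_L: "xs \<in> lists {..<3} \<Longrightarrow> h \<in> H3 \<Longrightarrow> foldr Linv xs (foldr L (rev xs) h) = h"
proof (induction xs arbitrary: h rule: list.induct)
  case (Cons i xs)
  then show ?case
    by (simp add: Linv_L)
qed simp

lemma Linv_hmult: "i < 3 \<Longrightarrow> g \<in> H3 \<Longrightarrow> h \<in> H3 \<Longrightarrow> Linv i g \<star> h = Linv i (g \<star> h)"
  by (simp add: Linv_def L_hmult hmult_simps)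

lemma foldr_Linv_hmult:
  "xs \<in> lists {..<3} \<Longrightarrow> g \<in> H3 \<Longrightarrow> h \<in> H3 \<Longrightarrow> foldr Linv xs g \<star> h = foldr Linv xs (g \<star> h)"
proof (induction xs rule: list.induct)
  case (Cons i xs)
  then show ?case
    using foldr_Linv_H3 [of xs g] by (simp add: Linv_hmult)
qed simp

text \<open>Inverting the braid relation of \<open>L\<close> reverses both words. A braid word of
  odd length is a palindrome, while reversal exchanges the two words of even length, so the relation
  returns in either case.\<close>

lemma Linv_braid:
  assumes "i < 3" "j < 3" "h \<in> H3"
  shows "foldr Linv (braid i j) h = foldr Linv (braid j i) h"
proof -
  let ?x = "foldr Linv (braid i j) h"
  have x: "?x \<in> H3"
    using assms by (intro foldr_Linv_H3 letters_braid)
  have "rev (braid i j) = braid i j \<and> rev (braid j i) = braid j i \<or>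
      rev (braid i j) = braid j i \<and> rev (braid j i) = braid i j"
    by (cases "i = j \<or> i + j = 3") (auto simp: braid_def add.commute)
  then have "foldr L (rev (braid j i)) ?x = foldr L (rev (braid i j)) ?x"
    using L_braid [OF assms(1,2) x] by auto
  also have "\<dots> = h"
    using assms by (intro foldr_L_Linv letters_braid)
  finally show ?thesis
    using foldr_Linv_L [OF letters_braid x, of j i] assms by simp
qed

text \<open>The hypothesis makes \<open>rev xs\<close> reduced, so T of its class is a product of
  generators and the product of their inverses in the opposite order is a two-sided inverse;
  associativity makes it the only one.\<close>

lemma hecke_inv_e:
  assumes "xs \<in> lists {..<3}" "length xs = wlen (index (rev xs))"
  shows "hecke_inv 3 (e (index (rev xs))) = foldr Linv xs (e 0)"
proof -
  let ?a = "index (rev xs)" and ?g = "foldr Linv xs (e 0)"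
  have a: "?a < 48" and rev: "rev xs \<in> lists {..<3}"
    using assms by (auto simp: in_lists_conv_set intro!: index_less)
  have e: "e ?a \<star> h = foldr L (rev xs) h" if "h \<in> H3" for h
    using a rev assms that foldr_L_reduced [of ?a "rev xs" h] by (simp add: hmult_e reduced_iff)
  have g: "?g \<in> H3"
    using assms by (simp add: foldr_Linv_H3)
  have 1: "e ?a \<star> ?g = e 0"
    using assms by (simp add: e g foldr_L_Linv)
  have "e ?a = foldr L (rev xs) (e 0)"
    using e [of "e 0"] a by simp
  then have 2: "?g \<star> e ?a = e 0"
    using assms a foldr_L_H3 [OF rev, of "e 0"] by (simp add: foldr_Linv_hmult foldr_Linv_L)
  have one: "hecke_one 3 = e 0"
    by (simp add: hecke_one_def e_def one_W3)
  show ?thesis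
    unfolding hecke_inv_def one
  proof (rule the_equality)
    show "?g \<in> H3 \<and> ?g \<star> e ?a = e 0 \<and> e ?a \<star> ?g = e 0"
      using 1 2 g by simp
    fix h assume h: "h \<in> H3 \<and> h \<star> e ?a = e 0 \<and> e ?a \<star> h = e 0"
    then have "h = h \<star> (e ?a \<star> ?g)"
      by (simp add: 1)
    also have "\<dots> = ?g"
      using h g a by (simp flip: hmult_assoc)
    finally show "h = ?g" .
  qed
qed

abbreviation bar :: "hecke \<Rightarrow> hecke" where
  "bar \<equiv> hecke_bar 3"

text \<open>Twisting the scalars turns the semilinear bar map into a module homomorphism, so that
  the extension and comparison lemmas apply to it.\<close>

abbreviation bar_smul :: "laurent \<Rightarrow> hecke \<Rightarrow> hecke" where
  "bar_smul a \<equiv> smul (laurent_bar a)"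

lemma bar_module: "Modules.module bar_smul"
  by unfold_locales
    (simp_all add: laurent_bar_add laurent_bar_mult laurent_bar_1 hecke.scale_right_distrib
      hecke.scale_left_distrib)

lemma bar_hom: "module_hom smul bar_smul bar"
  unfolding hecke_bar_def [abs_def] by (rule module_hom_ext [OF bar_module])

lemma bar_simps: "bar (x + y) = bar x + bar y" "bar (smul c x) = smul (laurent_bar c) (bar x)"
    "bar (x - y) = bar x - bar y" "bar (sum g A) = (\<Sum>a\<in>A. bar (g a))"
proof -
  interpret module_hom smul bar_smul bar by (rule bar_hom)
  show "bar (x + y) = bar x + bar y" "bar (smul c x) = smul (laurent_bar c) (bar x)"
    "bar (x - y) = bar x - bar y" "bar (sum g A) = (\<Sum>a\<in>A. bar (g a))"
    by (simp_all add: add scale diff sum)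
qed

lemma wlen_rev_checks: "list_all (\<lambda>k. wlen (foldr lmul (rev (word k)) 0) = wlen k) indices"
  by (simp add: indices_def wlen_def lmul_eval word_eval)

lemma wlen_rev: "k < 48 \<Longrightarrow> wlen (index (rev (word k))) = wlen k"
  using all_indices [OF wlen_rev_checks] by (simp add: index_def)

text \<open>T_{w^-1} is a product along the reversed word of w, so its inverse is the product of the
  inverse generators along the word itself.\<close>

lemma bar_e:
  assumes "k < 48"
  shows "bar (e k) = foldr Linv (word k) (e 0)"
proof -
  have "bar (e k) = hecke_inv 3 (T (inv\<^bsub>W 3\<^esub> (cls k)))"
    unfolding hecke_bar_def e_def by (rule ext_T [OF bar_module])
  also have "\<dots> = hecke_inv 3 (e (index (rev (word k))))"
    by (simp add: inv_cls assms e_def)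
  also have "\<dots> = foldr Linv (word k) (e 0)"
    using assms wlen_rev by (intro hecke_inv_e letters_word) (auto simp: wlen_def)
  finally show ?thesis .
qed

lemma bar_H3: "h \<in> H3 \<Longrightarrow> bar h \<in> H3"
  by (subst hecke_sum_e, assumption)
    (auto simp: bar_simps bar_e foldr_Linv_H3 letters_word intro!: H3_sum H3_simps)

text \<open>Multiplicativity of bar against a generator, the only case used later. At a descent the
  sign in bar(v_i - v_i^-1) = -(v_i - v_i^-1) accounts for passing from T_i to its inverse.\<close>

lemma bar_L:
  assumes "i < 3" "h \<in> H3"
  shows "bar (L i h) = Linv i (bar h)"
proof (rule hecke_linear_eqI [OF _ _ _ assms(2)])
  show "module_hom smul bar_smul (\<lambda>h. bar (L i h))" "module_hom smul bar_smul (\<lambda>h. Linv i (bar h))"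
    by (simp_all add: module_hom_iff smul_module bar_module bar_simps L_simps
        hecke_linearD [OF Linv_linear])
  have asc: "bar (e (lmul i k)) = Linv i (bar (e k))" if "k < 48" "ascent i k" for k
    using that assms foldr_word_step [where F = Linv and D = H3 and x = "e 0"]
    by (simp add: bar_e lmul_less Linv_braid)
  show "bar (L i (e k)) = Linv i (bar (e k))" if k: "k < 48" for k
  proof (cases "ascent i k")
    case True
    then show ?thesis using k assms by (simp add: L_e asc)
  next
    case False
    let ?j = "lmul i k" and ?b = "bar (e (lmul i k))"
    have j: "?j < 48" "ascent i ?j" "lmul i ?j = k"
      using k assms False by (simp_all add: lmul_less ascent_lmul lmul_lmul)
    have b: "bar (e k) = Linv i ?b"
      using asc [OF j(1,2)] j(3) by simp
    have v: "laurent_bar (vv i) = - vv i"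
      by (simp add: vv_def laurent_bar_diff laurent_bar_v)
    have "bar (L i (e k)) = ?b - smul (vv i) (Linv i ?b)"
      using False k assms by (simp add: L_e bar_simps b v)
    also have "\<dots> = Linv i (Linv i ?b)"
      using assms j by (subst (2) Linv_def) (simp add: L_Linv bar_H3)
    finally show ?thesis
      by (simp add: b)
  qed
qed

section \<open>Triangularity of the bar map and uniqueness of invariant elements\<close>

definition below :: "nat \<Rightarrow> hecke set" where
  "below m = {h \<in> H3. \<forall>j<48. m \<le> wlen j \<longrightarrow> lookup h (cls j) = 0}"

lemma below_add: "g \<in> below m \<Longrightarrow> h \<in> below m \<Longrightarrow> g + h \<in> below m"
  by (simp add: below_def lookup_add)

lemma Linv_below:
  assumes "i < 3" "h \<in> below m"
  shows "Linv i h \<in> below (Suc m)"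
proof -
  have h: "h \<in> H3" using assms by (simp add: below_def)
  have "lookup (Linv i h) (cls j) = 0" if "j < 48" "Suc m \<le> wlen j" for j
  proof -
    have "m \<le> wlen (lmul i j)" "m \<le> wlen j"
      using that assms wlen_lmul [of i j] by auto
    then have "lookup h (cls (lmul i j)) = 0" "lookup h (cls j) = 0"
      using assms that by (auto simp: below_def lmul_less)
    then show ?thesis
      using assms(1) that h by (simp add: Linv_def lookup_minus lookup_smul lookup_L)
  qed
  then show ?thesis
    using assms h by (simp add: below_def)
qed

text \<open>T_i^-1 = T_i - (v_i - v_i^-1) and one generator raises the length by at most one, so the
  error terms stay below the leading element along the word.\<close>

lemma bar_e_below: "k < 48 \<Longrightarrow> bar (e k) - e k \<in> below (wlen k)"
proof (induction "wlen k" arbitrary: k rule: less_induct)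
  case less
  show ?case
  proof (cases "k = 0")
    case True
    then show ?thesis by (simp add: bar_e below_def)
  next
    case False
    define i where "i = hd (word k)"
    let ?j = "lmul i k"
    have word: "word k = i # word ?j"
      using word_Cons less.prems False by (simp add: i_def)
    then have i: "i < 3"
      using letters_word [OF less.prems] by auto
    have len: "wlen k = Suc (wlen ?j)"
      using word unfolding wlen_def by (metis length_Cons)
    then have j: "?j < 48" "ascent i ?j" "lmul i ?j = k"
      using i less.prems by (auto simp: lmul_less lmul_lmul ascent_def)
    have "Linv i (e ?j) = e k - smul (vv i) (e ?j)"
      using i j by (simp add: Linv_def L_e)
    then have "bar (e k) - e k = Linv i (bar (e ?j) - e ?j) - smul (vv i) (e ?j)"
      using bar_L [OF i, of "e ?j"] i j by (simp add: L_e hecke_linearD [OF Linv_linear])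
    moreover have "Linv i (bar (e ?j) - e ?j) \<in> below (wlen k)"
      using less.hyps [of ?j] j len Linv_below [OF i] by simp
    moreover have "- smul (vv i) (e ?j) \<in> below (wlen k)"
      using j len H3_simps(4) [OF H3_simps(1), of "smul (vv i) (e ?j)"]
      by (auto simp: below_def lookup_smul lookup_e)
    ultimately show ?thesis
      using below_add by fastforce
  qed
qed

text \<open>At an element of maximal length in the support, triangularity makes the coefficient
  itself invariant under V \<mapsto> V^-1, v \<mapsto> v^-1, which cannot happen for a nonzero
  combination of monomials below 1.\<close>

lemma bar_invariant_neg_eq_0:
  assumes "h \<in> H3" "bar h = h" "\<And>k. k < 48 \<Longrightarrow> lookup h (cls k) \<in> A_neg wlex_less"
  shows "h = 0"
proof (rule ccontr)
  assume "h \<noteq> 0"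
  let ?S = "{k. k < 48 \<and> lookup h (cls k) \<noteq> 0}"
  have "?S \<noteq> {}"
  proof
    assume "?S = {}"
    then have "h = 0"
      by (subst hecke_sum_e [OF assms(1)]) (auto intro!: sum.neutral)
    with \<open>h \<noteq> 0\<close> show False ..
  qed
  then have "Max (wlen ` ?S) \<in> wlen ` ?S"
    by (intro Max_in) auto
  then obtain j where j: "j \<in> ?S" and "wlen j = Max (wlen ` ?S)"
    by (metis (no_types, lifting) imageE)
  then have max: "wlen k \<le> wlen j" if "k \<in> ?S" for k
    using that by simp
  let ?a = "lookup h (cls j)"
  have "bar h = bar (\<Sum>k<48. smul (lookup h (cls k)) (e k))"
    using hecke_sum_e [OF assms(1)] by (rule arg_cong)
  then have "lookup (bar h) (cls j) =
      (\<Sum>k<48. laurent_bar (lookup h (cls k)) * lookup (bar (e k)) (cls j))"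
    by (simp add: bar_simps lookup_sum lookup_smul)
  also have "\<dots> = (\<Sum>k<48. if k = j then laurent_bar ?a else 0)"
  proof (rule sum.cong)
    fix k assume "k \<in> {..<48::nat}"
    then have k: "k < 48" by simp
    show "laurent_bar (lookup h (cls k)) * lookup (bar (e k)) (cls j) = (if k = j then laurent_bar ?a else 0)"
    proof (cases "lookup h (cls k) = 0")
      case True
      then show ?thesis using j by (auto simp: laurent_bar_0)
    next
      case False
      then have "lookup (bar (e k) - e k) (cls j) = 0"
        using max [of k] j k bar_e_below [OF k] by (simp add: below_def)
      then show ?thesis
        using j k by (simp add: lookup_minus lookup_e)
    qed
  qed simp
  also have "\<dots> = laurent_bar ?a"
    using j by simp
  finally have bar: "laurent_bar ?a = ?a"
    using assms by simp
  have "keys ?a \<noteq> {}"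
    using j by simp
  then obtain m where m: "m \<in> keys ?a"
    by blast
  \<comment> \<open>Invariance makes the set of exponents symmetric, but \<open>m\<close> and
    \<open>- m\<close> cannot both be negative in the order.\<close>
  then have "- m \<in> keys ?a"
    using lookup_laurent_bar [of ?a "- m"] bar by (simp add: in_keys_iff)
  then have "wlex_less m (0, 0)" "wlex_less (- m) (0, 0)"
    using m assms(3) [of j] j by (auto simp: A_neg_def)
  then show False
    by (cases m) (auto simp: wlex_less_def)
qed

section \<open>The Kazhdan--Lusztig basis\<close>

text \<open>\<open>KL_table ! k ! j\<close> is the coefficient of $T_j$ in $C_k$, and for an ascent \<open>i\<close> of
  \<open>k\<close> the product $C_i C_k$ is $C_{ik}$ plus the combination \<open>mu_table ! i ! k\<close>.\<close>

definition KL_table :: "lpol list list" where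
  "KL_table = [
   [[(0, 0, 1)], [], [], [], [], [], [], [], [], [], [], [], [], [], [], [], [], [], [], [], [],
   [], [], [], [], [], [], [], [], [], [], [], [], [], [], [], [], [], [], [], [], [], [], [], [],
   [], [], []],
   [[(-1, 0, 1)], [(0, 0, 1)], [], [], [], [], [], [], [], [], [], [], [], [], [], [], [], [], [],
   [], [], [], [], [], [], [], [], [], [], [], [], [], [], [], [], [], [], [], [], [], [], [], [],
   [], [], [], [], []],
   [[(0, -1, 1)], [], [(0, 0, 1)], [], [], [], [], [], [], [], [], [], [], [], [], [], [], [], [],
   [], [], [], [], [], [], [], [], [], [], [], [], [], [], [], [], [], [], [], [], [], [], [], [],
   [], [], [], [], []],
   [[(0, -1, 1)], [], [], [(0, 0, 1)], [], [], [], [], [], [], [], [], [], [], [], [], [], [], [],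
   [], [], [], [], [], [], [], [], [], [], [], [], [], [], [], [], [], [], [], [], [], [], [], [],
   [], [], [], [], []],
   [[(-1, -1, 1)], [(0, -1, 1)], [(-1, 0, 1)], [], [(0, 0, 1)], [], [], [], [], [], [], [], [],
   [], [], [], [], [], [], [], [], [], [], [], [], [], [], [], [], [], [], [], [], [], [], [], [],
   [], [], [], [], [], [], [], [], [], [], []],
   [[(-1, -1, 1)], [(0, -1, 1)], [], [(-1, 0, 1)], [], [(0, 0, 1)], [], [], [], [], [], [], [],
   [], [], [], [], [], [], [], [], [], [], [], [], [], [], [], [], [], [], [], [], [], [], [], [],
   [], [], [], [], [], [], [], [], [], [], []],
   [[(-1, -1, 1)], [(0, -1, 1)], [(-1, 0, 1)], [], [], [], [(0, 0, 1)], [], [], [], [], [], [],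
   [], [], [], [], [], [], [], [], [], [], [], [], [], [], [], [], [], [], [], [], [], [], [], [],
   [], [], [], [], [], [], [], [], [], [], []],
   [[(0, -2, 1)], [], [(0, -1, 1)], [(0, -1, 1)], [], [], [], [(0, 0, 1)], [], [], [], [], [], [],
   [], [], [], [], [], [], [], [], [], [], [], [], [], [], [], [], [], [], [], [], [], [], [], [],
   [], [], [], [], [], [], [], [], [], []],
   [[(0, -2, 1)], [], [(0, -1, 1)], [(0, -1, 1)], [], [], [], [], [(0, 0, 1)], [], [], [], [], [],
   [], [], [], [], [], [], [], [], [], [], [], [], [], [], [], [], [], [], [], [], [], [], [], [],
   [], [], [], [], [], [], [], [], [], []],
   [[(-2, -1, 1), (-2, 1, -1)], [(-1, -1, 1), (-1, 1, -1)], [(-2, 0, 1)], [], [(-1, 0, 1)], [],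
   [(-1, 0, 1)], [], [], [(0, 0, 1)], [], [], [], [], [], [], [], [], [], [], [], [], [], [], [],
   [], [], [], [], [], [], [], [], [], [], [], [], [], [], [], [], [], [], [], [], [], [], []],
   [[(-1, -2, 1)], [(0, -2, 1)], [(-1, -1, 1)], [(-1, -1, 1)], [(0, -1, 1)], [(0, -1, 1)], [],
   [(-1, 0, 1)], [], [], [(0, 0, 1)], [], [], [], [], [], [], [], [], [], [], [], [], [], [], [],
   [], [], [], [], [], [], [], [], [], [], [], [], [], [], [], [], [], [], [], [], [], []],
   [[(-1, -2, 1)], [(0, -2, 1)], [(-1, -1, 1)], [(-1, -1, 1)], [(0, -1, 1)], [(0, -1, 1)], [], [],
   [(-1, 0, 1)], [], [], [(0, 0, 1)], [], [], [], [], [], [], [], [], [], [], [], [], [], [], [],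
   [], [], [], [], [], [], [], [], [], [], [], [], [], [], [], [], [], [], [], [], []],
   [[(-1, -2, 1), (-1, 0, 1)], [(0, -2, 1)], [(-1, -1, 1), (-1, 1, 1)], [], [(0, -1, 1)], [],
   [(0, -1, 1)], [], [], [], [], [], [(0, 0, 1)], [], [], [], [], [], [], [], [], [], [], [], [],
   [], [], [], [], [], [], [], [], [], [], [], [], [], [], [], [], [], [], [], [], [], [], []],
   [[(-1, -2, 1)], [(0, -2, 1)], [(-1, -1, 1)], [(-1, -1, 1)], [], [(0, -1, 1)], [(0, -1, 1)],
   [(-1, 0, 1)], [], [], [], [], [], [(0, 0, 1)], [], [], [], [], [], [], [], [], [], [], [], [],
   [], [], [], [], [], [], [], [], [], [], [], [], [], [], [], [], [], [], [], [], [], []],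
   [[(0, -3, 1)], [], [(0, -2, 1)], [(0, -2, 1)], [], [], [], [(0, -1, 1)], [(0, -1, 1)], [], [],
   [], [], [], [(0, 0, 1)], [], [], [], [], [], [], [], [], [], [], [], [], [], [], [], [], [],
   [], [], [], [], [], [], [], [], [], [], [], [], [], [], [], []],
   [[(-1, -2, 1)], [(0, -2, 1)], [(-1, -1, 1)], [(-1, -1, 1)], [], [(0, -1, 1)], [(0, -1, 1)], [],
   [(-1, 0, 1)], [], [], [], [], [], [], [(0, 0, 1)], [], [], [], [], [], [], [], [], [], [], [],
   [], [], [], [], [], [], [], [], [], [], [], [], [], [], [], [], [], [], [], [], []],
   [[(-2, -2, 1)], [(-1, -2, 1)], [(-2, -1, 1)], [], [(-1, -1, 1)], [], [(-1, -1, 1)], [], [],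
   [(0, -1, 1)], [], [], [(-1, 0, 1)], [], [], [], [(0, 0, 1)], [], [], [], [], [], [], [], [],
   [], [], [], [], [], [], [], [], [], [], [], [], [], [], [], [], [], [], [], [], [], [], []],
   [[(-2, -2, 1), (-2, 0, -1)], [(-1, -2, 1), (-1, 0, -1)], [(-2, -1, 1)],
   [(-2, -1, 1), (-2, 1, -1)], [(-1, -1, 1)], [(-1, -1, 1), (-1, 1, -1)], [(-1, -1, 1)],
   [(-2, 0, 1)], [], [(0, -1, 1)], [(-1, 0, 1)], [], [], [(-1, 0, 1)], [], [], [], [(0, 0, 1)],
   [], [], [], [], [], [], [], [], [], [], [], [], [], [], [], [], [], [], [], [], [], [], [], [],
   [], [], [], [], [], []],
   [[(-1, -3, 1)], [(0, -3, 1)], [(-1, -2, 1)], [(-1, -2, 1)], [(0, -2, 1)], [(0, -2, 1)], [],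
   [(-1, -1, 1)], [(-1, -1, 1)], [], [(0, -1, 1)], [(0, -1, 1)], [], [], [(-1, 0, 1)], [], [], [],
   [(0, 0, 1)], [], [], [], [], [], [], [], [], [], [], [], [], [], [], [], [], [], [], [], [],
   [], [], [], [], [], [], [], [], []],
   [[(-2, -2, 1), (-2, 0, -1)], [(-1, -2, 1), (-1, 0, -1)], [(-2, -1, 1)],
   [(-2, -1, 1), (-2, 1, -1)], [(-1, -1, 1)], [(-1, -1, 1), (-1, 1, -1)], [(-1, -1, 1)], [],
   [(-2, 0, 1)], [(0, -1, 1)], [], [(-1, 0, 1)], [], [], [], [(-1, 0, 1)], [], [], [],
   [(0, 0, 1)], [], [], [], [], [], [], [], [], [], [], [], [], [], [], [], [], [], [], [], [],
   [], [], [], [], [], [], [], []],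
   [[(-1, -3, 1), (-1, -1, 1)], [(0, -3, 1)], [(-1, -2, 1), (-1, 0, 1)],
   [(-1, -2, 1), (-1, 0, 1)], [(0, -2, 1)], [(0, -2, 1)], [(0, -2, 1)], [(-1, -1, 1), (-1, 1, 1)],
   [], [], [(0, -1, 1)], [], [(0, -1, 1)], [(0, -1, 1)], [], [], [], [], [], [], [(0, 0, 1)], [],
   [], [], [], [], [], [], [], [], [], [], [], [], [], [], [], [], [], [], [], [], [], [], [], [],
   [], []],
   [[(-1, -3, 1), (-1, -1, 1)], [(0, -3, 1)], [(-1, -2, 1), (-1, 0, 1)], [(-1, -2, 1)],
   [(0, -2, 1)], [(0, -2, 1)], [(0, -2, 1)], [(-1, -1, 1)], [(-1, -1, 1)], [], [], [(0, -1, 1)],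
   [(0, -1, 1)], [(0, -1, 1)], [(-1, 0, 1)], [], [], [], [], [], [], [(0, 0, 1)], [], [], [], [],
   [], [], [], [], [], [], [], [], [], [], [], [], [], [], [], [], [], [], [], [], [], []],
   [[(-1, -3, 1)], [(0, -3, 1)], [(-1, -2, 1)], [(-1, -2, 1)], [], [(0, -2, 1)], [(0, -2, 1)],
   [(-1, -1, 1)], [(-1, -1, 1)], [], [], [], [], [(0, -1, 1)], [(-1, 0, 1)], [(0, -1, 1)], [], [],
   [], [], [], [], [(0, 0, 1)], [], [], [], [], [], [], [], [], [], [], [], [], [], [], [], [],
   [], [], [], [], [], [], [], [], []],
   [[(-1, -3, 1), (-1, -1, 1)], [(0, -3, 1)], [(-1, -2, 1), (-1, 0, 1)],
   [(-1, -2, 1), (-1, 0, 1)], [(0, -2, 1)], [(0, -2, 1)], [(0, -2, 1)], [],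
   [(-1, -1, 1), (-1, 1, 1)], [], [], [(0, -1, 1)], [(0, -1, 1)], [], [], [(0, -1, 1)], [], [],
   [], [], [], [], [], [(0, 0, 1)], [], [], [], [], [], [], [], [], [], [], [], [], [], [], [],
   [], [], [], [], [], [], [], [], []],
   [[(-2, -3, 1)], [(-1, -3, 1)], [(-2, -2, 1)], [(-2, -2, 1)], [(-1, -2, 1)], [(-1, -2, 1)],
   [(-1, -2, 1)], [(-2, -1, 1)], [], [(0, -2, 1)], [(-1, -1, 1)], [], [(-1, -1, 1)],
   [(-1, -1, 1)], [], [], [(0, -1, 1)], [(0, -1, 1)], [], [], [(-1, 0, 1)], [], [], [],
   [(0, 0, 1)], [], [], [], [], [], [], [], [], [], [], [], [], [], [], [], [], [], [], [], [],
   [], [], []],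
   [[(-2, -3, 1)], [(-1, -3, 1)], [(-2, -2, 1)], [(-2, -2, 1), (-2, 0, -1)], [(-1, -2, 1)],
   [(-1, -2, 1), (-1, 0, -1)], [(-1, -2, 1)], [(-2, -1, 1)], [(-2, -1, 1), (-2, 1, -1)],
   [(0, -2, 1)], [(-1, -1, 1)], [(-1, -1, 1), (-1, 1, -1)], [(-1, -1, 1)], [(-1, -1, 1)],
   [(-2, 0, 1)], [], [(0, -1, 1)], [(0, -1, 1)], [(-1, 0, 1)], [], [], [(-1, 0, 1)], [], [], [],
   [(0, 0, 1)], [], [], [], [], [], [], [], [], [], [], [], [], [], [], [], [], [], [], [], [],
   [], []],
   [[(-2, -3, 1), (0, -3, 1)], [(-1, -3, 1), (1, -3, 1)], [(-2, -2, 1)],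
   [(-2, -2, 1), (0, -2, 1)], [(-1, -2, 1)], [(-1, -2, 1), (1, -2, 1)], [(-1, -2, 1)],
   [(-2, -1, 1)], [(-2, -1, 1)], [(0, -2, 1)], [(-1, -1, 1)], [(-1, -1, 1)], [], [(-1, -1, 1)],
   [(-2, 0, 1)], [(-1, -1, 1)], [], [(0, -1, 1)], [(-1, 0, 1)], [(0, -1, 1)], [], [],
   [(-1, 0, 1)], [], [], [], [(0, 0, 1)], [], [], [], [], [], [], [], [], [], [], [], [], [], [],
   [], [], [], [], [], [], []],
   [[(-2, -3, 1)], [(-1, -3, 1)], [(-2, -2, 1)], [(-2, -2, 1)], [(-1, -2, 1)], [(-1, -2, 1)],
   [(-1, -2, 1)], [], [(-2, -1, 1)], [(0, -2, 1)], [], [(-1, -1, 1)], [(-1, -1, 1)], [], [],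
   [(-1, -1, 1)], [(0, -1, 1)], [], [], [(0, -1, 1)], [], [], [], [(-1, 0, 1)], [], [], [],
   [(0, 0, 1)], [], [], [], [], [], [], [], [], [], [], [], [], [], [], [], [], [], [], [], []],
   [[(-1, -4, 1), (-1, -2, 1)], [(0, -4, 1)], [(-1, -3, 1), (-1, -1, 1)],
   [(-1, -3, 1), (-1, -1, 1)], [(0, -3, 1)], [(0, -3, 1)], [(0, -3, 1)],
   [(-1, -2, 1), (-1, 0, 1)], [(-1, -2, 1), (-1, 0, 1)], [], [(0, -2, 1)], [(0, -2, 1)],
   [(0, -2, 1)], [(0, -2, 1)], [(-1, -1, 1), (-1, 1, 1)], [], [], [], [(0, -1, 1)], [],
   [(0, -1, 1)], [(0, -1, 1)], [], [], [], [], [], [], [(0, 0, 1)], [], [], [], [], [], [], [],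
   [], [], [], [], [], [], [], [], [], [], [], []],
   [[(-2, -3, 1)], [(-1, -3, 1)], [(-2, -2, 1)], [(-2, -2, 1), (-2, 0, -1)], [(-1, -2, 1)],
   [(-1, -2, 1), (-1, 0, -1)], [(-1, -2, 1)], [(-2, -1, 1), (-2, 1, -1)], [(-2, -1, 1)],
   [(0, -2, 1)], [], [(-1, -1, 1)], [(-1, -1, 1)], [(-1, -1, 1), (-1, 1, -1)], [(-2, 0, 1)],
   [(-1, -1, 1)], [(0, -1, 1)], [], [], [(0, -1, 1)], [], [(-1, 0, 1)], [(-1, 0, 1)], [], [], [],
   [], [], [], [(0, 0, 1)], [], [], [], [], [], [], [], [], [], [], [], [], [], [], [], [], [],
   []],
   [[(-1, -4, 1), (-1, -2, 1)], [(0, -4, 1)], [(-1, -3, 1), (-1, -1, 1)],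
   [(-1, -3, 1), (-1, -1, 1)], [(0, -3, 1)], [(0, -3, 1)], [(0, -3, 1)],
   [(-1, -2, 1), (-1, 0, 1)], [(-1, -2, 1), (-1, 0, 1)], [], [], [(0, -2, 1)], [(0, -2, 1)],
   [(0, -2, 1)], [(-1, -1, 1), (-1, 1, 1)], [(0, -2, 1)], [], [], [], [], [], [(0, -1, 1)],
   [(0, -1, 1)], [(0, -1, 1)], [], [], [], [], [], [], [(0, 0, 1)], [], [], [], [], [], [], [],
   [], [], [], [], [], [], [], [], [], []],
   [[(-1, -4, 1), (-1, -2, 2), (-1, 0, 1)], [(0, -4, 1), (0, -2, 1)], [(-1, -3, 1), (-1, -1, 1)],
   [(-1, -3, 1), (-1, -1, 2), (-1, 1, 1)], [(0, -3, 1)], [(0, -3, 1), (0, -1, 1)], [(0, -3, 1)],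
   [(-1, -2, 1), (-1, 0, 1)], [(-1, -2, 1), (-1, 0, 1)], [], [(0, -2, 1)], [(0, -2, 1)],
   [(0, -2, 1)], [(0, -2, 1)], [(-1, -1, 1), (-1, 1, 1)], [(0, -2, 1)], [], [], [(0, -1, 1)], [],
   [(0, -1, 1)], [], [(0, -1, 1)], [(0, -1, 1)], [], [], [], [], [], [], [], [(0, 0, 1)], [], [],
   [], [], [], [], [], [], [], [], [], [], [], [], [], []],
   [[(-2, -4, 1)], [(-1, -4, 1)], [(-2, -3, 1)], [(-2, -3, 1)], [(-1, -3, 1)], [(-1, -3, 1)],
   [(-1, -3, 1)], [(-2, -2, 1)], [(-2, -2, 1)], [(0, -3, 1)], [(-1, -2, 1)], [(-1, -2, 1)],
   [(-1, -2, 1)], [(-1, -2, 1)], [(-2, -1, 1)], [], [(0, -2, 1)], [(0, -2, 1)], [(-1, -1, 1)], [],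
   [(-1, -1, 1)], [(-1, -1, 1)], [], [], [(0, -1, 1)], [(0, -1, 1)], [], [], [(-1, 0, 1)], [], [],
   [], [(0, 0, 1)], [], [], [], [], [], [], [], [], [], [], [], [], [], [], []],
   [[(-3, -3, 1), (-3, -1, -2), (-3, 1, 1), (-1, -3, -1), (-1, -1, 1)],
   [(-2, -3, 1), (-2, -1, -2), (-2, 1, 1), (0, -3, -1), (0, -1, 1)],
   [(-3, -2, 1), (-3, 0, -2), (-1, -2, -1)], [(-3, -2, 1), (-3, 0, -2), (-3, 2, 1)],
   [(-2, -2, 1), (-2, 0, -2), (0, -2, -1)], [(-2, -2, 1), (-2, 0, -2), (-2, 2, 1)],
   [(-2, -2, 1), (-2, 0, -2), (0, -2, -1)], [(-3, -1, 1), (-3, 1, -1)],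
   [(-3, -1, 1), (-3, 1, -1)], [(-1, -2, 1), (-1, 0, -2), (1, -2, -1)],
   [(-2, -1, 1), (-2, 1, -1)], [(-2, -1, 1), (-2, 1, -1)], [(-2, -1, 1), (-2, 1, -1)],
   [(-2, -1, 1), (-2, 1, -1)], [(-3, 0, 1)], [(-2, -1, 1), (-2, 1, -1)],
   [(-1, -1, 1), (-1, 1, -1)], [(-1, -1, 1), (-1, 1, -1)], [(-2, 0, 1)],
   [(-1, -1, 1), (-1, 1, -1)], [], [(-2, 0, 1)], [(-2, 0, 1)], [], [], [(-1, 0, 1)], [(-1, 0, 1)],
   [], [], [(-1, 0, 1)], [], [], [], [(0, 0, 1)], [], [], [], [], [], [], [], [], [], [], [], [],
   [], []],
   [[(-2, -4, 1), (-2, -2, 1), (0, -4, 1)], [(-1, -4, 1), (-1, -2, 1), (1, -4, 1)],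
   [(-2, -3, 1), (-2, -1, 1), (0, -3, 1)], [(-2, -3, 1), (-2, -1, 1), (0, -3, 1)],
   [(-1, -3, 1), (-1, -1, 1), (1, -3, 1)], [(-1, -3, 1), (-1, -1, 1), (1, -3, 1)], [(-1, -3, 1)],
   [(-2, -2, 1), (-2, 0, 1)], [(-2, -2, 1), (-2, 0, 1), (0, -2, 1)], [(0, -3, 1)],
   [(-1, -2, 1), (-1, 0, 1)], [(-1, -2, 1), (-1, 0, 1), (1, -2, 1)], [(-1, -2, 1)], [(-1, -2, 1)],
   [(-2, -1, 1), (-2, 1, 1)], [(-1, -2, 1)], [(0, -2, 1)], [(0, -2, 1)],
   [(-1, -1, 1), (-1, 1, 1)], [(0, -2, 1)], [], [(-1, -1, 1)], [(-1, -1, 1)], [(-1, -1, 1)], [],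
   [(0, -1, 1)], [(0, -1, 1)], [(0, -1, 1)], [], [], [(-1, 0, 1)], [], [], [], [(0, 0, 1)], [],
   [], [], [], [], [], [], [], [], [], [], [], []],
   [[(-2, -4, 1), (-2, -2, 1)], [(-1, -4, 1), (-1, -2, 1)], [(-2, -3, 1)],
   [(-2, -3, 1), (-2, -1, 1)], [(-1, -3, 1)], [(-1, -3, 1), (-1, -1, 1)], [(-1, -3, 1)],
   [(-2, -2, 1)], [(-2, -2, 1)], [(0, -3, 1)], [(-1, -2, 1)], [(-1, -2, 1)], [(-1, -2, 1)],
   [(-1, -2, 1)], [(-2, -1, 1)], [(-1, -2, 1)], [(0, -2, 1)], [(0, -2, 1)], [(-1, -1, 1)],
   [(0, -2, 1)], [(-1, -1, 1)], [], [(-1, -1, 1)], [(-1, -1, 1)], [(0, -1, 1)], [], [(0, -1, 1)],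
   [(0, -1, 1)], [], [], [], [(-1, 0, 1)], [], [], [], [(0, 0, 1)], [], [], [], [], [], [], [],
   [], [], [], [], []],
   [[(-2, -4, 1), (-2, -2, 1), (0, -4, 1)], [(-1, -4, 1), (-1, -2, 1), (1, -4, 1)],
   [(-2, -3, 1), (-2, -1, 1), (0, -3, 1)], [(-2, -3, 1), (-2, -1, 1), (0, -3, 1)], [(-1, -3, 1)],
   [(-1, -3, 1), (-1, -1, 1), (1, -3, 1)], [(-1, -3, 1), (-1, -1, 1), (1, -3, 1)],
   [(-2, -2, 1), (-2, 0, 1), (0, -2, 1)], [(-2, -2, 1), (-2, 0, 1)], [(0, -3, 1)], [(-1, -2, 1)],
   [(-1, -2, 1)], [(-1, -2, 1)], [(-1, -2, 1), (-1, 0, 1), (1, -2, 1)], [(-2, -1, 1), (-2, 1, 1)],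
   [(-1, -2, 1), (-1, 0, 1)], [(0, -2, 1)], [(0, -2, 1)], [(-1, -1, 1)], [(0, -2, 1)],
   [(-1, -1, 1)], [(-1, -1, 1)], [(-1, -1, 1), (-1, 1, 1)], [], [(0, -1, 1)], [], [(0, -1, 1)],
   [], [(-1, 0, 1)], [(0, -1, 1)], [], [], [], [], [], [], [(0, 0, 1)], [], [], [], [], [], [],
   [], [], [], [], []],
   [[(-2, -4, 1)], [(-1, -4, 1)], [(-2, -3, 1)], [(-2, -3, 1)], [(-1, -3, 1)], [(-1, -3, 1)],
   [(-1, -3, 1)], [(-2, -2, 1)], [(-2, -2, 1)], [(0, -3, 1)], [], [(-1, -2, 1)], [(-1, -2, 1)],
   [(-1, -2, 1)], [(-2, -1, 1)], [(-1, -2, 1)], [(0, -2, 1)], [], [], [(0, -2, 1)], [],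
   [(-1, -1, 1)], [(-1, -1, 1)], [(-1, -1, 1)], [], [], [], [(0, -1, 1)], [], [(0, -1, 1)],
   [(-1, 0, 1)], [], [], [], [], [], [], [(0, 0, 1)], [], [], [], [], [], [], [], [], [], []],
   [[(-1, -5, 1), (-1, -3, 1), (1, -5, -1)], [(0, -5, 1)],
   [(-1, -4, 1), (-1, -2, 1), (1, -4, -1)], [(-1, -4, 1), (-1, -2, 1), (1, -4, -1)], [(0, -4, 1)],
   [(0, -4, 1)], [(0, -4, 1)], [(-1, -3, 1), (-1, -1, 1), (1, -3, -1)],
   [(-1, -3, 1), (-1, -1, 1), (1, -3, -1)], [], [(0, -3, 1)], [(0, -3, 1)], [(0, -3, 1)],
   [(0, -3, 1)], [(-1, -2, 1), (-1, 0, 1), (1, -2, -1)], [(0, -3, 1)], [], [], [(0, -2, 1)], [],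
   [(0, -2, 1)], [(0, -2, 1)], [(0, -2, 1)], [(0, -2, 1)], [], [], [], [], [(0, -1, 1)], [],
   [(0, -1, 1)], [(0, -1, 1)], [], [], [], [], [], [], [(0, 0, 1)], [], [], [], [], [], [], [],
   [], []],
   [[(-3, -4, 1), (-3, -2, -1)], [(-2, -4, 1), (-2, -2, -1)], [(-3, -3, 1), (-3, -1, -1)],
   [(-3, -3, 1), (-3, -1, -1)], [(-2, -3, 1), (-2, -1, -1)], [(-2, -3, 1), (-2, -1, -1)],
   [(-2, -3, 1), (-2, -1, -1)], [(-3, -2, 1), (-3, 0, -1)], [(-3, -2, 1)],
   [(-1, -3, 1), (-1, -1, -1)], [(-2, -2, 1), (-2, 0, -1)], [(-2, -2, 1)],
   [(-2, -2, 1), (-2, 0, -1)], [(-2, -2, 1), (-2, 0, -1)], [(-3, -1, 1)], [(-2, -2, 1)],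
   [(-1, -2, 1), (-1, 0, -1)], [(-1, -2, 1), (-1, 0, -1)], [(-2, -1, 1)], [(-1, -2, 1)],
   [(-2, -1, 1), (-2, 1, -1)], [(-2, -1, 1)], [(-2, -1, 1)], [], [(-1, -1, 1), (-1, 1, -1)],
   [(-1, -1, 1)], [(-1, -1, 1)], [], [(-2, 0, 1)], [(-1, -1, 1)], [], [], [(-1, 0, 1)],
   [(0, -1, 1)], [], [], [(-1, 0, 1)], [], [], [(0, 0, 1)], [], [], [], [], [], [], [], []],
   [[(-3, -4, 1), (-3, -2, -1)], [(-2, -4, 1), (-2, -2, -1)], [(-3, -3, 1), (-3, -1, -1)],
   [(-3, -3, 1), (-3, -1, -1)], [(-2, -3, 1), (-2, -1, -1)], [(-2, -3, 1), (-2, -1, -1)],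
   [(-2, -3, 1), (-2, -1, -1)], [(-3, -2, 1)], [(-3, -2, 1), (-3, 0, -1)],
   [(-1, -3, 1), (-1, -1, -1)], [(-2, -2, 1)], [(-2, -2, 1), (-2, 0, -1)],
   [(-2, -2, 1), (-2, 0, -1)], [(-2, -2, 1)], [(-3, -1, 1)], [(-2, -2, 1), (-2, 0, -1)],
   [(-1, -2, 1), (-1, 0, -1)], [(-1, -2, 1)], [(-2, -1, 1)], [(-1, -2, 1), (-1, 0, -1)], [],
   [(-2, -1, 1)], [(-2, -1, 1)], [(-2, -1, 1), (-2, 1, -1)], [], [(-1, -1, 1)], [(-1, -1, 1)],
   [(-1, -1, 1), (-1, 1, -1)], [], [(-1, -1, 1)], [(-2, 0, 1)], [], [], [(0, -1, 1)],
   [(-1, 0, 1)], [], [], [(-1, 0, 1)], [], [], [(0, 0, 1)], [], [], [], [], [], [], []],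
   [[(-2, -5, 1), (-2, -3, 1)], [(-1, -5, 1), (-1, -3, 1)], [(-2, -4, 1), (-2, -2, 1)],
   [(-2, -4, 1), (-2, -2, 1)], [(-1, -4, 1), (-1, -2, 1)], [(-1, -4, 1), (-1, -2, 1)],
   [(-1, -4, 1)], [(-2, -3, 1), (-2, -1, 1)], [(-2, -3, 1), (-2, -1, 1)], [(0, -4, 1)],
   [(-1, -3, 1), (-1, -1, 1)], [(-1, -3, 1), (-1, -1, 1)], [(-1, -3, 1)], [(-1, -3, 1)],
   [(-2, -2, 1), (-2, 0, 1)], [(-1, -3, 1)], [(0, -3, 1)], [(0, -3, 1)],
   [(-1, -2, 1), (-1, 0, 1)], [(0, -3, 1)], [(-1, -2, 1)], [(-1, -2, 1)], [(-1, -2, 1)],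
   [(-1, -2, 1)], [(0, -2, 1)], [(0, -2, 1)], [(0, -2, 1)], [(0, -2, 1)], [(-1, -1, 1)], [],
   [(-1, -1, 1)], [(-1, -1, 1)], [(0, -1, 1)], [], [(0, -1, 1)], [(0, -1, 1)], [], [],
   [(-1, 0, 1)], [], [], [(0, 0, 1)], [], [], [], [], [], []],
   [[(-2, -5, 1), (-2, -3, 2), (-2, -1, 1), (0, -5, 1), (0, -3, 1)],
   [(-1, -5, 1), (-1, -3, 2), (1, -5, 1)],
   [(-2, -4, 1), (-2, -2, 2), (-2, 0, 1), (0, -4, 1), (0, -2, 1)],
   [(-2, -4, 1), (-2, -2, 2), (-2, 0, 1), (0, -4, 1)], [(-1, -4, 1), (-1, -2, 2), (1, -4, 1)],
   [(-1, -4, 1), (-1, -2, 2), (1, -4, 1)], [(-1, -4, 1), (-1, -2, 2), (1, -4, 1)],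
   [(-2, -3, 1), (-2, -1, 2), (-2, 1, 1), (0, -3, 1)],
   [(-2, -3, 1), (-2, -1, 2), (-2, 1, 1), (0, -3, 1)], [(0, -4, 1), (0, -2, 1)],
   [(-1, -3, 1), (-1, -1, 1)], [(-1, -3, 1), (-1, -1, 2), (1, -3, 1)],
   [(-1, -3, 1), (-1, -1, 2), (1, -3, 1)], [(-1, -3, 1), (-1, -1, 2), (1, -3, 1)],
   [(-2, -2, 1), (-2, 0, 2), (-2, 2, 1), (0, -2, 1)], [(-1, -3, 1), (-1, -1, 1)],
   [(0, -3, 1), (0, -1, 1)], [(0, -3, 1)], [(-1, -2, 1), (-1, 0, 1)], [(0, -3, 1)],
   [(-1, -2, 1), (-1, 0, 1)], [(-1, -2, 1), (-1, 0, 2), (1, -2, 1)], [(-1, -2, 1), (-1, 0, 1)],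
   [(-1, -2, 1), (-1, 0, 1)], [(0, -2, 1)], [(0, -2, 1)], [(0, -2, 1)], [(0, -2, 1)],
   [(-1, -1, 1), (-1, 1, 1)], [(0, -2, 1)], [(-1, -1, 1), (-1, 1, 1)], [], [(0, -1, 1)], [],
   [(0, -1, 1)], [], [(0, -1, 1)], [(0, -1, 1)], [], [], [], [], [(0, 0, 1)], [], [], [], [], []],
   [[(-2, -5, 1), (-2, -3, 1)], [(-1, -5, 1), (-1, -3, 1)], [(-2, -4, 1), (-2, -2, 1)],
   [(-2, -4, 1), (-2, -2, 1)], [(-1, -4, 1)], [(-1, -4, 1), (-1, -2, 1)],
   [(-1, -4, 1), (-1, -2, 1)], [(-2, -3, 1), (-2, -1, 1)], [(-2, -3, 1), (-2, -1, 1)],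
   [(0, -4, 1)], [(-1, -3, 1)], [(-1, -3, 1)], [(-1, -3, 1)], [(-1, -3, 1), (-1, -1, 1)],
   [(-2, -2, 1), (-2, 0, 1)], [(-1, -3, 1), (-1, -1, 1)], [(0, -3, 1)], [(0, -3, 1)],
   [(-1, -2, 1)], [(0, -3, 1)], [(-1, -2, 1)], [(-1, -2, 1)], [(-1, -2, 1), (-1, 0, 1)],
   [(-1, -2, 1)], [(0, -2, 1)], [], [(0, -2, 1)], [(0, -2, 1)], [(-1, -1, 1)], [(0, -2, 1)],
   [(-1, -1, 1)], [(-1, -1, 1)], [], [], [], [(0, -1, 1)], [(0, -1, 1)], [(0, -1, 1)],
   [(-1, 0, 1)], [], [], [], [], [(0, 0, 1)], [], [], [], []],
   [[(-3, -5, 1), (-3, -1, -1)], [(-2, -5, 1), (-2, -1, -1)], [(-3, -4, 1), (-3, 0, -1)],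
   [(-3, -4, 1)], [(-2, -4, 1), (-2, 0, -1)], [(-2, -4, 1)], [(-2, -4, 1), (-2, 0, -1)],
   [(-3, -3, 1)], [(-3, -3, 1)], [(-1, -4, 1), (-1, 0, -1)], [(-2, -3, 1)], [(-2, -3, 1)],
   [(-2, -3, 1), (-2, 1, -1)], [(-2, -3, 1)], [(-3, -2, 1)], [(-2, -3, 1)],
   [(-1, -3, 1), (-1, 1, -1)], [(-1, -3, 1)], [(-2, -2, 1)], [(-1, -3, 1)], [(-2, -2, 1)],
   [(-2, -2, 1)], [(-2, -2, 1)], [(-2, -2, 1)], [(-1, -2, 1)], [(-1, -2, 1)], [(-1, -2, 1)],
   [(-1, -2, 1)], [(-2, -1, 1)], [(-1, -2, 1)], [(-2, -1, 1)], [], [(-1, -1, 1)], [(0, -2, 1)],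
   [(-1, -1, 1)], [], [(-1, -1, 1)], [(-1, -1, 1)], [], [(0, -1, 1)], [(0, -1, 1)], [],
   [(-1, 0, 1)], [], [(0, 0, 1)], [], [], []],
   [[(-3, -5, 1), (-3, -1, -1)], [(-2, -5, 1), (-2, -1, -1)], [(-3, -4, 1)],
   [(-3, -4, 1), (-3, 0, -1)], [(-2, -4, 1)], [(-2, -4, 1), (-2, 0, -1)], [(-2, -4, 1)],
   [(-3, -3, 1)], [(-3, -3, 1)], [(-1, -4, 1)], [(-2, -3, 1)], [(-2, -3, 1)],
   [(-2, -3, 1), (-2, -1, -1)], [(-2, -3, 1)], [(-3, -2, 1)], [(-2, -3, 1)],
   [(-1, -3, 1), (-1, -1, -1)], [(-1, -3, 1)], [(-2, -2, 1)], [(-1, -3, 1)],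
   [(-2, -2, 1), (-2, 0, -1)], [(-2, -2, 1)], [(-2, -2, 1)], [(-2, -2, 1), (-2, 0, -1)],
   [(-1, -2, 1), (-1, 0, -1)], [(-1, -2, 1)], [(-1, -2, 1)], [(-1, -2, 1), (-1, 0, -1)],
   [(-2, -1, 1)], [(-1, -2, 1)], [(-2, -1, 1)], [(-2, -1, 1), (-2, 1, -1)], [(-1, -1, 1)],
   [(0, -2, 1)], [(-1, -1, 1)], [(-1, -1, 1), (-1, 1, -1)], [(-1, -1, 1)], [(-1, -1, 1)],
   [(-2, 0, 1)], [(0, -1, 1)], [(0, -1, 1)], [(-1, 0, 1)], [], [(-1, 0, 1)], [], [(0, 0, 1)], [],
   []],
   [[(-2, -6, 1), (-2, -4, 1), (-2, -2, 1)], [(-1, -6, 1), (-1, -4, 1)],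
   [(-2, -5, 1), (-2, -3, 1), (-2, -1, 1)], [(-2, -5, 1), (-2, -3, 1), (-2, -1, 1)],
   [(-1, -5, 1), (-1, -3, 1)], [(-1, -5, 1), (-1, -3, 1)], [(-1, -5, 1), (-1, -3, 1)],
   [(-2, -4, 1), (-2, -2, 1), (-2, 0, 1)], [(-2, -4, 1), (-2, -2, 1), (-2, 0, 1)], [(0, -5, 1)],
   [(-1, -4, 1), (-1, -2, 1)], [(-1, -4, 1), (-1, -2, 1)], [(-1, -4, 1), (-1, -2, 1)],
   [(-1, -4, 1), (-1, -2, 1)], [(-2, -3, 1), (-2, -1, 1), (-2, 1, 1)], [(-1, -4, 1), (-1, -2, 1)],
   [(0, -4, 1)], [(0, -4, 1)], [(-1, -3, 1), (-1, -1, 1)], [(0, -4, 1)],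
   [(-1, -3, 1), (-1, -1, 1)], [(-1, -3, 1), (-1, -1, 1)], [(-1, -3, 1), (-1, -1, 1)],
   [(-1, -3, 1), (-1, -1, 1)], [(0, -3, 1)], [(0, -3, 1)], [(0, -3, 1)], [(0, -3, 1)],
   [(-1, -2, 1), (-1, 0, 1)], [(0, -3, 1)], [(-1, -2, 1), (-1, 0, 1)], [(-1, -2, 1), (-1, 0, 1)],
   [(0, -2, 1)], [], [(0, -2, 1)], [(0, -2, 1)], [(0, -2, 1)], [(0, -2, 1)],
   [(-1, -1, 1), (-1, 1, 1)], [], [], [(0, -1, 1)], [(0, -1, 1)], [(0, -1, 1)], [], [],
   [(0, 0, 1)], []],
   [[(-3, -6, 1)], [(-2, -6, 1)], [(-3, -5, 1)], [(-3, -5, 1)], [(-2, -5, 1)], [(-2, -5, 1)],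
   [(-2, -5, 1)], [(-3, -4, 1)], [(-3, -4, 1)], [(-1, -5, 1)], [(-2, -4, 1)], [(-2, -4, 1)],
   [(-2, -4, 1)], [(-2, -4, 1)], [(-3, -3, 1)], [(-2, -4, 1)], [(-1, -4, 1)], [(-1, -4, 1)],
   [(-2, -3, 1)], [(-1, -4, 1)], [(-2, -3, 1)], [(-2, -3, 1)], [(-2, -3, 1)], [(-2, -3, 1)],
   [(-1, -3, 1)], [(-1, -3, 1)], [(-1, -3, 1)], [(-1, -3, 1)], [(-2, -2, 1)], [(-1, -3, 1)],
   [(-2, -2, 1)], [(-2, -2, 1)], [(-1, -2, 1)], [(0, -3, 1)], [(-1, -2, 1)], [(-1, -2, 1)],
   [(-1, -2, 1)], [(-1, -2, 1)], [(-2, -1, 1)], [(0, -2, 1)], [(0, -2, 1)], [(-1, -1, 1)],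
   [(-1, -1, 1)], [(-1, -1, 1)], [(0, -1, 1)], [(0, -1, 1)], [(-1, 0, 1)], [(0, 0, 1)]]]"

definition mu_table :: "(nat \<times> lpol) list list list" where
  "mu_table = [
   [[], [], [], [], [(1, [(-1, 1, 1), (1, -1, 1)])], [], [], [], [], [],
   [(5, [(-1, 1, 1), (1, -1, 1)])], [(5, [(-1, 1, 1), (1, -1, 1)])],
   [(6, [(-1, 1, 1), (1, -1, 1)])], [], [], [], [], [], [], [], [(13, [(-1, 1, 1), (1, -1, 1)])],
   [(13, [(-1, 1, 1), (1, -1, 1)])], [], [(15, [(-1, 1, 1), (1, -1, 1)])], [],
   [(16, [(-1, 1, 1), (1, -1, 1)]), (17, [(-1, 1, 1), (1, -1, 1)])], [], [], [], [],
   [(22, [(-1, 1, 1), (1, -1, 1)])],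
   [(5, [(-1, 1, 1), (1, -1, 1)]), (22, [(-1, 1, 1), (1, -1, 1)])],
   [(24, [(-1, 1, 1), (1, -1, 1)])], [],
   [(26, [(-1, 1, 1), (1, -1, 1)]), (27, [(-1, 1, 1), (1, -1, 1)])], [], [], [], [], [], [],
   [(35, [(-1, 1, 1), (1, -1, 1)])],
   [(16, [(-1, 1, 1), (1, -1, 1)]), (36, [(-1, 1, 1), (1, -1, 1)]), (37, [(-1, 1, 1), (1, -1, 1)])],
   [], [], [], [(43, [(-1, 1, 1), (1, -1, 1)])], []],
   [[], [], [], [], [], [], [], [(2, [(0, 0, 1)])], [], [], [(4, [(0, 0, 1)])], [], [], [], [],
   [], [], [], [], [], [(12, [(0, 0, 1)])], [], [], [], [(16, [(0, 0, 1)])], [], [], [], [],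
   [(16, [(0, 0, 1)])], [],
   [(14, [(-1, 2, 1), (1, -2, 1)]), (18, [(0, 0, 1)]), (23, [(0, 0, 1)])], [],
   [(16, [(-1, 2, -1), (1, -2, -1)])], [], [(27, [(0, 0, 1)])], [], [], [], [], [], [], [],
   [(37, [(0, 0, 1)])], [], [(40, [(0, 0, 1)])], [], []],
   [[], [], [], [], [], [], [], [], [(3, [(0, 0, 1)])], [], [], [(5, [(0, 0, 1)])], [], [], [],
   [(5, [(0, 0, 1)])], [], [], [], [(5, [(-1, 2, -1), (1, -2, -1)])], [], [(13, [(0, 0, 1)])], [],
   [], [], [(17, [(0, 0, 1)])], [], [], [], [(13, [(-1, 2, -1), (1, -2, -1)])],
   [(14, [(-1, 2, 1), (1, -2, 1)]), (22, [(0, 0, 1)])], [], [],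
   [(17, [(-1, 2, -1), (1, -2, -1)])], [(18, [(-1, 2, 1), (1, -2, 1)]), (26, [(0, 0, 1)])], [],
   [], [], [], [], [], [], [(28, [(-1, 2, 1), (1, -2, 1)]), (32, [(0, 0, 1)]), (36, [(0, 0, 1)])],
   [], [(39, [(0, 0, 1)])], [], [], []]]"

definition vpol :: "nat \<Rightarrow> lpol" where
  "vpol i = (if i = 0 then [(1, 0, 1)] else [(0, 1, 1)])"

definition vipol :: "nat \<Rightarrow> lpol" where
  "vipol i = (if i = 0 then [(- 1, 0, 1)] else [(0, - 1, 1)])"

text \<open>At a descent C_i C_k = (v_i + v_i^-1) C_k. The list \<open>vipol i @ vpol i\<close> is
  that scalar with its exponents in increasing order.\<close>

definition KL_prod :: "nat \<Rightarrow> nat \<Rightarrow> nat \<Rightarrow> (nat \<times> lpol) list" where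
  "KL_prod i k ik = (if k < ik then (ik, [(0, 0, 1)]) # mu_table ! i ! k else [(k, vipol i @ vpol i)])"

fun hcomb :: "(nat \<times> lpol) list \<Rightarrow> lpol list" where
  "hcomb [] = hzero"
| "hcomb ((z, m) # g) = hadd (hscale m (KL_table ! z)) (hcomb g)"

definition KL_prod_ok :: "nat \<Rightarrow> nat \<Rightarrow> nat \<Rightarrow> bool" where
  "KL_prod_ok i k ik \<longleftrightarrow> hgen i (vipol i) (vpol i) (KL_table ! k) = hcomb (KL_prod i k ik)"

text \<open>\<open>pbar\<close> reverses the order of exponents, so \<open>rev (pbar m) = m\<close>
  is bar invariance in sorted form. The bound 0 at a descent forces the list to be empty, and the
  last clause says that \<open>i\<close> is a descent of \<open>z\<close>.\<close>

definition mu_ok :: "nat \<Rightarrow> nat \<Rightarrow> nat \<Rightarrow> bool" where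
  "mu_ok i k ik \<longleftrightarrow> list_all (\<lambda>(z, m). z < (if k < ik then ik else 0) \<and> rev (pbar m) = m \<and> lmul_table ! i ! z < z) (mu_table ! i ! k)"

definition KL_entry_ok :: "nat \<Rightarrow> nat \<times> lpol \<Rightarrow> bool" where
  "KL_entry_ok k = (\<lambda>(j, p). if j = k then p = [(0, 0, 1)]
     else list_all (\<lambda>(a, b, c). a + b < 0 \<or> (a + b = 0 \<and> a < 0)) p)"

text \<open>A nonzero coefficient at an element requires one in the row of the shorter element,
  either at the same place or at its image under the first letter. This is the step from one word to
  the next in the subword argument for the Bruhat condition.\<close>

definition KL_support_ok :: "lpol list \<Rightarrow> lpol \<times> nat \<times> lpol \<Rightarrow> bool" where
  "KL_support_ok row = (\<lambda>(p, j, q). p = [] \<or> q \<noteq> [] \<or> row ! j \<noteq> [])"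

definition KL_row_ok :: "nat \<times> nat list \<times> lpol list \<Rightarrow> bool" where
  "KL_row_ok = (\<lambda>(k, w, row). list_all (KL_entry_ok k) (zip indices row) \<and>
     (case w of [] \<Rightarrow> list_all (\<lambda>(j, p). j = 0 \<or> p = []) (zip indices row)
      | i # _ \<Rightarrow> list_all (KL_support_ok (KL_table ! (lmul_table ! i ! k)))
          (zip row (zip (lmul_table ! i) (KL_table ! (lmul_table ! i ! k))))))"

lemma KL_prod_checks:
  "list_all (\<lambda>(k, ik). KL_prod_ok 0 k ik) (zip indices (lmul_table ! 0))"
  "list_all (\<lambda>(k, ik). KL_prod_ok 1 k ik) (zip indices (lmul_table ! 1))"
  "list_all (\<lambda>(k, ik). KL_prod_ok 2 k ik) (zip indices (lmul_table ! 2))"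
  by code_simp+

lemma mu_checks:
  "list_all (\<lambda>i. list_all (\<lambda>(k, ik). mu_ok i k ik) (zip indices (lmul_table ! i))) [0, 1, 2]"
  by code_simp

lemma KL_table_lengths: "list_all (\<lambda>row. length row = 48) KL_table" "length KL_table = 48"
  by code_simp+

lemma KL_row_checks: "list_all KL_row_ok (zip indices (zip word_table KL_table))"
  by code_simp

lemma lmul_table_nth: "lmul_table ! i ! k = lmul i k"
  by (simp add: lmul_def)

lemma list_all_zip_indices:
  "list_all P (zip indices xs) \<Longrightarrow> length xs = 48 \<Longrightarrow> k < 48 \<Longrightarrow> P (k, xs ! k)"
  by (simp add: list_all_length length_indices nth_indices)

lemma length_KL_row: "k < 48 \<Longrightarrow> length (KL_table ! k) = 48"
  using KL_table_lengths by (simp add: list_all_length)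

lemma pval_vpol: "pval (vpol i) = v_gen i" and pval_vipol: "pval (vipol i) = v_gen_inv i"
  by (simp_all add: vpol_def vipol_def v_gen_def v_gen_inv_def monom_def pval_Cons)

text \<open>Left multiplication by the Kazhdan-Lusztig element of the generator, which is T_i +
  v_i^-1.\<close>

definition C :: "nat \<Rightarrow> hecke \<Rightarrow> hecke" where
  "C i h = L i h + smul (v_gen_inv i) h"

definition H :: "nat \<Rightarrow> hecke" where
  "H k = hval (KL_table ! k)"

lemma H_H3 [simp]: "H k \<in> H3"
  by (simp add: H_def)

lemma C_H3 [simp]: "i < 3 \<Longrightarrow> h \<in> H3 \<Longrightarrow> C i h \<in> H3"
  by (simp add: C_def)

lemma C_linear: "hecke_linear (C i)"
  by (simp add: module_hom_iff smul_module C_def L_simps hecke.scale_right_distrib ac_simps)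

lemmas C_simps = hecke_linearD [OF C_linear]

lemma bar_C: "i < 3 \<Longrightarrow> h \<in> H3 \<Longrightarrow> bar (C i h) = C i (bar h)"
  by (simp add: C_def bar_simps bar_L laurent_bar_v Linv_def vv_def hecke.scale_left_diff_distrib)

definition C_coeffs :: "nat \<Rightarrow> nat \<Rightarrow> (nat \<times> lpol) list" where
  "C_coeffs i k = KL_prod i k (lmul i k)"

lemma mu_entries:
  assumes "i < 3" "k < 48" "(z, m) \<in> set (mu_table ! i ! k)"
  shows "ascent i k" "z < lmul i k" "rev (pbar m) = m" "\<not> ascent i z"
proof -
  have "mu_ok i k (lmul i k)"
    using list_all_zip_indices [OF all_gens [OF mu_checks assms(1)], of k] assms
    by (simp add: length_lmul_table lmul_table_nth)
  then have "case (z, m) of (z, m) \<Rightarrow> z < (if k < lmul i k then lmul i k else 0) \<and>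
      rev (pbar m) = m \<and> lmul_table ! i ! z < z"
    unfolding mu_ok_def list_all_iff by (rule bspec [OF _ assms(3)])
  then have *: "z < (if k < lmul i k then lmul i k else 0)" "rev (pbar m) = m" "lmul i z < z"
    by (simp_all add: lmul_table_nth)
  then show "ascent i k" "z < lmul i k"
    using assms by (auto simp: ascent_iff_less split: if_splits)
  show "rev (pbar m) = m" by fact
  show "\<not> ascent i z"
    using * \<open>z < lmul i k\<close> lmul_less [OF assms(1,2)] assms ascent_iff_less [of i z] by simp
qed

lemma C_coeffs_entries:
  assumes "i < 3" "k < 48" "(z, m) \<in> set (C_coeffs i k)"
  shows "z < 48" "\<not> ascent i z"
proof -
  consider "ascent i k" "z = lmul i k" | "(z, m) \<in> set (mu_table ! i ! k)" | "\<not> ascent i k" "z = k"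
    using assms by (auto simp: C_coeffs_def KL_prod_def ascent_iff_less split: if_splits)
  then have "z < 48 \<and> \<not> ascent i z"
    using mu_entries [OF assms(1,2), of z m] lmul_less [OF assms(1,2)] ascent_lmul [OF assms(1,2)] assms
    by cases auto
  then show "z < 48" "\<not> ascent i z" by auto
qed

lemma hcomb:
  assumes "\<And>z m. (z, m) \<in> set g \<Longrightarrow> z < 48"
  shows "length (hcomb g) = 48 \<and> hval (hcomb g) = (\<Sum>(z, m)\<leftarrow>g. smul (pval m) (H z))"
  using assms
proof (induction g)
  case (Cons p g)
  obtain z m where p: "p = (z, m)" by (cases p)
  have "z < 48" "length (hcomb g) = 48 \<and> hval (hcomb g) = (\<Sum>(z, m)\<leftarrow>g. smul (pval m) (H z))"
    using Cons p by auto
  moreover from this have "length (hscale m (KL_table ! z)) = 48"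
    by (simp add: hscale_def length_KL_row)
  ultimately show ?case
    by (simp add: p hval_hadd hadd_nth hval_hscale length_KL_row H_def)
next
  case Nil
  show ?case by (simp add: hval_hzero) (simp add: hzero_def)
qed

lemma C_H:
  assumes "i < 3" "k < 48"
  shows "C i (H k) = (\<Sum>(z, m)\<leftarrow>C_coeffs i k. smul (pval m) (H z))"
proof -
  have "list_all (\<lambda>(k, ik). KL_prod_ok i k ik) (zip indices (lmul_table ! i))"
    using assms(1) KL_prod_checks by (auto simp: less_Suc_eq numeral_3_eq_3 numeral_2_eq_2)
  then have *: "hgen i (vipol i) (vpol i) (KL_table ! k) = hcomb (C_coeffs i k)"
    using list_all_zip_indices [of "\<lambda>(k, ik). KL_prod_ok i k ik" "lmul_table ! i" k] assms
    by (simp add: length_lmul_table KL_prod_ok_def C_coeffs_def lmul_table_nth)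
  have "C i (H k) = hval (hgen i (vipol i) (vpol i) (KL_table ! k))"
    unfolding C_def H_def
    by (subst hval_hgen [OF assms(1)]) (simp_all add: pval_vpol pval_vipol vv_def)
  then show ?thesis
    using hcomb [of "C_coeffs i k"] C_coeffs_entries [OF assms] * by metis
qed

lemma C_H_descent:
  assumes "i < 3" "k < 48" "\<not> ascent i k"
  shows "C i (H k) = smul (v_gen i + v_gen_inv i) (H k)"
  unfolding C_H [OF assms(1,2)] C_coeffs_def KL_prod_def
  using assms by (simp add: ascent_iff_less vpol_def vipol_def pval_Cons v_gen_def v_gen_inv_def
      monom_def add.commute)

lemma C_H_ascent:
  assumes "i < 3" "k < 48" "ascent i k"
  shows "C i (H k) = H (lmul i k) + (\<Sum>(z, m)\<leftarrow>mu_table ! i ! k. smul (pval m) (H z))"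
  unfolding C_H [OF assms(1,2)] C_coeffs_def KL_prod_def
  using assms by (simp add: ascent_iff_less pval_Cons single_00)

lemma KL_row:
  assumes "k < 48"
  shows "list_all (KL_entry_ok k) (zip indices (KL_table ! k)) \<and>
     (case word k of [] \<Rightarrow> list_all (\<lambda>(j, p). j = 0 \<or> p = []) (zip indices (KL_table ! k))
      | i # _ \<Rightarrow> list_all (KL_support_ok (KL_table ! lmul i k))
          (zip (KL_table ! k) (zip (lmul_table ! i) (KL_table ! lmul i k))))"
proof -
  have "length word_table = 48" by (simp add: word_table_def)
  then show ?thesis
    using list_all_zip_indices [OF KL_row_checks, of k] assms KL_table_lengths
    by (simp add: KL_row_ok_def lmul_table_nth word_def split: list.splits)
qed

lemma KL_entry:
  assumes "j < 48" "k < 48"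
  shows "KL_table ! k ! k = [(0, 0, 1)]"
    and "j \<noteq> k \<Longrightarrow> (a, b, c) \<in> set (KL_table ! k ! j) \<Longrightarrow> wlex_less (a, b) (0, 0)"
proof -
  have *: "KL_entry_ok k (j, KL_table ! k ! j)" if "j < 48" for j
    using list_all_zip_indices [of "KL_entry_ok k" "KL_table ! k" j] that KL_row [OF assms(2)]
    by (simp add: length_KL_row assms)
  show "KL_table ! k ! k = [(0, 0, 1)]"
    using * [OF assms(2)] by (simp add: KL_entry_ok_def)
  assume "j \<noteq> k" "(a, b, c) \<in> set (KL_table ! k ! j)"
  then show "wlex_less (a, b) (0, 0)"
    using * [OF assms(1)] by (auto simp: KL_entry_ok_def list_all_iff wlex_less_def)
qed

lemma word_step:
  assumes "k < 48" "k \<noteq> 0"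
  obtains i j where "i < 3" "j < 48" "ascent i j" "lmul i j = k" "j = lmul i k" "word k = i # word j"
proof -
  define i where "i = hd (word k)"
  have word: "word k = i # word (lmul i k)"
    using word_Cons assms by (simp add: i_def)
  then have i: "i < 3"
    using letters_word [OF assms(1)] by auto
  have "wlen k = Suc (wlen (lmul i k))"
    using word unfolding wlen_def by (metis length_Cons)
  then show ?thesis
    using that [of i "lmul i k"] i assms word by (auto simp: lmul_less lmul_lmul ascent_def)
qed

text \<open>Induction along the word: by \<open>KL_support_ok\<close> the index \<open>j\<close>
  comes from a subword for the shorter element, with the first letter either omitted or put in
  front.\<close>

lemma KL_support:
  assumes "k < 48" "j < 48" "KL_table ! k ! j \<noteq> []"
  shows "\<exists>ys. subseq ys (word k) \<and> ys \<in> lists {..<3} \<and> index ys = j"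
  using assms
proof (induction "wlen k" arbitrary: k j rule: less_induct)
  case less
  show ?case
  proof (cases "k = 0")
    case True
    then have "list_all (\<lambda>(j, p). j = 0 \<or> p = []) (zip indices (KL_table ! k))"
      using KL_row [OF less.prems(1)] by simp
    then have "j = 0"
      using list_all_zip_indices [of _ "KL_table ! k" j] less.prems by (fastforce simp: length_KL_row)
    then show ?thesis
      using True by (auto simp: index_def)
  next
    case False
    then obtain i k' where i: "i < 3" and k': "k' < 48" "ascent i k'" "lmul i k' = k" "k' = lmul i k"
      and word: "word k = i # word k'"
      using word_step less.prems(1) by metis
    have "list_all (KL_support_ok (KL_table ! k')) (zip (KL_table ! k) (zip (lmul_table ! i) (KL_table ! k')))"
      using KL_row [OF less.prems(1)] word k' by simp
    then have "KL_support_ok (KL_table ! k') (KL_table ! k ! j, lmul i j, KL_table ! k' ! j)"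
      using less.prems k' i
      by (simp add: list_all_length length_KL_row length_lmul_table lmul_table_nth)
    then consider "KL_table ! k' ! j \<noteq> []" | "KL_table ! k' ! lmul i j \<noteq> []"
      using less.prems by (auto simp: KL_support_ok_def)
    then show ?thesis
    proof cases
      case 1
      then obtain ys where "subseq ys (word k')" "ys \<in> lists {..<3}" "index ys = j"
        using less.hyps [of k' j] k' word less.prems by (auto simp: wlen_def)
      then show ?thesis
        using word by (intro exI [of _ ys]) auto
    next
      case 2
      then obtain ys where "subseq ys (word k')" "ys \<in> lists {..<3}" "index ys = lmul i j"
        using less.hyps [of k' "lmul i j"] k' word less.prems i by (auto simp: wlen_def lmul_less)
      then show ?thesis
        using word i less.prems
        by (intro exI [of _ "i # ys"]) (auto simp: index_Cons lmul_lmul)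
    qed
  qed
qed

lemma lookup_H: "k < 48 \<Longrightarrow> j < 48 \<Longrightarrow> lookup (H k) (cls j) = pval (KL_table ! k ! j)"
  by (simp add: H_def lookup_hval)

lemma lookup_H_self: "k < 48 \<Longrightarrow> lookup (H k) (cls k) = 1"
  by (simp add: lookup_H KL_entry(1) pval_Cons single_00)

lemma bruhat_support:
  assumes "k < 48" "j < 48" "j \<noteq> k" "lookup (H k) (cls j) \<noteq> 0"
  shows "bruhat_less (cls j) (cls k)"
proof -
  have "KL_table ! k ! j \<noteq> []"
    using assms lookup_H by fastforce
  then obtain ys where "subseq ys (word k)" "ys \<in> lists {..<3}" "index ys = j"
    using KL_support assms by metis
  then show ?thesis
    using assms reduced_word unfolding bruhat_less_def by (metis cls_inject mem_cls)
qed

lemma keys_pval: "keys (pval p) \<subseteq> {(a, b). \<exists>c. (a, b, c) \<in> set p}"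
proof (induction p)
  case (Cons m p)
  obtain a b c where m: "m = (a, b, c)" by (cases m)
  show ?case
    using Cons Poly_Mapping.keys_add [of "Poly_Mapping.single (a, b) c" "pval p"]
    by (force simp: m pval_Cons split: if_splits)
qed simp

lemma lookup_H_neg: "k < 48 \<Longrightarrow> j < 48 \<Longrightarrow> j \<noteq> k \<Longrightarrow> lookup (H k) (cls j) \<in> A_neg wlex_less"
  using keys_pval KL_entry(2) by (fastforce simp: lookup_H A_neg_def)

lemma pval_rev: "pval (rev p) = pval p"
  by (simp add: pval_def rev_map [symmetric] sum_list_rev)

lemma H_0: "H 0 = e 0"
proof -
  have "KL_table ! 0 ! j = []" if "j < 48" "j \<noteq> 0" for j
  proof -
    have "list_all (\<lambda>(j, p). j = 0 \<or> p = []) (zip indices (KL_table ! 0))"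
      using KL_row [of 0] by simp
    then show ?thesis
      using list_all_zip_indices [of _ "KL_table ! 0" j] that by (fastforce simp: length_KL_row)
  qed
  then show ?thesis
    using KL_entry(1) [of 0 0]
    by (subst hecke_sum_e [OF H_H3])
      (simp add: lookup_H pval_Cons single_00 sum.remove [of _ "0 :: nat"])
qed

text \<open>C_k equals C_i C_j minus bar-invariant multiples of elements with smaller numbers, and
  C_i commutes with bar. Invariance thus propagates from T_1 without expanding bar in the basis
  T_w.\<close>

lemma bar_H: "k < 48 \<Longrightarrow> bar (H k) = H k"
proof (induction k rule: less_induct)
  case (less k)
  show ?case
  proof (cases "k = 0")
    case True
    then show ?thesis
      by (simp add: H_0 bar_e)
  next
    case False
    then obtain i j where i: "i < 3" and j: "j < 48" "ascent i j" "lmul i j = k"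
      using word_step less.prems by metis
    have mu: "bar (smul (pval m) (H z)) = smul (pval m) (H z)" if "(z, m) \<in> set (mu_table ! i ! j)" for z m
      using mu_entries [OF i j(1) that] less j
      by (metis bar_simps(2) less_trans pval_pbar pval_rev)
    have "H k = C i (H j) - (\<Sum>(z, m)\<leftarrow>mu_table ! i ! j. smul (pval m) (H z))"
      using C_H_ascent [OF i j(1,2)] j(3) by simp
    moreover have "bar (H j) = H j"
      using less j i by (simp add: ascent_iff_less)
    moreover have "bar (\<Sum>(z, m)\<leftarrow>ms. smul (pval m) (H z)) = (\<Sum>(z, m)\<leftarrow>ms. smul (pval m) (H z))"
      if "set ms \<subseteq> set (mu_table ! i ! j)" for ms
      using that
    proof (induction ms)
      case Nil
      then show ?case using bar_simps(2) [of 0 0] by (simp add: laurent_bar_0)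
    qed (auto simp: bar_simps(1) mu)
    ultimately show ?thesis
      using i by (simp add: bar_simps bar_C)
  qed
qed

lemma KL_eq_H:
  assumes "k < 48"
  shows "KL wlex_less 3 (cls k) = H k"
  unfolding KL_def
proof (rule the_equality)
  let ?P = "\<lambda>h. (\<exists>g\<in>H3. h = T (cls k) + g \<and>
      (\<forall>y\<in>keys g. bruhat_less y (cls k) \<and> lookup g y \<in> A_neg wlex_less)) \<and> bar h = h"
  have H: "?P (H k)"
  proof (intro conjI bexI [of _ "H k - e k"] ballI)
    fix y assume y: "y \<in> keys (H k - e k)"
    moreover have "H k - e k \<in> H3" using assms by simp
    ultimately obtain j where j: "j < 48" "y = cls j"
      unfolding H3_iff by auto
    have "j \<noteq> k"
      using y j assms lookup_H_self by (auto simp: in_keys_iff lookup_minus lookup_e)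
    then show "bruhat_less y (cls k)" "lookup (H k - e k) y \<in> A_neg wlex_less"
      using y j assms bruhat_support lookup_H_neg by (auto simp: in_keys_iff lookup_minus lookup_e)
  qed (use assms bar_H H3_simps(5) [of k] in \<open>auto simp: e_def\<close>)
  then show "?P (H k)" .
  fix h assume "?P h"
  then obtain g where g: "g \<in> H3" "h = T (cls k) + g"
    "\<And>y. y \<in> keys g \<Longrightarrow> bruhat_less y (cls k) \<and> lookup g y \<in> A_neg wlex_less" "bar h = h" by auto
  from H obtain g' where g': "g' \<in> H3" "H k = T (cls k) + g'"
    "\<And>y. y \<in> keys g' \<Longrightarrow> bruhat_less y (cls k) \<and> lookup g' y \<in> A_neg wlex_less" "bar (H k) = H k" by auto
  \<comment> \<open>In the difference of two candidates the leading term cancels, leaving a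
    bar-invariant element all of whose coefficients are combinations of monomials below 1.\<close>
  have "lookup (g - g') (cls j) \<in> A_neg wlex_less" for j
  proof -
    have "0 \<in> A_neg wlex_less" by (simp add: A_neg_def)
    then have "lookup g (cls j) \<in> A_neg wlex_less" "lookup g' (cls j) \<in> A_neg wlex_less"
      using g(3) [of "cls j"] g'(3) [of "cls j"] by (metis in_keys_iff)+
    moreover have "keys (lookup g (cls j) - lookup g' (cls j)) \<subseteq> keys (lookup g (cls j)) \<union> keys (lookup g' (cls j))"
      by (rule keys_diff)
    ultimately show ?thesis
      by (auto simp: A_neg_def lookup_minus)
  qed
  moreover have "bar (g - g') = g - g'"
    using g g' by (metis add_diff_cancel_left bar_simps(3))
  ultimately have "g - g' = 0"
    using g g' by (intro bar_invariant_neg_eq_0) auto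
  then show "h = H k"
    using g g' by simp
qed

section \<open>Coordinates in the Kazhdan-Lusztig basis and left ideals spanned by basis
  elements\<close>

definition comb :: "(nat \<Rightarrow> laurent) \<Rightarrow> hecke" where
  "comb c = (\<Sum>k<48. smul (c k) (H k))"

lemma comb_H3 [simp]: "comb c \<in> H3"
  unfolding comb_def by (intro H3_sum) simp

lemma comb_add: "comb c + comb d = comb (\<lambda>k. c k + d k)"
  and comb_smul: "smul a (comb c) = comb (\<lambda>k. a * c k)"
  by (simp_all add: comb_def hecke.scale_left_distrib sum.distrib hecke.scale_sum_right)

lemma comb_single: "k < 48 \<Longrightarrow> comb (\<lambda>j. if j = k then a else 0) = smul a (H k)"
  by (simp add: comb_def if_distrib [where f = "\<lambda>a. smul a x" for x] cong: if_cong)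

text \<open>At an index of maximal length among the nonzero coefficients only \<open>H j\<close>
  itself contributes to T_j, with coefficient 1.\<close>

lemma comb_eq_0:
  assumes "comb c = 0" "k < 48"
  shows "c k = 0"
proof (rule ccontr)
  assume "c k \<noteq> 0"
  let ?S = "{k. k < 48 \<and> c k \<noteq> 0}"
  have "?S \<noteq> {}" using \<open>c k \<noteq> 0\<close> assms(2) by auto
  then have "Max (wlen ` ?S) \<in> wlen ` ?S"
    by (intro Max_in) auto
  then obtain j where j: "j \<in> ?S" and "wlen j = Max (wlen ` ?S)"
    by (metis (no_types, lifting) imageE)
  then have max: "wlen k \<le> wlen j" if "k \<in> ?S" for k
    using that by simp
  have "lookup (comb c) (cls j) = (\<Sum>k<48. c k * lookup (H k) (cls j))"
    by (simp add: comb_def lookup_sum lookup_smul)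
  also have "\<dots> = (\<Sum>k<48. if k = j then c j else 0)"
  proof (rule sum.cong)
    fix k assume k: "k \<in> {..<48::nat}"
    have "c k = 0 \<or> lookup (H k) (cls j) = 0" if "k \<noteq> j"
    proof (rule ccontr)
      assume "\<not> ?thesis"
      then have "k \<in> ?S" "wlen j < wlen k"
        using that k j bruhat_support [of k j] bruhat_less_wlen [of j k] by auto
      then show False using max [of k] by simp
    qed
    then show "c k * lookup (H k) (cls j) = (if k = j then c j else 0)"
      using j lookup_H_self [of j] by auto
  qed simp
  also have "\<dots> = c j" using j by simp
  finally show False using assms(1) j by simp
qed

text \<open>The triangular change of basis is inverted by induction on length: \<open>e k\<close> is
  \<open>H k\<close> minus multiples of shorter basis elements.\<close>

lemma comb_surj: "h \<in> H3 \<Longrightarrow> h \<in> range comb"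
proof -
  have sub: "hecke.subspace (range comb)"
    unfolding hecke.subspace_def
    using comb_single [of 0 0] by (auto simp: comb_add comb_smul)
  have "e k \<in> range comb" if "k < 48" for k
    using that
  proof (induction "wlen k" arbitrary: k rule: less_induct)
    case less
    have "H k = (\<Sum>j<48. smul (lookup (H k) (cls j)) (e j))"
      by (rule hecke_sum_e) simp
    also have "\<dots> = e k + (\<Sum>j\<in>{..<48} - {k}. smul (lookup (H k) (cls j)) (e j))"
      using less.prems by (simp add: sum.remove [of _ k] lookup_H_self)
    finally have ek: "e k = H k - (\<Sum>j\<in>{..<48} - {k}. smul (lookup (H k) (cls j)) (e j))"
      by (rule eq_diff_eq [THEN iffD2, OF HOL.sym])
    moreover have "H k \<in> range comb"
      using comb_single [OF less.prems, of 1] by (metis hecke.scale_one range_eqI)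
    moreover have "smul (lookup (H k) (cls j)) (e j) \<in> range comb" if "j \<in> {..<48} - {k}" for j
    proof (cases "lookup (H k) (cls j) = 0")
      case True
      then show ?thesis using hecke.subspace_0 [OF sub] by simp
    next
      case False
      then show ?thesis
        using that less bruhat_support [of k j] bruhat_less_wlen [of j k]
        by (intro hecke.subspace_scale [OF sub]) auto
    qed
    then have "(\<Sum>j\<in>{..<48} - {k}. smul (lookup (H k) (cls j)) (e j)) \<in> range comb"
      by (rule hecke.subspace_sum [OF sub])
    ultimately show ?case
      unfolding ek by (intro hecke.subspace_diff [OF sub])
  qed
  then have "H3 \<subseteq> range comb"
    unfolding H3_span by (intro hecke.span_minimal [OF _ sub]) auto
  then show "h \<in> H3 \<Longrightarrow> h \<in> range comb" by auto
qed

text \<open>\<open>comb\<close> only reads the values below 48, so the chosen function is determined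
  on these indices and arbitrary beyond; hence the bounds in the lemmas about it.\<close>

definition coord :: "hecke \<Rightarrow> nat \<Rightarrow> laurent" where
  "coord h = (SOME c. comb c = h)"

lemma comb_coord:
  assumes "h \<in> H3"
  shows "comb (coord h) = h"
proof -
  obtain c where "comb c = h" using comb_surj [OF assms] by auto
  then show ?thesis unfolding coord_def by (rule someI [of "\<lambda>c. comb c = h"])
qed

lemma coord_comb:
  assumes "k < 48"
  shows "coord (comb c) k = c k"
proof -
  have "comb (\<lambda>k. coord (comb c) k + (- 1) * c k) = 0"
    unfolding comb_add [symmetric] comb_smul [symmetric] by (simp add: comb_coord)
  then show ?thesis
    using comb_eq_0 [OF _ assms] by fastforce
qed

lemma coord_simps:
  assumes "k < 48"
  shows "g \<in> H3 \<Longrightarrow> h \<in> H3 \<Longrightarrow> coord (g + h) k = coord g k + coord h k"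
    and "h \<in> H3 \<Longrightarrow> coord (smul a h) k = a * coord h k"
    and "g \<in> H3 \<Longrightarrow> h \<in> H3 \<Longrightarrow> coord (g - h) k = coord g k - coord h k"
    and "coord 0 k = 0"
    and "j < 48 \<Longrightarrow> coord (H j) k = (if j = k then 1 else 0)"
proof -
  show add: "coord (g + h) k = coord g k + coord h k" if "g \<in> H3" "h \<in> H3" for g h
    using coord_comb [OF assms] comb_coord [OF that(1)] comb_coord [OF that(2)] comb_add by metis
  show smul: "coord (smul a h) k = a * coord h k" if "h \<in> H3" for a h
    using coord_comb [OF assms] comb_coord [OF that] comb_smul by metis
  show "coord (g - h) k = coord g k - coord h k" if "g \<in> H3" "h \<in> H3"
    using add [of g "smul (- 1) h"] smul [of h "- 1"] that H3_simps(3) [of h "- 1"] by simp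
  show "coord 0 k = 0"
    using smul [of 0 0] by simp
  show "coord (H j) k = (if j = k then 1 else 0)" if "j < 48"
    using coord_comb [OF assms, of "\<lambda>i. if i = j then 1 else 0"] comb_single [OF that, of 1] by auto
qed

lemma coord_sum:
  "k < 48 \<Longrightarrow> (\<And>a. a \<in> A \<Longrightarrow> f a \<in> H3) \<Longrightarrow> coord (sum f A) k = (\<Sum>a\<in>A. coord (f a) k)"
proof (induction A rule: infinite_finite_induct)
  case (insert a A)
  then show ?case using H3_sum [of A f] by (simp add: coord_simps)
qed (simp_all add: coord_simps)

lemma coord_sum_list:
  assumes "k < 48" "\<And>z m. (z, m) \<in> set ms \<Longrightarrow> z < 48"
  shows "coord (\<Sum>(z, m)\<leftarrow>ms. smul (pval m) (H z)) k = (\<Sum>(z, m)\<leftarrow>ms. if z = k then pval m else 0)"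
proof -
  have "(\<Sum>(z, m)\<leftarrow>ms. smul (pval m) (H z)) \<in> H3 \<and> ?thesis" if "\<forall>p\<in>set ms. fst p < 48"
    using that by (induction ms) (auto simp: coord_simps assms(1))
  then show ?thesis using assms(2) by fastforce
qed

definition H_span :: "nat set \<Rightarrow> hecke set" where
  "H_span D = {h \<in> H3. \<forall>k<48. coord h k \<noteq> 0 \<longrightarrow> k \<in> D}"

lemma A_span_H:
  assumes "D \<subseteq> {..<48}"
  shows "A_span (H ` D) = H_span D"
proof
  have "hecke.subspace (H_span D)"
    unfolding hecke.subspace_def H_span_def by (auto simp: coord_simps)
  then show "A_span (H ` D) \<subseteq> H_span D"
  proof (rule hecke.span_minimal [rotated])
    have "j < 48" if "j \<in> D" for j using assms that by auto
    then show "H ` D \<subseteq> H_span D"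
      by (auto simp: H_span_def coord_simps split: if_splits)
  qed
  show "H_span D \<subseteq> A_span (H ` D)"
  proof
    fix h assume h: "h \<in> H_span D"
    have "smul (coord h k) (H k) \<in> A_span (H ` D)" if "k < 48" for k
      using h that by (cases "coord h k = 0")
        (auto simp: H_span_def intro: hecke.span_zero hecke.span_scale hecke.span_base)
    then have "comb (coord h) \<in> A_span (H ` D)"
      unfolding comb_def by (intro hecke.span_sum) auto
    then show "h \<in> A_span (H ` D)"
      using h by (simp add: H_span_def comb_coord)
  qed
qed

lemma H_span_simps:
  "0 \<in> H_span D" "g \<in> H_span D \<Longrightarrow> h \<in> H_span D \<Longrightarrow> g + h \<in> H_span D"
  "h \<in> H_span D \<Longrightarrow> smul a h \<in> H_span D" "g \<in> H_span D \<Longrightarrow> h \<in> H_span D \<Longrightarrow> g - h \<in> H_span D"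
  "h \<in> H_span D \<Longrightarrow> h \<in> H3"
  by (auto simp: H_span_def coord_simps)

text \<open>Downward closed for the left pre-order. The span of such a set is stable under every
  C_i, hence a left ideal.\<close>

definition step_closed :: "nat set \<Rightarrow> bool" where
  "step_closed D \<longleftrightarrow> D \<subseteq> {..<48} \<and> (\<forall>i<3. \<forall>k\<in>D. \<forall>z<48. coord (C i (H k)) z \<noteq> 0 \<longrightarrow> z \<in> D)"

lemma C_H_span:
  assumes "step_closed D" "i < 3" "h \<in> H_span D"
  shows "C i h \<in> H_span D"
proof -
  have "C i (comb (coord h)) = (\<Sum>k<48. smul (coord h k) (C i (H k)))"
    by (simp add: comb_def C_simps)
  then have h: "h \<in> H3" "C i h = (\<Sum>k<48. smul (coord h k) (C i (H k)))"
    using assms(3) comb_coord [of h] by (simp_all add: H_span_def)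
  have coord: "coord (C i h) z = (\<Sum>k<48. coord h k * coord (C i (H k)) z)" if "z < 48" for z
    unfolding h(2) using assms that by (subst coord_sum) (auto simp: coord_simps)
  have "z \<in> D" if z: "z < 48" "coord (C i h) z \<noteq> 0" for z
  proof -
    have "(\<Sum>k<48. coord h k * coord (C i (H k)) z) \<noteq> 0"
      using coord [OF z(1)] z(2) by simp
    then obtain k where "k \<in> {..<48}" "coord h k * coord (C i (H k)) z \<noteq> 0"
      by (rule sum.not_neutral_contains_not_neutral)
    then have "k < 48" "coord h k \<noteq> 0" "coord (C i (H k)) z \<noteq> 0" by auto
    then show ?thesis
      using assms z by (auto simp: step_closed_def H_span_def)
  qed
  moreover have "C i h \<in> H3"
    using assms(2) h(1) by (rule C_H3)
  ultimately show ?thesis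
    unfolding H_span_def by blast
qed

lemma hmult_H_span:
  assumes "step_closed D" "g \<in> H3" "h \<in> H_span D"
  shows "g \<star> h \<in> H_span D"
proof -
  have h: "h \<in> H3" using assms(3) by (rule H_span_simps(5))
  have L: "L i h \<in> H_span D" if "i < 3" "h \<in> H_span D" for i h
  proof -
    have "L i h = C i h - smul (v_gen_inv i) h" by (simp add: C_def)
    then show ?thesis
      using that by (auto intro: H_span_simps C_H_span [OF assms(1)])
  qed
  have "foldr L xs h \<in> H_span D" if "xs \<in> lists {..<3}" for xs
    using that by (induction xs rule: list.induct) (simp_all add: L assms)
  then have e: "e k \<star> h \<in> H_span D" if "k < 48" for k
    using that h letters_word by (simp add: hmult_e)
  have "g \<star> h = (\<Sum>k<48. smul (lookup g (cls k)) (e k)) \<star> h"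
    using hecke_sum_e [OF assms(2)] by simp
  also have "\<dots> = (\<Sum>k<48. smul (lookup g (cls k)) (e k \<star> h))"
    by (simp add: hmult_simps)
  also have "\<dots> \<in> A_span (H ` D)"
    using e assms(1) by (intro hecke.span_sum hecke.span_scale) (simp add: A_span_H step_closed_def)
  finally show ?thesis
    using assms(1) by (simp add: A_span_H step_closed_def)
qed

section \<open>Left cells\<close>

lemma H_gen_hmult:
  assumes "i < 3" "h \<in> H3"
  shows "H (index [i]) \<star> h = C i h"
proof -
  have "mu_table ! i ! 0 = []"
    using all_gens [of "\<lambda>i. mu_table ! i ! 0 = []"] assms by (simp add: mu_table_def)
  moreover have "ascent i 0"
    using ascent_iff_less [OF assms(1), of 0] lmul_neq [OF assms(1), of 0] by simp
  ultimately have "H (index [i]) = C i (e 0)"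
    using C_H_ascent [OF assms(1), of 0] by (simp add: H_0 index_def)
  then show ?thesis
    using assms by (simp add: C_def hmult_simps L_hmult)
qed

lemma left_step_iff:
  assumes "z < 48" "y < 48"
  shows "left_step wlex_less 3 (cls z) (cls y) \<longleftrightarrow> (\<exists>i<3. coord (C i (H y)) z \<noteq> 0)"
proof -
  have inj: "inj_on cls {..<48}"
    by (auto simp: inj_on_def cls_inject)
  have sum: "(\<Sum>w\<in>carrier (W 3). smul (c w) (KL wlex_less 3 w)) = comb (\<lambda>k. c (cls k))" for c
    by (simp add: carrier_W3 sum.reindex [OF inj] comb_def KL_eq_H)
  have KL: "KL wlex_less 3 (gen 3 i) \<star> KL wlex_less 3 (cls y) = C i (H y)" if "i < 3" for i
    using that assms index_less [of "[i]"] by (simp add: gen_index KL_eq_H H_gen_hmult)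
  show ?thesis
  proof
    assume "left_step wlex_less 3 (cls z) (cls y)"
    then obtain i c where "i < 3" "C i (H y) = comb (\<lambda>k. c (cls k))" "c (cls z) \<noteq> 0"
      by (auto simp: left_step_def KL sum)
    then show "\<exists>i<3. coord (C i (H y)) z \<noteq> 0"
      using coord_comb assms by metis
  next
    assume "\<exists>i<3. coord (C i (H y)) z \<noteq> 0"
    then obtain i where i: "i < 3" "coord (C i (H y)) z \<noteq> 0" by auto
    define c where "c w = coord (C i (H y)) (inv_into {..<48} cls w)" for w
    have c: "c (cls k) = coord (C i (H y)) k" if "k < 48" for k
      using that inj by (simp add: c_def inv_into_f_f)
    have "C i (H y) = comb (coord (C i (H y)))"
      using i by (simp add: comb_coord)
    also have "\<dots> = comb (\<lambda>k. c (cls k))"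
      unfolding comb_def by (rule sum.cong) (simp_all add: c)
    finally show "left_step wlex_less 3 (cls z) (cls y)"
      unfolding left_step_def sum
      using i assms c
      by (intro conjI exI [of _ i] exI [of _ c]) (simp_all add: KL carrier_W3)
  qed
qed

text \<open>\<open>D\<close> collects everything below the cell and \<open>D0\<close> removes the
  cell itself. Both are downward closed, so the cell module becomes a quotient of two coordinate
  left ideals, and only this is remembered afterwards.\<close>

lemma left_cell_ideals:
  assumes "X \<in> left_cells wlex_less 3"
  obtains D D0 where "step_closed D" "step_closed D0" "D0 \<subseteq> D"
    "cell_ideal wlex_less 3 X = H_span D" "cell_ideal_hat wlex_less 3 X = H_span D0"
proof -
  let ?le = "left_le wlex_less 3"
  obtain x where X: "X = {y. x \<in> carrier (W 3) \<and> y \<in> carrier (W 3) \<and> ?le x y \<and> ?le y x}"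
    using assms by (auto simp: left_cells_def quotient_def left_le_def)
  have le_trans: "?le a b \<Longrightarrow> ?le b c \<Longrightarrow> ?le a c" for a b c
    by (simp add: left_le_def)
  define D where "D = {k. k < 48 \<and> (\<exists>w\<in>X. ?le (cls k) w)}"
  define D0 where "D0 = {k \<in> D. cls k \<notin> X}"
  have step: "?le (cls z) (cls k)" if "i < 3" "k < 48" "z < 48" "coord (C i (H k)) z \<noteq> 0" for i z k
    using that left_step_iff by (auto simp: left_le_def)
  have D: "step_closed D"
    unfolding step_closed_def D_def using step le_trans by blast
  \<comment> \<open>An element of \<open>D\<close> with a member of the cell below it is squeezed
    between two members of the cell. So a step from \<open>D0\<close> cannot enter the cell.\<close>
  have "cls k \<in> X" if "i < 3" and k: "k \<in> D" and "z < 48" "coord (C i (H k)) z \<noteq> 0" and z: "cls z \<in> X" for i z k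
  proof -
    have 1: "?le (cls z) (cls k)" using that step by (simp add: D_def)
    obtain w where w: "w \<in> X" "?le (cls k) w" using k by (auto simp: D_def)
    have x: "?le x (cls z)" "?le w x" "x \<in> carrier (W 3)"
      using z w(1) unfolding X by simp_all
    have "?le x (cls k)" "?le (cls k) x"
      using le_trans [OF x(1) 1] le_trans [OF w(2) x(2)] by simp_all
    moreover have "cls k \<in> carrier (W 3)"
      using k by (auto simp: D_def carrier_W3)
    ultimately show ?thesis
      using x(3) unfolding X by simp
  qed
  note up = this
  have D0: "step_closed D0"
    unfolding step_closed_def
  proof (intro conjI allI impI ballI)
    show "D0 \<subseteq> {..<48}" by (auto simp: D0_def D_def)
    fix i k z :: nat
    assume *: "i < 3" "k \<in> D0" "z < 48" "coord (C i (H k)) z \<noteq> 0"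
    then have k: "k \<in> D" "cls k \<notin> X" by (simp_all add: D0_def)
    then have "z \<in> D" using D * by (simp add: step_closed_def)
    moreover have "cls z \<notin> X" using up [OF *(1) k(1) *(3,4)] k(2) by (rule contrapos_nn [rotated])
    ultimately show "z \<in> D0" by (simp add: D0_def)
  qed
  have KL: "{KL wlex_less 3 y |y. y \<in> carrier (W 3) \<and> P y} = H ` {k. k < 48 \<and> P (cls k)}" for P
  proof -
    have "{KL wlex_less 3 y |y. y \<in> carrier (W 3) \<and> P y} = KL wlex_less 3 ` cls ` {k. k < 48 \<and> P (cls k)}"
      by (auto simp: carrier_W3)
    then show ?thesis
      by (simp add: image_image KL_eq_H cong: image_cong_simp)
  qed
  have 1: "cell_ideal wlex_less 3 X = H_span D"
    unfolding cell_ideal_def KL using A_span_H [of D] D by (simp add: D_def step_closed_def)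
  have "D0 = {k. k < 48 \<and> (\<exists>w\<in>X. ?le (cls k) w) \<and> cls k \<notin> X}"
    by (simp add: D0_def D_def)
  then have 2: "cell_ideal_hat wlex_less 3 X = H_span D0"
    unfolding cell_ideal_hat_def KL using A_span_H [of D0] D0 by (simp add: step_closed_def)
  show ?thesis
    using that D D0 1 2 by (auto simp: D0_def)
qed

section \<open>The symmetric group\<close>

text \<open>The six elements of the parabolic subgroup generated by s_1 and s_2, that is, those
  whose words avoid the letter 0.\<close>

definition sym_indices :: "nat list" where
  "sym_indices = [0, 2, 3, 7, 8, 14]"

definition perm :: "nat \<Rightarrow> nat \<Rightarrow> nat" where
  "perm k = word_perm (word k)"

lemma perm_eval:
  "perm 0 x = x"
  "perm 2 x = (if x = 1 then 2 else if x = 2 then 1 else x)"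
  "perm 3 x = (if x = 2 then 3 else if x = 3 then 2 else x)"
  "perm 7 x = (if x = 1 then 3 else if x = 2 then 1 else if x = 3 then 2 else x)"
  "perm 8 x = (if x = 1 then 2 else if x = 2 then 3 else if x = 3 then 1 else x)"
  "perm 14 x = (if x = 1 then 3 else if x = 3 then 1 else x)"
  by (simp_all add: perm_def word_simps transpose_def)

lemma sym_indices_less: "k \<in> set sym_indices \<Longrightarrow> k < 48"
  by (auto simp: sym_indices_def)

lemma perm_step:
  assumes "i \<in> {1, 2}" "k \<in> set sym_indices"
  shows "lmul i k \<in> set sym_indices \<and> transpose i (Suc i) \<circ> perm k = perm (lmul i k)"
proof (intro conjI ext)
  show "lmul i k \<in> set sym_indices"
    using assms by (auto simp: sym_indices_def lmul_eval)
  fix x :: nat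
  have "x = 1 \<or> x = 2 \<or> x = 3 \<or> x \<notin> {1, 2, 3}" by auto
  then show "(transpose i (Suc i) \<circ> perm k) x = perm (lmul i k) x"
    using assms by (elim disjE) (auto simp: sym_indices_def lmul_eval perm_eval transpose_def)
qed

lemma word_perm_index:
  "set xs \<subseteq> {1..<3} \<Longrightarrow> index xs \<in> set sym_indices \<and> word_perm xs = perm (index xs)"
proof (induction xs)
  case Nil
  then show ?case
    by (auto simp: index_def sym_indices_def perm_eval fun_eq_iff)
next
  case (Cons i xs)
  then have "i \<in> {1, 2}" by auto
  then show ?case
    using Cons perm_step [of i "index xs"] by (simp add: index_Cons)
qed

lemma perm_inject: "j \<in> set sym_indices \<Longrightarrow> k \<in> set sym_indices \<Longrightarrow> perm j = perm k \<Longrightarrow> j = k"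
  by (auto simp: sym_indices_def perm_eval dest: fun_cong [of _ _ 1] fun_cong [of _ _ 2])

lemma sym_elt_perm:
  assumes "k \<in> set sym_indices"
  shows "sym_elt 3 (perm k) = cls k"
  unfolding sym_elt_def
proof (rule the_equality)
  have "set (word k) \<subseteq> {1..<3}"
    using assms by (auto simp: sym_indices_def word_simps)
  moreover have "word k \<in> cls k"
    using sym_indices_less [OF assms] by (simp add: mem_cls letters_word index_word)
  ultimately show "cls k \<in> carrier (W 3) \<and> (\<exists>xs\<in>cls k. set xs \<subseteq> {1..<3} \<and> word_perm xs = perm k)"
    using sym_indices_less [OF assms] by (auto simp: carrier_W3 perm_def)
next
  fix w assume "w \<in> carrier (W 3) \<and> (\<exists>xs\<in>w. set xs \<subseteq> {1..<3} \<and> word_perm xs = perm k)"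
  then obtain j xs where j: "j < 48" "w = cls j" and xs: "xs \<in> w" "set xs \<subseteq> {1..<3}" "word_perm xs = perm k"
    unfolding carrier_W3 by auto
  then have "index xs = k"
    using word_perm_index [OF xs(2)] assms perm_inject by auto
  then show "w = cls k"
    using j xs mem_cls by auto
qed

lemma perm_permutes: "k \<in> set sym_indices \<Longrightarrow> perm k permutes {1..3}"
proof -
  have "word_perm xs permutes {1..3}" if "set xs \<subseteq> {1..<3}" for xs
    using that
  proof (induction xs)
    case (Cons i xs)
    have "transpose i (Suc i) permutes {1..3}"
      using Cons.prems by (intro permutes_swap_id) auto
    moreover have "word_perm xs permutes {1..3}"
      using Cons by simp
    ultimately show ?case
      unfolding word_perm.simps by (rule permutes_compose [rotated])
  qed (simp add: permutes_id)
  moreover have "k \<in> set sym_indices \<Longrightarrow> set (word k) \<subseteq> {1..<3}"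
    by (auto simp: sym_indices_def word_simps)
  ultimately show "k \<in> set sym_indices \<Longrightarrow> perm k permutes {1..3}"
    unfolding perm_def by blast
qed

lemma three_elements:
  assumes "distinct l" "set l = {1..3 :: nat}"
  shows "\<exists>k\<in>set sym_indices. l = map (perm k) [1, 2, 3]"
proof -
  have "length l = 3"
    using distinct_card [OF assms(1)] assms(2) by simp
  then obtain a b c where l: "l = [a, b, c]"
    by (auto simp: numeral_3_eq_3 length_Suc_conv)
  have "a \<in> {1..3}" "b \<in> {1..3}" "c \<in> {1..3}"
    using assms(2) l by auto
  then have "a = 1 \<or> a = 2 \<or> a = 3" "b = 1 \<or> b = 2 \<or> b = 3" "c = 1 \<or> c = 2 \<or> c = 3"
    by auto
  then show ?thesis
    using assms(1) l by (auto simp: sym_indices_def perm_eval)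
qed

lemma permutes_eq_perm:
  assumes "\<sigma> permutes {1..3}"
  shows "\<exists>k\<in>set sym_indices. \<sigma> = perm k"
proof -
  have "distinct (map \<sigma> [1, 2, 3])"
    using permutes_inj [OF assms] by (auto simp: inj_eq)
  moreover have "set (map \<sigma> [1, 2, 3]) = {1..3}"
  proof -
    have "{1..3 :: nat} = {1, 2, 3}" by auto
    then show ?thesis using permutes_image [OF assms] by simp
  qed
  ultimately obtain k where k: "k \<in> set sym_indices" "map \<sigma> [1, 2, 3] = map (perm k) [1, 2, 3]"
    using three_elements by metis
  have "\<sigma> x = perm k x" for x
  proof (cases "x \<in> {1..3}")
    case True
    then have "x = 1 \<or> x = 2 \<or> x = 3" by auto
    then show ?thesis using k by auto
  next
    case False
    then show ?thesis
      using permutes_not_in [OF assms False] permutes_not_in [OF perm_permutes [OF k(1)] False] by simp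
  qed
  then show ?thesis using k by auto
qed

lemma row_stabilizer_eq:
  "row_stabilizer 3 mu = cls ` {k \<in> set sym_indices.
     \<forall>r \<in> set (fst (t_super mu)) \<union> set (snd (t_super mu)). perm k ` set r = set r}"
  (is "_ = cls ` {k \<in> _. ?P (perm k)}")
proof (intro equalityI subsetI)
  fix w assume "w \<in> row_stabilizer 3 mu"
  then obtain \<sigma> where \<sigma>: "w = sym_elt 3 \<sigma>" "\<sigma> permutes {1..3}" "?P \<sigma>"
    unfolding row_stabilizer_def by blast
  then obtain k where "k \<in> set sym_indices" "\<sigma> = perm k"
    using permutes_eq_perm by metis
  then show "w \<in> cls ` {k \<in> set sym_indices. ?P (perm k)}"
    using \<sigma> by (intro image_eqI [of _ _ k]) (simp_all add: sym_elt_perm)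
next
  fix w assume "w \<in> cls ` {k \<in> set sym_indices. ?P (perm k)}"
  then obtain k where "w = cls k" "k \<in> set sym_indices" "?P (perm k)" by blast
  moreover from this have "w = sym_elt 3 (perm k)" "perm k permutes {1..3}"
    by (simp_all only: sym_elt_perm perm_permutes)
  ultimately show "w \<in> row_stabilizer 3 mu"
    unfolding row_stabilizer_def by blast
qed

section \<open>Bitaux and the elements d(t)\<close>

lemma concat_fill_rows: "concat (fill_rows k ps) = [k..<k + sum_list ps]"
proof (induction ps arbitrary: k)
  case (Cons p ps)
  then show ?case
    using upt_add_eq_append [of k "k + p" "sum_list ps"] by (simp add: add.assoc)
qed simp

lemma length_fill_rows: "map length (fill_rows k ps) = ps"
  by (induction ps arbitrary: k) auto

lemma t_super_entries:
  assumes "mu \<in> bipartitions 3"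
  shows "concat (fst (t_super mu)) @ concat (snd (t_super mu)) = [1, 2, 3]"
proof -
  have "sum_list (fst mu) + sum_list (snd mu) = 3"
    using assms by (auto simp: bipartitions_def)
  then have 3: "1 + sum_list (fst mu) + sum_list (snd mu) = 4" by simp
  have "concat (fst (t_super mu)) @ concat (snd (t_super mu)) =
      [1..<1 + sum_list (fst mu)] @ [1 + sum_list (fst mu)..<1 + sum_list (fst mu) + sum_list (snd mu)]"
    by (simp only: t_super_def concat_fill_rows fst_conv snd_conv)
  also have "\<dots> = [1..<1 + sum_list (fst mu) + sum_list (snd mu)]"
    by (rule upt_add_eq_append [symmetric]) simp
  also have "\<dots> = [1, 2, 3]"
    unfolding 3 by (simp add: upt_rec)
  finally show ?thesis .
qed

lemma concat_eqI: "map length xs = map length ys \<Longrightarrow> concat xs = concat ys \<Longrightarrow> xs = ys"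
proof (induction xs arbitrary: ys)
  case (Cons x xs)
  then show ?case by (cases ys) auto
qed auto

lemma d_elt_perm:
  assumes "mu \<in> bipartitions 3" "k \<in> set sym_indices" "act_bitableau (perm k) (t_super mu) = tt"
  shows "d_elt 3 mu tt = cls k"
proof -
  have "(THE \<sigma>. \<sigma> permutes {1..3} \<and> act_bitableau \<sigma> (t_super mu) = tt) = perm k"
  proof (rule the_equality)
    show "perm k permutes {1..3} \<and> act_bitableau (perm k) (t_super mu) = tt"
      using assms perm_permutes by simp
    fix \<sigma> assume \<sigma>: "\<sigma> permutes {1..3} \<and> act_bitableau \<sigma> (t_super mu) = tt"
    then obtain j where j: "j \<in> set sym_indices" "\<sigma> = perm j"
      using permutes_eq_perm by auto
    have "act_bitableau (perm j) (t_super mu) = act_bitableau (perm k) (t_super mu)"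
      using \<sigma> j assms by simp
    then have 1: "map (map (perm j)) (fst (t_super mu)) = map (map (perm k)) (fst (t_super mu))"
      and 2: "map (map (perm j)) (snd (t_super mu)) = map (map (perm k)) (snd (t_super mu))"
      by (simp_all only: act_bitableau_def prod.inject)
    have "map (perm j) [1, 2, 3] = map (perm k) [1, 2, 3]"
      unfolding t_super_entries [OF assms(1), symmetric] map_append map_concat 1 2 ..
    then show "\<sigma> = perm k"
      using j assms(2) by (auto simp: sym_indices_def perm_eval)
  qed
  then show ?thesis
    using sym_elt_perm assms by (simp add: d_elt_def)
qed

text \<open>The reading word of a bitableau is a rearrangement of 1, 2, 3, and for a fixed shape it
  determines the bitableau. So some \<open>perm k\<close> carries \<open>t_super mu\<close> to
  \<open>tt\<close>.\<close>

lemma d_elt_std: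
  assumes "mu \<in> bipartitions 3" "tt \<in> std_bitableaux 3 mu"
  shows "\<exists>k<48. d_elt 3 mu tt = cls k"
proof -
  obtain r1 r2 where tt: "tt = (r1, r2)" by (cases tt)
  have *: "map length r1 = fst mu" "map length r2 = snd mu"
    "distinct (concat r1 @ concat r2)" "set (concat r1 @ concat r2) = {1..3}"
    using assms(2) by (auto simp: std_bitableaux_def tt)
  obtain k where k: "k \<in> set sym_indices" "concat r1 @ concat r2 = map (perm k) [1, 2, 3]"
    using three_elements [OF *(3,4)] by auto
  let ?r1 = "map (map (perm k)) (fst (t_super mu))" and ?r2 = "map (map (perm k)) (snd (t_super mu))"
  have len: "map length ?r1 = fst mu" "map length ?r2 = snd mu"
    using length_fill_rows by (simp_all add: t_super_def comp_def)
  have "concat ?r1 @ concat ?r2 = concat r1 @ concat r2"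
    unfolding k t_super_entries [OF assms(1), symmetric] by (simp add: map_concat)
  moreover have "length (concat ?r1) = length (concat r1)"
    unfolding length_concat using len * by simp
  ultimately have "concat ?r1 = concat r1" "concat ?r2 = concat r2"
    by simp_all
  then have "?r1 = r1" "?r2 = r2"
    using len * by (auto intro: concat_eqI)
  then show ?thesis
    using d_elt_perm [OF assms(1) k(1), of tt] sym_indices_less [OF k(1)]
    by (auto simp: act_bitableau_def tt)
qed

section \<open>A representation of rank three\<close>

text \<open>Multiplication by a monomial translates the support by \<open>s\<close>, so the
  hypothesis would make a finite nonempty support stable under translation. This cancels factors
  such as 1 + V^2 without showing that the Laurent ring is an integral domain.\<close>

lemma shift_eq_0:
  fixes a :: laurent
  assumes "a + Poly_Mapping.single s 1 * a = 0" "s \<noteq> 0"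
  shows "a = 0"
proof (rule ccontr)
  assume "a \<noteq> 0"
  have single: "lookup (Poly_Mapping.single s 1 * b) (s + k) = lookup b k" for b :: laurent and k
  proof (induction b rule: laurent_induct)
    case (single l c)
    then show ?case by (auto simp: mult_single lookup_single when_def)
  qed (simp_all add: distrib_left lookup_add)
  have "lookup a (s + k) = - lookup a k" for k
    using single [of a k] arg_cong [OF assms(1), of "\<lambda>b. lookup b (s + k)"]
    by (simp add: lookup_add add_eq_0_iff2)
  then have step: "s + k \<in> keys a" if "k \<in> keys a" for k
    using that by (simp add: in_keys_iff)
  obtain i j where s: "s = (i, j)" by (cases s)
  \<comment> \<open>The inner product with \<open>s\<close> attains a maximum on the support, but
    translation by \<open>s\<close> raises it by i^2 + j^2 > 0.\<close>
  have "finite ((\<lambda>(a, b). i * a + j * b) ` keys a)" (is "finite ?K") by simp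
  moreover have "?K \<noteq> {}" using \<open>a \<noteq> 0\<close> by simp
  ultimately have "Max ?K \<in> ?K" "\<forall>x\<in>?K. x \<le> Max ?K"
    by (auto intro: Max_in)
  then obtain k where k: "k \<in> keys a" "\<forall>x\<in>?K. x \<le> (case k of (a, b) \<Rightarrow> i * a + j * b)"
    by (metis (no_types, lifting) imageE)
  obtain a' b' where k': "k = (a', b')" by (cases k)
  have "(i + a', j + b') \<in> keys a"
    using step [OF k(1)] by (simp add: s k')
  then have "i * (i + a') + j * (j + b') \<le> i * a' + j * b'"
    using k(2) k' by force
  then have "i * i + j * j \<le> 0"
    by (simp add: algebra_simps)
  then have "i = 0" "j = 0"
    by (metis add_nonneg_eq_0_iff antisym mult_eq_0_iff zero_le_square add_nonneg_nonneg)+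
  then show False
    using assms(2) s by (simp add: zero_prod_def)
qed

definition VV :: laurent where "VV = monom 1 0"
definition Vi :: laurent where "Vi = monom (- 1) 0"
definition pp :: laurent where "pp = monom 0 1"
definition pm :: laurent where "pm = monom 0 (- 1)"

lemma unit_simps:
  "VV * Vi = 1" "pp * pm = 1" "Vi * VV = 1" "pm * pp = 1"
  "VV * (Vi * c) = c" "pp * (pm * c) = c" "Vi * (VV * c) = c" "pm * (pp * c) = c"
  by (simp_all add: VV_def Vi_def pp_def pm_def monom_def mult_single single_00 flip: mult.assoc)

lemma vv_simps: "vv 0 = VV - Vi" "vv 1 = pp - pm" "vv (Suc 0) = pp - pm" "vv 2 = pp - pm"
  by (simp_all add: vv_def v_gen_def v_gen_inv_def VV_def Vi_def pp_def pm_def)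

type_synonym triple = "laurent \<times> laurent \<times> laurent"

fun tscale :: "laurent \<Rightarrow> triple \<Rightarrow> triple" where
  "tscale c (x, y, z) = (c * x, c * y, c * z)"

lemma tscale_module: "Modules.module tscale"
  by unfold_locales (auto simp: algebra_simps)

text \<open>The action on the basis $X$, $Y = T_1 X$, $Z = T_2 Y$ of the Specht module, with $X$ the
  class of the generator.\<close>

definition rho :: "nat \<Rightarrow> triple \<Rightarrow> triple" where
  "rho i = (\<lambda>(x, y, z).
     if i = 0 then (VV * x + Vi * (pp - pm) * (y + pp * z), - Vi * y, - Vi * z)
     else if i = 1 then (y, x + (pp - pm) * y, pp * z)
     else (pp * x, z, y + (pp - pm) * z))"

lemma rho_hom: "module_hom tscale tscale (rho i)"
  unfolding module_hom_iff
  by (auto simp: tscale_module rho_def algebra_simps split: prod.splits)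

lemmas rho_linear = module_hom.add [OF rho_hom] module_hom.scale [OF rho_hom]

lemma rho_quadratic:
  assumes "i < 3"
  shows "rho i (rho i t) = t + tscale (vv i) (rho i t)"
proof -
  obtain x y z where t: "t = (x, y, z)" by (cases t) auto
  have "i = 0 \<or> i = 1 \<or> i = 2" using assms by auto
  then show ?thesis
    by (elim disjE) (simp_all add: t rho_def vv_simps unit_simps algebra_simps)
qed

lemma rho_braid:
  assumes "i < 3" "j < 3"
  shows "foldr rho (braid i j) t = foldr rho (braid j i) t"
proof -
  obtain x y z where t: "t = (x, y, z)" by (cases t) auto
  have 1: "rho 0 (rho 1 (rho 0 (rho 1 t))) = rho 1 (rho 0 (rho 1 (rho 0 t)))"
    by (simp add: t rho_def algebra_simps, simp add: unit_simps algebra_simps)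
  have 2: "rho 1 (rho 2 (rho 1 t)) = rho 2 (rho 1 (rho 2 t))"
    by (simp add: t rho_def algebra_simps, simp add: unit_simps algebra_simps)
  have 3: "rho 0 (rho 2 t) = rho 2 (rho 0 t)"
    by (simp add: t rho_def algebra_simps, simp only: unit_simps add.commute)
  have "i = 0 \<or> i = 1 \<or> i = 2" "j = 0 \<or> j = 1 \<or> j = 2" using assms by auto
  then show ?thesis
    using 1 2 3 by (auto simp: braid_def)
qed

definition act :: "hecke \<Rightarrow> triple \<Rightarrow> triple" where
  "act h t = (\<Sum>w\<in>keys h. tscale (lookup h w) (foldr rho (SOME xs. reduced w xs) t))"

lemma act_hom: "module_hom smul tscale (\<lambda>h. act h t)"
  unfolding act_def by (rule module_hom_ext [OF tscale_module])

lemmas act_linear = module_hom.add [OF act_hom] module_hom.scale [OF act_hom]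
  module_hom.diff [OF act_hom] module_hom.sum [OF act_hom] module_hom.zero [OF act_hom]

lemma act_e:
  assumes "k < 48"
  shows "act (e k) t = foldr rho (word k) t"
proof -
  have "act (e k) t = foldr rho (SOME xs. reduced (cls k) xs) t"
    unfolding act_def e_def by (rule ext_T [OF tscale_module])
  moreover have "reduced (cls k) (SOME xs. reduced (cls k) xs)"
    using reduced_word [OF assms] by (rule someI)
  ultimately show ?thesis
    using assms foldr_reduced_word [where F = rho and D = UNIV and x = t] rho_braid
    by (simp add: reduced_iff index_def)
qed

lemma act_L:
  assumes "i < 3" "h \<in> H3"
  shows "act (L i h) t = rho i (act h t)"
proof (rule hecke_linear_eqI [OF _ _ _ assms(2)])
  show "module_hom smul tscale (\<lambda>h. act (L i h) t)" "module_hom smul tscale (\<lambda>h. rho i (act h t))"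
    by (simp_all add: module_hom_iff smul_module tscale_module L_simps act_linear rho_linear)
  have asc: "act (e (lmul i k)) t = rho i (act (e k) t)" if "k < 48" "ascent i k" for k
    using that assms foldr_word_step [where F = rho and D = UNIV and x = t] rho_braid
    by (simp add: act_e lmul_less)
  show "act (L i (e k)) t = rho i (act (e k) t)" if k: "k < 48" for k
  proof (cases "ascent i k")
    case True
    then show ?thesis using k assms by (simp add: L_e asc)
  next
    case False
    let ?j = "lmul i k"
    have j: "?j < 48" "ascent i ?j" "lmul i ?j = k"
      using k assms False by (simp_all add: lmul_less ascent_lmul lmul_lmul)
    have "act (e k) t = rho i (act (e ?j) t)"
      using asc [OF j(1,2)] j(3) by simp
    then show ?thesis
      using False assms j k by (simp add: L_e act_linear rho_quadratic)
  qed
qed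

lemma act_foldr_L: "xs \<in> lists {..<3} \<Longrightarrow> h \<in> H3 \<Longrightarrow> act (foldr L xs h) t = foldr rho xs (act h t)"
  by (induction xs rule: list.induct) (simp_all add: act_L foldr_L_H3)

lemma act_hmult:
  assumes "g \<in> H3" "h \<in> H3"
  shows "act (g \<star> h) t = act g (act h t)"
proof (rule hecke_linear_eqI [OF _ act_hom _ assms(1)])
  show "module_hom smul tscale (\<lambda>g. act (g \<star> h) t)"
    by (simp add: module_hom_iff smul_module tscale_module hmult_simps act_linear)
qed (use assms in \<open>simp add: hmult_e act_foldr_L act_e letters_word\<close>)

lemma act_linear2: "act h (s + t) = act h s + act h t" "act h (tscale c t) = tscale c (act h t)"
proof -
  have "foldr rho xs (s + t) = foldr rho xs s + foldr rho xs t"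
    "foldr rho xs (tscale c t) = tscale c (foldr rho xs t)" for xs
    by (induction xs) (simp_all add: rho_linear)
  then show "act h (s + t) = act h s + act h t" "act h (tscale c t) = tscale c (act h t)"
    using tscale_module
    by (simp_all add: act_def Modules.module.scale_right_distrib sum.distrib
        Modules.module.scale_sum_right Modules.module.scale_scale mult.commute)
qed

lemma act_0 [simp]: "act h 0 = 0"
  using act_linear2(1) [of h 0 0] by simp

section \<open>The Specht module\<close>

definition tword :: "nat \<Rightarrow> nat list" where
  "tword i = rev [1..<i] @ [0] @ [1..<i]"

definition uelt :: "nat \<Rightarrow> hecke" where
  "uelt i = smul (monom 0 (2 * (int i - 1))) (hecke_one 3) + smul (monom 1 (2 * (int i - 1))) (T (t_elt 3 i))"

definition uop :: "nat \<Rightarrow> hecke \<Rightarrow> hecke" where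
  "uop i h = smul (monom 0 (2 * (int i - 1))) h + smul (monom 1 (2 * (int i - 1))) (foldr L (tword i) h)"

lemma tword_simps: "tword (Suc 0) = [0]" "tword 2 = [1, 0, 1]" "tword 3 = [2, 1, 0, 1, 2]"
  by (simp_all add: tword_def upt_rec)

lemma tword_reduced:
  assumes "i \<in> {1, 2, 3}"
  shows "tword i \<in> lists {..<3}" "reduced (cls (index (tword i))) (tword i)"
  using assms by (auto simp: reduced_iff tword_simps index_def lmul_eval wlen_def word_eval)

lemma uelt:
  assumes "i \<in> {1, 2, 3}"
  shows "uelt i \<in> H3" "h \<in> H3 \<Longrightarrow> uelt i \<star> h = uop i h"
proof -
  let ?k = "index (tword i)"
  have k: "?k < 48"
    using tword_reduced(1) [OF assms] by (rule index_less)
  have "t_elt 3 i = word_class 3 (tword i)"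
    by (simp add: t_elt_def tword_def)
  then have u: "uelt i = smul (monom 0 (2 * (int i - 1))) (e 0) + smul (monom 1 (2 * (int i - 1))) (e ?k)"
    using word_class_index [OF tword_reduced(1) [OF assms]]
    by (simp add: uelt_def hecke_one_def one_W3 e_def)
  then show "uelt i \<in> H3" using k by simp
  show "uelt i \<star> h = uop i h" if "h \<in> H3"
    using k that foldr_L_reduced [OF k tword_reduced(2) [OF assms] that]
    by (simp add: u uop_def hmult_simps hmult_e [of ?k])
qed

text \<open>The product u_l^+ is treated as a composition of operators, which can be followed both
  on coefficient lists and under \<open>rho\<close> without expanding the product.\<close>

lemma foldr_uelt:
  assumes "set is \<subseteq> {1, 2, 3}"
  shows "foldr hmult (map uelt is) (e 0) \<in> H3 \<and>
    (\<forall>h\<in>H3. foldr hmult (map uelt is) (e 0) \<star> h = foldr uop is h)"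
  using assms
proof (induction "is")
  case (Cons i "is")
  then have i: "i \<in> {1, 2, 3}" and IH: "foldr hmult (map uelt is) (e 0) \<in> H3"
    "\<And>h. h \<in> H3 \<Longrightarrow> foldr hmult (map uelt is) (e 0) \<star> h = foldr uop is h" by auto
  let ?U = "foldr hmult (map uelt is) (e 0)"
  have "uelt i \<star> ?U \<in> H3"
    using uelt(1) [OF i] IH(1) by (rule hmult_H3)
  moreover have "uelt i \<star> ?U \<star> h = uop i (foldr uop is h)" if h: "h \<in> H3" for h
    using hmult_assoc [OF uelt(1) [OF i] IH(1) h] IH(2) [OF h] uelt(2) [OF i hmult_H3 [OF IH(1) h]]
    by simp
  ultimately show ?case
    by (simp only: list.map foldr.simps o_apply) blast
qed simp

lemma u_plus:
  assumes "l \<le> 3"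
  shows "u_plus 3 l \<in> H3" "h \<in> H3 \<Longrightarrow> u_plus 3 l \<star> h = foldr uop [1..<Suc l] h"
proof -
  have "set [1..<Suc l] \<subseteq> {1, 2, 3}"
    using assms by auto
  moreover have "u_plus 3 l = foldr hmult (map uelt [1..<Suc l]) (e 0)"
    unfolding u_plus_def uelt_def [abs_def] by (simp add: hecke_one_def one_W3 e_def del: upt_Suc)
  ultimately show "u_plus 3 l \<in> H3" "h \<in> H3 \<Longrightarrow> u_plus 3 l \<star> h = foldr uop [1..<Suc l] h"
    using foldr_uelt [of "[1..<Suc l]"] by simp_all
qed

definition rowsum :: "bipartition \<Rightarrow> hecke" where
  "rowsum mu = (\<Sum>w\<in>row_stabilizer 3 mu. smul (monom 0 (int (len w))) (T w))"

lemma rowsum_eq: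
  assumes "row_stabilizer 3 mu = cls ` set ks" "distinct ks" "set ks \<subseteq> {..<48}"
  shows "rowsum mu = (\<Sum>k\<leftarrow>ks. smul (monom 0 (int (wlen k))) (e k))"
proof -
  have "inj_on cls (set ks)"
    using assms(3) by (auto simp: inj_on_def cls_inject subset_iff)
  then have "rowsum mu = (\<Sum>k\<in>set ks. smul (monom 0 (int (len (cls k)))) (e k))"
    by (simp add: rowsum_def assms(1) sum.reindex e_def)
  also have "\<dots> = (\<Sum>k\<in>set ks. smul (monom 0 (int (wlen k))) (e k))"
    using assms(3) by (intro sum.cong) (auto simp: len_cls)
  also have "\<dots> = (\<Sum>k\<leftarrow>ks. smul (monom 0 (int (wlen k))) (e k))"
    by (simp add: sum.distinct_set_conv_list assms(2))
  finally show ?thesis .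
qed

lemma rowsum_H3: "rowsum mu \<in> H3"
proof -
  have "len (cls k) = wlen k \<and> e k \<in> H3" if "k \<in> set sym_indices" for k
    using sym_indices_less [OF that] by (simp add: len_cls)
  then show ?thesis
    unfolding rowsum_def row_stabilizer_eq
    by (intro H3_sum) (auto simp flip: e_def)
qed

lemma x_elt:
  assumes "sum_list (fst mu) \<le> 3"
  shows "x_elt 3 mu \<in> H3" "h \<in> H3 \<Longrightarrow> x_elt 3 mu \<star> h = foldr uop [1..<Suc (sum_list (fst mu))] (rowsum mu \<star> h)"
proof -
  have x: "x_elt 3 mu = u_plus 3 (sum_list (fst mu)) \<star> rowsum mu"
    by (simp add: x_elt_def rowsum_def)
  note u = u_plus [OF assms]
  show "x_elt 3 mu \<in> H3"
    unfolding x using u(1) rowsum_H3 by (rule hmult_H3)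
  show "x_elt 3 mu \<star> h = foldr uop [1..<Suc (sum_list (fst mu))] (rowsum mu \<star> h)" if "h \<in> H3"
    unfolding x hmult_assoc [OF u(1) rowsum_H3 that] using rowsum_H3 that by (intro u(2) hmult_H3)
qed

lemma bipartition_le: "mu \<in> bipartitions 3 \<Longrightarrow> sum_list (fst mu) \<le> 3"
  by (auto simp: bipartitions_def)

lemma x_st_eq:
  assumes "mu \<in> bipartitions 3" "a < 48" "b < 48" "d_elt 3 mu s = cls a" "d_elt 3 mu t = cls b"
  defines "b' \<equiv> index (rev (word b))"
  shows "x_st 3 mu s t = foldr L (word a) (foldr uop [1..<Suc (sum_list (fst mu))] (rowsum mu \<star> e b'))"
    and "x_st 3 mu s t = e a \<star> (x_elt 3 mu \<star> e b')" "b' < 48"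
proof -
  show b': "b' < 48"
    using assms(3) letters_word unfolding b'_def by (intro index_less) (auto simp: in_lists_conv_set)
  note x = x_elt [OF bipartition_le [OF assms(1)]]
  show 1: "x_st 3 mu s t = e a \<star> (x_elt 3 mu \<star> e b')"
    using x b' assms inv_cls [OF assms(3)]
    by (simp add: x_st_def hmult_assoc flip: e_def)
  have "x_elt 3 mu \<star> e b' \<in> H3"
    using x(1) b' by simp
  then show "x_st 3 mu s t = foldr L (word a) (foldr uop [1..<Suc (sum_list (fst mu))] (rowsum mu \<star> e b'))"
    unfolding 1 using assms(2) x(2) b' by (simp add: hmult_e del: upt_Suc)
qed

subsection \<open>The ideal acts by zero on the representation\<close>

lemma act_uop:
  assumes "i \<in> {1, 2, 3}" "h \<in> H3"
  shows "act (uop i h) t = tscale (monom 0 (2 * (int i - 1))) (act h t) +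
    tscale (monom 1 (2 * (int i - 1))) (foldr rho (tword i) (act h t))"
  using assms tword_reduced(1) [OF assms(1)]
  by (simp add: uop_def act_linear act_foldr_L)

lemma uop_H3: "i \<in> {1, 2, 3} \<Longrightarrow> h \<in> H3 \<Longrightarrow> uop i h \<in> H3"
  using uelt hmult_H3 by metis

lemma foldr_uop_H3: "set is \<subseteq> {1, 2, 3} \<Longrightarrow> h \<in> H3 \<Longrightarrow> foldr uop is h \<in> H3"
  by (induction "is") (simp_all add: uop_H3)

lemma monom_simps: "monom 0 0 = 1" "monom 1 0 = VV" "monom 0 2 = pp * pp" "monom 1 2 = VV * (pp * pp)"
  by (simp_all add: VV_def pp_def monom_def mult_single single_00)

text \<open>The operators \<open>uop 1\<close> and \<open>uop 2\<close> are the two factors of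
  u_2^+. Its vanishing under \<open>rho\<close> is what makes all of \<open>N_hat\<close> act by
  zero.\<close>

lemma act_u2:
  assumes "h \<in> H3"
  shows "act (uop 1 (uop 2 h)) t = 0"
proof -
  obtain x y z where t: "act h t = (x, y, z)" by (cases "act h t") auto
  have "act (uop 1 (uop 2 h)) t = 0"
    using assms by (simp add: act_uop uop_H3 t tword_simps rho_def monom_simps zero_prod_def
      unit_simps algebra_simps)
  then show ?thesis .
qed

text \<open>The inequalities for j = 1 force the first component to be nonempty and its size plus
  the first part of the second component to be at least 3. If the first component had size 1, the
  bipartition would be ((1)|(2)) itself.\<close>

lemma strictly_dominated_ge_2:
  assumes "mu \<in> bipartitions 3" "strictly_dominated ([1], [2]) mu"
  shows "sum_list (fst mu) \<ge> 2"
proof (rule ccontr)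
  assume less: "\<not> 2 \<le> sum_list (fst mu)"
  obtain p q where mu: "mu = (p, q)" by (cases mu)
  have pq: "is_partition p" "is_partition q" "sum_list p + sum_list q = 3" "sum_list p < 2"
    using assms(1) less by (auto simp: bipartitions_def mu)
  have "dominated ([1], [2]) (p, q)"
    using assms(2) by (simp add: strictly_dominated_def mu)
  then have dom: "sum_list (take 1 [1]) \<le> sum_list (take 1 p)" "1 + sum_list (take 1 [2]) \<le> sum_list p + sum_list (take 1 q)"
    unfolding dominated_def fst_conv snd_conv by (drule_tac x = 1 in spec, simp)+
  obtain a p' where p: "p = a # p'" using dom(1) by (cases p) auto
  then have "1 \<le> a" "a + sum_list p' < 2" using pq dom(1) by simp_all
  then have "a = 1" "sum_list p' = 0" by linarith+
  moreover have "p' = []"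
  proof (cases p')
    case (Cons b r)
    then show ?thesis
      using pq(1) p \<open>sum_list p' = 0\<close> by (auto simp: is_partition_def)
  qed
  ultimately have p1: "p = [1]" using p by simp
  obtain b q' where q: "q = b # q'" using dom(2) p1 by (cases q) auto
  then have "2 \<le> b" "b + sum_list q' = 2" using pq dom(2) p1 by simp_all
  then have "b = 2" "sum_list q' = 0" by linarith+
  moreover have "q' = []"
  proof (cases q')
    case (Cons c r)
    then show ?thesis
      using pq(2) q \<open>sum_list q' = 0\<close> by (auto simp: is_partition_def)
  qed
  ultimately have "mu = ([1], [2])" using p1 q mu by simp
  then show False using assms(2) by (simp add: strictly_dominated_def)
qed

lemma N_hat_act:
  assumes "h \<in> N_hat 3 ([1], [2])"
  shows "h \<in> H3 \<and> (\<forall>t. act h t = 0)"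
proof -
  let ?K = "{h \<in> H3. \<forall>t. act h t = 0}"
  have "hecke.subspace ?K"
    by (auto simp: hecke.subspace_def act_linear) (simp_all add: zero_prod_def)
  moreover have "x_st 3 mu s t \<in> ?K" if mu: "mu \<in> bipartitions 3" "strictly_dominated ([1], [2]) mu"
    and st: "s \<in> std_bitableaux 3 mu" "t \<in> std_bitableaux 3 mu" for mu s t
  proof -
    let ?l = "sum_list (fst mu)"
    obtain a b where ab: "a < 48" "d_elt 3 mu s = cls a" "b < 48" "d_elt 3 mu t = cls b"
      using d_elt_std [OF mu(1) st(1)] d_elt_std [OF mu(1) st(2)] by auto
    let ?b = "index (rev (word b))"
    note x = x_st_eq [OF mu(1) ab(1,3,2,4)]
    \<comment> \<open>Since the first component has size at least 2, both factors of u_2^+ stand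
      outermost, where \<open>act_u2\<close> applies.\<close>
    have "[1..<Suc ?l] = 1 # 2 # [3..<Suc ?l]"
      using strictly_dominated_ge_2 [OF mu] by (simp add: upt_conv_Cons numeral_eq_Suc)
    moreover have "foldr uop [3..<Suc ?l] (rowsum mu \<star> e ?b) \<in> H3"
      using bipartition_le [OF mu(1)] x(3)
      by (intro foldr_uop_H3 hmult_H3 rowsum_H3 H3_simps) auto
    ultimately have "act (x_elt 3 mu \<star> e ?b) u = 0" for u
      using x_elt [OF bipartition_le [OF mu(1)]] x(3) act_u2 by simp
    moreover have "x_elt 3 mu \<star> e ?b \<in> H3"
      using x(3) by (intro hmult_H3 x_elt(1) bipartition_le mu(1) H3_simps(5))
    ultimately show ?thesis
      unfolding x(2) using ab by (simp add: act_hmult)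
  qed
  ultimately have "N_hat 3 ([1], [2]) \<subseteq> ?K"
    unfolding N_hat_def by (intro hecke.span_minimal) auto
  then show ?thesis using assms by auto
qed

subsection \<open>Spanning modulo the ideal\<close>

definition vvpol :: "nat \<Rightarrow> lpol" where
  "vvpol i = (if i = 0 then [(- 1, 0, - 1), (1, 0, 1)] else [(0, - 1, - 1), (0, 1, 1)])"

definition hL :: "nat \<Rightarrow> lpol list \<Rightarrow> lpol list" where
  "hL i xs = hgen i [] (vvpol i) xs"

fun hword :: "nat list \<Rightarrow> lpol list \<Rightarrow> lpol list" where
  "hword [] xs = xs"
| "hword (i # ws) xs = hL i (hword ws xs)"

definition huop :: "nat \<Rightarrow> lpol list \<Rightarrow> lpol list" where
  "huop i xs = hadd (hscale [(0, 2 * (int i - 1), 1)] xs)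
     (hscale [(1, 2 * (int i - 1), 1)] (hword (tword i) xs))"

fun huops :: "nat list \<Rightarrow> lpol list \<Rightarrow> lpol list" where
  "huops [] xs = xs"
| "huops (i # is) xs = huop i (huops is xs)"

fun hlin :: "(lpol \<times> lpol list) list \<Rightarrow> lpol list" where
  "hlin [] = hzero"
| "hlin ((c, xs) # l) = hadd (hscale c xs) (hlin l)"

text \<open>List version of the row sum times T_b; the weight v^l(w) is read off the length of the
  word.\<close>

fun hrow :: "nat list list \<Rightarrow> nat \<Rightarrow> lpol list" where
  "hrow [] b = hzero"
| "hrow (w # ws) b = hadd (hscale [(0, int (length w), 1)] (hword w (hunit b))) (hrow ws b)"

definition hxst :: "nat \<Rightarrow> nat list list \<Rightarrow> nat list \<Rightarrow> nat \<Rightarrow> lpol list" where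
  "hxst l ws xs b = hword xs (huops [1..<Suc l] (hrow ws b))"

lemma length_hL: "i < 3 \<Longrightarrow> length (hL i xs) = 48"
  by (simp add: hL_def length_hgen)

lemma hval_hL: "i < 3 \<Longrightarrow> hval (hL i xs) = L i (hval xs)"
  unfolding hL_def
  by (subst hval_hgen)
    (simp_all add: vvpol_def vv_def v_gen_def v_gen_inv_def monom_def pval_Cons single_uminus)

lemma hword:
  "ws \<in> lists {..<3} \<Longrightarrow> length xs = 48 \<Longrightarrow> length (hword ws xs) = 48 \<and> hval (hword ws xs) = foldr L ws (hval xs)"
  by (induction ws rule: list.induct) (simp_all add: length_hL hval_hL)

lemma huop:
  assumes "i \<in> {1, 2, 3}" "length xs = 48"
  shows "length (huop i xs) = 48 \<and> hval (huop i xs) = uop i (hval xs)"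
  using hword [OF tword_reduced(1) [OF assms(1)] assms(2)] assms(2)
  by (simp add: huop_def hadd_nth hval_hadd hval_hscale hscale_def [THEN fun_cong, THEN arg_cong [where f = length]]
      uop_def pval_Cons monom_def)

lemma huops:
  "set is \<subseteq> {1, 2, 3} \<Longrightarrow> length xs = 48 \<Longrightarrow>
    length (huops is xs) = 48 \<and> hval (huops is xs) = foldr uop is (hval xs)"
  by (induction "is") (simp_all add: huop)

lemma hlin:
  assumes "\<forall>(c, xs)\<in>set l. length xs = 48"
  shows "length (hlin l) = 48 \<and> hval (hlin l) = (\<Sum>(c, xs)\<leftarrow>l. smul (pval c) (hval xs))"
  using assms
proof (induction l)
  case (Cons p l)
  then show ?case
    by (cases p) (simp add: hadd_nth hval_hadd hval_hscale hscale_def [THEN fun_cong, THEN arg_cong [where f = length]])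
next
  case Nil
  show ?case by (simp add: hval_hzero) (simp add: hzero_def)
qed

lemma length_hunit: "length (hunit b) = 48"
  by (simp add: hunit_def length_indices)

lemma hxst:
  assumes "l \<le> 3" "set ws \<subseteq> lists {..<3}" "xs \<in> lists {..<3}" "b < 48"
  shows "length (hxst l ws xs b) = 48 \<and> hval (hxst l ws xs b) = foldr L xs (foldr uop [1..<Suc l]
     (\<Sum>w\<leftarrow>ws. smul (monom 0 (int (length w))) (foldr L w (e b))))"
proof -
  have "length (hrow ws b) = 48 \<and> hval (hrow ws b) = (\<Sum>w\<leftarrow>ws. smul (monom 0 (int (length w))) (foldr L w (e b)))"
    using assms(2)
  proof (induction ws rule: list.induct)
    case (Cons w ws)
    then show ?case
      using hword [of w "hunit b"] assms(4)
      by (simp add: hval_hunit length_hunit hadd_nth hval_hadd hval_hscale pval_Cons monom_def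
          hscale_def [THEN fun_cong, THEN arg_cong [where f = length]])
  next
    case Nil
    show ?case by (simp add: hval_hzero) (simp add: hzero_def)
  qed
  moreover have "set [1..<Suc l] \<subseteq> {1, 2, 3}"
    using assms(1) by auto
  ultimately show ?thesis
    unfolding hxst_def using huops [of "[1..<Suc l]" "hrow ws b"] hword [OF assms(3)] by simp
qed

definition N :: "hecke set" where
  "N = N_hat 3 ([1], [2])"

lemma N_simps: "0 \<in> N" "g \<in> N \<Longrightarrow> h \<in> N \<Longrightarrow> g + h \<in> N" "h \<in> N \<Longrightarrow> smul c h \<in> N" "g \<in> N \<Longrightarrow> h \<in> N \<Longrightarrow> g - h \<in> N"
  unfolding N_def N_hat_def
  by (auto intro: hecke.span_zero hecke.span_add hecke.span_scale hecke.span_diff)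

lemma hlin_N:
  assumes "\<forall>(c, xs)\<in>set l. length xs = 48 \<and> hval xs \<in> N" "v = hlin l"
  shows "length v = 48 \<and> hval v \<in> N"
proof -
  have "(\<Sum>(c, xs)\<leftarrow>l. smul (pval c) (hval xs)) \<in> N"
    using assms(1) by (induction l) (auto simp: N_simps)
  then show ?thesis
    using hlin [of l] assms by fastforce
qed

definition row_ok :: "bipartition \<Rightarrow> nat \<Rightarrow> bool" where
  "row_ok mu k \<longleftrightarrow> (\<forall>r \<in> set (fst (t_super mu)) \<union> set (snd (t_super mu)). perm k ` set r = set r)"

lemma hxst_x:
  assumes "mu \<in> bipartitions 3" "xs \<in> lists {..<3}" "b < 48"
  shows "hval (hxst (sum_list (fst mu)) (map word (filter (row_ok mu) sym_indices)) xs b) =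
    foldr L xs (x_elt 3 mu \<star> e b)"
proof -
  let ?ks = "filter (row_ok mu) sym_indices"
  have ks: "k < 48" if "k \<in> set ?ks" for k
    using that sym_indices_less by auto
  have "row_stabilizer 3 mu = cls ` set ?ks"
    unfolding row_stabilizer_eq by (simp add: row_ok_def)
  then have "rowsum mu = (\<Sum>k\<leftarrow>?ks. smul (monom 0 (int (wlen k))) (e k))"
    using ks by (intro rowsum_eq) (auto simp: sym_indices_def)
  moreover have mult: "(\<Sum>k\<leftarrow>ks. smul (c k) (e k)) \<star> e b = (\<Sum>k\<leftarrow>ks. smul (c k) (foldr L (word k) (e b)))"
    if "\<And>k. k \<in> set ks \<Longrightarrow> k < 48" for ks c
    using that assms(3) by (induction ks) (simp_all add: hmult_simps hmult_e)
  ultimately have "rowsum mu \<star> e b =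
      (\<Sum>w\<leftarrow>map word ?ks. smul (monom 0 (int (length w))) (foldr L w (e b)))"
    using mult [of ?ks "\<lambda>k. monom 0 (int (wlen k))", OF ks] by (simp add: comp_def wlen_def)
  moreover have "set (map word ?ks) \<subseteq> lists {..<3}"
    using ks letters_word by auto
  ultimately show ?thesis
    using hxst [OF bipartition_le [OF assms(1)] _ assms(2,3)] x_elt(2) [OF bipartition_le [OF assms(1)]] assms(3)
    by simp
qed

lemma hxst_N:
  assumes mu: "mu \<in> bipartitions 3" "strictly_dominated ([1], [2]) mu"
    and a: "a \<in> set sym_indices" "act_bitableau (perm a) (t_super mu) \<in> std_bitableaux 3 mu"
    and b: "b \<in> set sym_indices" "act_bitableau (perm b) (t_super mu) \<in> std_bitableaux 3 mu"
  shows "hval (hxst (sum_list (fst mu)) (map word (filter (row_ok mu) sym_indices)) (word a)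
    (index (rev (word b)))) \<in> N"
proof -
  let ?s = "act_bitableau (perm a) (t_super mu)" and ?t = "act_bitableau (perm b) (t_super mu)"
  have ab: "a < 48" "b < 48" "d_elt 3 mu ?s = cls a" "d_elt 3 mu ?t = cls b"
    using a b sym_indices_less d_elt_perm [OF mu(1)] by auto
  note x = x_st_eq [OF mu(1) ab]
  have "x_elt 3 mu \<star> e (index (rev (word b))) \<in> H3"
    using x(3) by (intro hmult_H3 x_elt(1) bipartition_le mu(1) H3_simps(5))
  then have "x_st 3 mu ?s ?t = hval (hxst (sum_list (fst mu)) (map word (filter (row_ok mu) sym_indices))
      (word a) (index (rev (word b))))"
    unfolding x(2) hxst_x [OF mu(1) letters_word [OF ab(1)] x(3)] using ab(1) by (simp add: hmult_e)
  moreover have "x_st 3 mu ?s ?t \<in> N"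
    unfolding N_def N_hat_def using mu a b by (intro hecke.span_base) blast
  ultimately show ?thesis by simp
qed

lemma t_super_eval:
  "t_super ([1, 1], [1]) = ([[1], [2]], [[3]])"
  "t_super ([2], [1]) = ([[1, 2]], [[3]])"
  "t_super ([1, 1, 1], []) = ([[1], [2], [3]], [])"
  "t_super ([2, 1], []) = ([[1, 2], [3]], [])"
  "t_super ([3], []) = ([[1, 2, 3]], [])"
  "t_super ([1], [2]) = ([[1]], [[2, 3]])"
  by (simp_all add: t_super_def upt_rec)

lemma row_filters:
  "filter (row_ok ([1, 1], [1])) sym_indices = [0]"
  "filter (row_ok ([2], [1])) sym_indices = [0, 2]"
  "filter (row_ok ([1, 1, 1], [])) sym_indices = [0]"
  "filter (row_ok ([2, 1], [])) sym_indices = [0, 2]"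
  "filter (row_ok ([3], [])) sym_indices = [0, 2, 3, 7, 8, 14]"
  "filter (row_ok ([1], [2])) sym_indices = [0, 3]"
  unfolding row_ok_def [abs_def] t_super_eval sym_indices_def
  by (simp_all add: perm_eval doubleton_eq_iff insert_commute)

lemma bipartitions_3:
  "([1, 1], [1]) \<in> bipartitions 3" "([2], [1]) \<in> bipartitions 3" "([1, 1, 1], []) \<in> bipartitions 3"
  "([2, 1], []) \<in> bipartitions 3" "([3], []) \<in> bipartitions 3" "([1], [2]) \<in> bipartitions 3"
  by (simp_all add: bipartitions_def is_partition_def)

lemma dominating:
  "strictly_dominated ([1], [2]) ([1, 1], [1])" "strictly_dominated ([1], [2]) ([2], [1])"
  "strictly_dominated ([1], [2]) ([1, 1, 1], [])" "strictly_dominated ([1], [2]) ([2, 1], [])"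
  "strictly_dominated ([1], [2]) ([3], [])"
  by (auto simp: strictly_dominated_def dominated_def take_Cons split: nat.split)

lemma three_interval: "{1..3 :: nat} = {1, 2, 3}"
  by auto

lemma standard:
  "k \<in> {0, 3, 8} \<Longrightarrow> act_bitableau (perm k) (t_super ([1, 1], [1])) \<in> std_bitableaux 3 ([1, 1], [1])"
  "k \<in> {0, 3, 8} \<Longrightarrow> act_bitableau (perm k) (t_super ([2], [1])) \<in> std_bitableaux 3 ([2], [1])"
  "act_bitableau (perm 0) (t_super ([1, 1, 1], [])) \<in> std_bitableaux 3 ([1, 1, 1], [])"
  "k \<in> {0, 3} \<Longrightarrow> act_bitableau (perm k) (t_super ([2, 1], [])) \<in> std_bitableaux 3 ([2, 1], [])"
  "act_bitableau (perm 0) (t_super ([3], [])) \<in> std_bitableaux 3 ([3], [])"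
  unfolding t_super_eval std_bitableaux_def three_interval
  by (auto simp: act_bitableau_def perm_eval standard_rows_def less_Suc_eq)

text \<open>The spanning elements x_st of \<open>N\<close> that the reductions use. On the right
  only the indices 0 and 3 occur; they stand for involutions, so passing to the inverse leaves
  \<open>b\<close> unchanged.\<close>

lemma N_elements:
  "a \<in> {0, 3, 8} \<Longrightarrow> b \<in> {0, 3} \<Longrightarrow> hval (hxst 2 [[]] (word a) b) \<in> N"
  "a \<in> {0, 3, 8} \<Longrightarrow> b \<in> {0, 3} \<Longrightarrow> hval (hxst 2 [[], [1]] (word a) b) \<in> N"
  "hval (hxst 3 [[]] [] 0) \<in> N"
  "a \<in> {0, 3} \<Longrightarrow> b \<in> {0, 3} \<Longrightarrow> hval (hxst 3 [[], [1]] (word a) b) \<in> N"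
  "hval (hxst 3 [[], [1], [2], [2, 1], [1, 2], [1, 2, 1]] [] 0) \<in> N"
proof -
  have b: "index (rev (word b)) = b" if "b \<in> {0, 3}" for b
    using that by (auto simp: index_def word_simps lmul_eval)
  have sym: "a \<in> {0, 3, 8} \<Longrightarrow> a \<in> set sym_indices" "b \<in> {0, 3} \<Longrightarrow> b \<in> {0, 3, 8}"
    "b \<in> {0, 3} \<Longrightarrow> b \<in> set sym_indices" for a b
    by (auto simp: sym_indices_def)
  have sums: "sum_list (fst ([1, 1], [1 :: nat])) = (2 :: nat)" "sum_list (fst ([2], [1 :: nat])) = (2 :: nat)"
    "sum_list (fst ([1, 1, 1], [] :: nat list)) = (3 :: nat)" "sum_list (fst ([2, 1], [] :: nat list)) = (3 :: nat)"
    "sum_list (fst ([3], [] :: nat list)) = (3 :: nat)"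
    by simp_all
  note eval = row_filters sums list.map word_simps(1,3)
  show "hval (hxst 2 [[]] (word a) b) \<in> N" if "a \<in> {0, 3, 8}" "b \<in> {0, 3}"
    using hxst_N [OF bipartitions_3(1) dominating(1) sym(1) standard(1) sym(3) standard(1), of a b] that sym(2)
    by (simp only: eval b)
  show "hval (hxst 2 [[], [1]] (word a) b) \<in> N" if "a \<in> {0, 3, 8}" "b \<in> {0, 3}"
    using hxst_N [OF bipartitions_3(2) dominating(2) sym(1) standard(2) sym(3) standard(2), of a b] that sym(2)
    by (simp only: eval b)
  have 0: "(0 :: nat) \<in> {0, 3}" by simp
  show "hval (hxst 3 [[]] [] 0) \<in> N"
    using hxst_N [OF bipartitions_3(3) dominating(3) sym(3) standard(3) sym(3) standard(3), OF 0 0] b [OF 0]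
    by (simp only: eval)
  show "hval (hxst 3 [[], [1]] (word a) b) \<in> N" if "a \<in> {0, 3}" "b \<in> {0, 3}"
    using hxst_N [OF bipartitions_3(4) dominating(4) sym(3) standard(4) sym(3) standard(4), of a b] that
    by (simp only: eval b)
  show "hval (hxst 3 [[], [1], [2], [2, 1], [1, 2], [1, 2, 1]] [] 0) \<in> N"
    using hxst_N [OF bipartitions_3(5) dominating(5) sym(3) standard(5) sym(3) standard(5), OF 0 0] b [OF 0]
    by (simp only: eval word_simps list.map)
qed

section \<open>A left ideal inside \<open>N\<close> generated by two explicit elements\<close>

definition x_list :: "lpol list" where
  "x_list = [
   [(0, 0, 1)], [(1, 0, 1)], [], [(0, 1, 1)], [], [(1, 1, 1)], [], [], [], [], [], [], [], [],
   [], [], [], [], [], [], [], [], [], [], [], [], [], [], [], [], [], [], [], [], [], [], [], [],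
   [], [], [], [], [], [], [], [], [], []]"

text \<open>The element u_2^+ (1 + v T_2), which adjoins the second factor of u_2^+ to X = (1 + V
  T_t)(1 + v T_2). It carries the relation that X satisfies modulo \<open>N\<close>.\<close>

definition g_list :: "lpol list" where
  "g_list = [
   [(0, 2, 1)], [(1, 2, 1)], [], [(0, 3, 1)], [], [(1, 3, 1)], [], [], [], [], [], [],
   [(1, 2, 1)], [], [], [], [(2, 2, 1)], [], [], [], [], [], [], [(1, 3, 1)], [], [], [],
   [(2, 3, 1)], [], [], [], [], [], [], [], [], [], [], [], [], [], [], [], [], [], [], [], []]"

text \<open>The element u_3^+. It is adjoined because T_t applied to T_1 T_2 g leaves the span of
  the elements T_w g with w in the symmetric group.\<close>

definition u_list :: "lpol list" where
  "u_list = [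
   [(0, 6, 1)], [(1, 6, 1)], [], [], [], [], [], [], [], [], [], [], [(1, 6, 1)], [], [], [],
   [(2, 6, 1)], [], [], [], [], [], [], [], [], [], [], [], [], [], [], [(1, 6, 1)], [], [], [],
   [(2, 6, 1)], [], [], [], [], [], [], [], [], [], [], [(2, 6, 1)], [(3, 6, 1)]]"

abbreviation one_pol :: lpol where "one_pol \<equiv> [(0, 0, 1)]"
abbreviation v_pol :: lpol where "v_pol \<equiv> [(0, 1, 1)]"
abbreviation vi_pol :: lpol where "vi_pol \<equiv> [(0, - 1, 1)]"
abbreviation nvi_pol :: lpol where "nvi_pol \<equiv> [(0, - 1, - 1)]"

lemma list_checks:
  "hxst 1 [[], [2]] [] 0 = x_list" "hxst 2 [[], [2]] [] 0 = g_list" "hxst 3 [[]] [] 0 = u_list"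
  "length x_list = 48" "length g_list = 48" "length u_list = 48"
  by code_simp+

text \<open>Membership of g in \<open>N\<close>: u_2^+ is x for the bipartition ((1,1)|(1)), which
  gives T_a g directly. The words ending in 1 use that u_2^+ commutes with T_1, so that u_2^+ T_1 =
  v^-1 (x - u_2^+) with x = u_2^+ (1 + v T_1) belonging to ((2)|(1)).\<close>

lemma g_checks:
  "g_list = hlin [(one_pol, hxst 2 [[]] [] 0), (v_pol, hxst 2 [[]] [] 3)]"
  "hword [2] g_list = hlin [(one_pol, hxst 2 [[]] [2] 0), (v_pol, hxst 2 [[]] [2] 3)]"
  "hword [1, 2] g_list = hlin [(one_pol, hxst 2 [[]] [1, 2] 0), (v_pol, hxst 2 [[]] [1, 2] 3)]"
  "hword [1] g_list = hlin [(vi_pol, hxst 2 [[], [1]] [] 0), (one_pol, hxst 2 [[], [1]] [] 3),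
     (nvi_pol, g_list)]"
  "hword [2, 1] g_list = hlin [(vi_pol, hxst 2 [[], [1]] [2] 0), (one_pol, hxst 2 [[], [1]] [2] 3),
     (nvi_pol, hword [2] g_list)]"
  "hword [1, 2, 1] g_list = hlin [(vi_pol, hxst 2 [[], [1]] [1, 2] 0),
     (one_pol, hxst 2 [[], [1]] [1, 2] 3), (nvi_pol, hword [1, 2] g_list)]"
  by code_simp+

text \<open>The same reduction for u_3^+, which belongs to ((1,1,1)|-). T_1 is resolved by x for
  ((2,1)|-), and T_2 by combining it with the full sum over the symmetric group, which belongs to
  ((3)|-).\<close>

lemma u_checks:
  "hword [1] u_list = hlin [(vi_pol, hxst 3 [[], [1]] [] 0), (nvi_pol, u_list)]"
  "hword [2] u_list = hlin [([(0, - 3, - 1)], hxst 3 [[], [1], [2], [2, 1], [1, 2], [1, 2, 1]] [] 0),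
     ([(0, - 3, 1)], hxst 3 [[], [1]] [] 0), ([(0, - 2, 1)], hxst 3 [[], [1]] [2] 0),
     ([(0, - 2, 1)], hxst 3 [[], [1]] [] 3), (vi_pol, hxst 3 [[], [1]] [2] 3), (nvi_pol, u_list)]"
  "hword [2, 1] u_list = hlin [(vi_pol, hxst 3 [[], [1]] [2] 0), (nvi_pol, hword [2] u_list)]"
  "hword [1, 2] u_list = hlin [(vi_pol, hxst 3 [[], [1]] [] 3), (nvi_pol, hword [2] u_list)]"
  "hword [1, 2, 1] u_list = hlin [(vi_pol, hxst 3 [[], [1]] [2] 3), (nvi_pol, u_list),
     ([(0, - 2, 1), (0, 0, - 1)], hword [2] u_list)]"
  by code_simp+

text \<open>u_3^+ commutes with the T_w for w in the symmetric group and absorbs T_t on the left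
  with eigenvalue V.\<close>

lemma t_checks_u:
  "hL 0 (hword [] u_list) = hscale [(1, 0, 1)] (hword [] u_list)"
  "hL 0 (hword [1] u_list) = hscale [(1, 0, 1)] (hword [1] u_list)"
  "hL 0 (hword [2] u_list) = hscale [(1, 0, 1)] (hword [2] u_list)"
  "hL 0 (hword [2, 1] u_list) = hscale [(1, 0, 1)] (hword [2, 1] u_list)"
  "hL 0 (hword [1, 2] u_list) = hscale [(1, 0, 1)] (hword [1, 2] u_list)"
  "hL 0 (hword [1, 2, 1] u_list) = hscale [(1, 0, 1)] (hword [1, 2, 1] u_list)"
  by code_simp+

text \<open>In the first four cases T_w can be moved past T_t or u_2^+, so T_t acts by V. The last
  two express that the span of the T_w g and T_w u is stable under T_t; the relation comes from the
  third factor of u_3^+.\<close>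

lemma t_checks_g:
  "hL 0 (hword [] g_list) = hscale [(1, 0, 1)] (hword [] g_list)"
  "hL 0 (hword [1] g_list) = hscale [(1, 0, 1)] (hword [1] g_list)"
  "hL 0 (hword [2] g_list) = hscale [(1, 0, 1)] (hword [2] g_list)"
  "hL 0 (hword [2, 1] g_list) = hscale [(1, 0, 1)] (hword [2, 1] g_list)"
  "hL 0 (hword [1, 2] g_list) = hlin
     [([(- 1, - 6, 1), (- 1, - 4, - 1)], u_list), ([(- 1, - 5, 1)], hword [1] u_list),
      ([(- 1, - 5, 1), (- 1, - 3, - 1)], hword [2] u_list), ([(- 1, - 4, 1)], hword [1, 2] u_list),
      ([(- 1, - 2, - 1), (- 1, 0, 2), (- 1, 2, - 1)], g_list),
      ([(- 1, - 1, - 1), (- 1, 1, 1)], hword [1] g_list),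
      ([(- 1, - 1, - 1), (- 1, 1, 1)], hword [2] g_list), ([(- 1, 0, - 1)], hword [1, 2] g_list)]"
  "hL 0 (hword [1, 2, 1] g_list) = hlin
     [([(- 1, - 5, 1), (- 1, - 3, - 1)], u_list), ([(- 1, - 4, 1), (- 1, - 2, - 1)], hword [2] u_list),
      ([(- 1, - 5, 1)], hword [2, 1] u_list), ([(- 1, - 4, 1)], hword [1, 2, 1] u_list),
      ([(- 1, - 1, - 1), (- 1, 1, 1)], g_list),
      ([(- 1, - 1, - 1), (- 1, 1, 1)], hword [2, 1] g_list), ([(- 1, 0, - 1)], hword [1, 2, 1] g_list)]"
  by code_simp+

lemma x_checks:
  "hL 0 x_list = hscale [(1, 0, 1)] x_list" "hL 2 x_list = hscale v_pol x_list"
  "hL 0 (hL 1 x_list) = hlin [([(- 1, 0, - 1)], hL 1 x_list), ([(- 1, - 1, - 1), (- 1, 1, 1)], x_list),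
     ([(- 1, - 2, 1)], hword [1] g_list), ([(- 1, - 3, 1), (- 1, - 1, - 1)], g_list)]"
  by code_simp+

definition X :: hecke where "X = x_elt 3 ([1], [2])"
abbreviation gel :: hecke where "gel \<equiv> hval g_list"
abbreviation uel :: hecke where "uel \<equiv> hval u_list"

lemma X_eq: "X = hval x_list" and X_H3 [simp]: "X \<in> H3"
proof -
  show "X \<in> H3"
    unfolding X_def by (rule x_elt(1) [OF bipartition_le [OF bipartitions_3(6)]])
  then have "X = foldr L [] (x_elt 3 ([1], [2]) \<star> e 0)"
    unfolding X_def by simp
  also have "\<dots> = hval (hxst (sum_list (fst ([1], [2 :: nat]))) (map word (filter (row_ok ([1], [2])) sym_indices)) [] 0)"
    by (rule hxst_x [OF bipartitions_3(6), symmetric]) simp_all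
  also have "\<dots> = hval (hxst 1 [[], [2]] [] 0)"
    by (simp only: row_filters list.map word_simps) simp
  finally show "X = hval x_list"
    by (simp only: list_checks)
qed

lemma hL_word:
  "ws \<in> lists {..<3} \<Longrightarrow> length (hword ws g_list) = 48 \<and> hval (hword ws g_list) = foldr L ws gel"
  "ws \<in> lists {..<3} \<Longrightarrow> length (hword ws u_list) = 48 \<and> hval (hword ws u_list) = foldr L ws uel"
  using hword list_checks by blast+

lemma length_hxst: "l \<le> 3 \<Longrightarrow> set ws \<subseteq> lists {..<3} \<Longrightarrow> xs \<in> lists {..<3} \<Longrightarrow> b < 48 \<Longrightarrow> length (hxst l ws xs b) = 48"
  using hxst by blast

lemma gel_N:
  assumes "ws \<in> {[], [1], [2], [2, 1], [1, 2], [1, 2, 1]}"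
  shows "length (hword ws g_list) = 48 \<and> hval (hword ws g_list) \<in> N"
proof -
  have N: "hval (hxst 2 [[]] ws b) \<in> N" "hval (hxst 2 [[], [1]] ws b) \<in> N"
    if "ws \<in> {[], [2], [1, 2]}" "b \<in> {0, 3}" for ws b
  proof -
    have "\<exists>a\<in>{0, 3, 8}. ws = word a"
      using that(1) by (auto simp: word_simps)
    then show "hval (hxst 2 [[]] ws b) \<in> N" "hval (hxst 2 [[], [1]] ws b) \<in> N"
      using N_elements(1,2) that(2) by metis+
  qed
  have len: "length (hxst 2 [[]] ws b) = 48" "length (hxst 2 [[], [1]] ws b) = 48"
    if "ws \<in> {[], [2], [1, 2]}" "b \<in> {0, 3}" for ws b
    using that by (auto intro!: length_hxst)
  have 1: "length (hword ws g_list) = 48 \<and> hval (hword ws g_list) \<in> N" if "ws \<in> {[], [2], [1, 2]}" for ws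
  proof (rule hlin_N)
    show "hword ws g_list = hlin [(one_pol, hxst 2 [[]] ws 0), (v_pol, hxst 2 [[]] ws 3)]"
      using that g_checks(1-3) by auto
  qed (use that N len in simp)
  have "length (hword (ws @ [1]) g_list) = 48 \<and> hval (hword (ws @ [1]) g_list) \<in> N"
    if "ws \<in> {[], [2], [1, 2]}" for ws
  proof (rule hlin_N)
    show "hword (ws @ [1]) g_list = hlin [(vi_pol, hxst 2 [[], [1]] ws 0), (one_pol, hxst 2 [[], [1]] ws 3),
        (nvi_pol, hword ws g_list)]"
      using that g_checks(4-6) by auto
  qed (use that N len 1 in simp)
  note 2 = this
  consider "ws \<in> {[], [2], [1, 2]}" | "ws = [] @ [1]" | "ws = [2] @ [1]" | "ws = [1, 2] @ [1]"
    using assms by auto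
  then show ?thesis
    by cases (use 1 2 in \<open>simp_all only: insertI1 insertI2\<close>)
qed

lemma uel_N:
  assumes "ws \<in> {[], [1], [2], [2, 1], [1, 2], [1, 2, 1]}"
  shows "hval (hword ws u_list) \<in> N"
proof -
  have N: "hval (hxst 3 [[], [1]] ws b) \<in> N" if "ws \<in> {[], [2]}" "b \<in> {0, 3}" for ws b
  proof -
    have "\<exists>a\<in>{0, 3}. ws = word a"
      using that(1) by (auto simp: word_simps)
    then show ?thesis
      using N_elements(4) that(2) by metis
  qed
  have len: "length (hxst 3 [[], [1]] ws b) = 48" if "ws \<in> {[], [2]}" "b \<in> {0, 3}" for ws b
    using that by (auto intro!: length_hxst)
  have len': "length (hxst 3 [[], [1], [2], [2, 1], [1, 2], [1, 2, 1]] [] 0) = 48"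
    by (auto intro!: length_hxst)
  have u: "length u_list = 48 \<and> hval u_list \<in> N"
    using N_elements(3) list_checks by simp
  have 1: "length (hword [1] u_list) = 48 \<and> hval (hword [1] u_list) \<in> N"
    by (rule hlin_N [OF _ u_checks(1)]) (use N len u in simp)
  have 2: "length (hword [2] u_list) = 48 \<and> hval (hword [2] u_list) \<in> N"
    by (rule hlin_N [OF _ u_checks(2)]) (use N len len' N_elements(5) u in simp)
  have 21: "length (hword [2, 1] u_list) = 48 \<and> hval (hword [2, 1] u_list) \<in> N"
    by (rule hlin_N [OF _ u_checks(3)]) (use N len 2 in simp)
  have 12: "length (hword [1, 2] u_list) = 48 \<and> hval (hword [1, 2] u_list) \<in> N"
    by (rule hlin_N [OF _ u_checks(4)]) (use N len 2 in simp)
  have 121: "length (hword [1, 2, 1] u_list) = 48 \<and> hval (hword [1, 2, 1] u_list) \<in> N"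
    by (rule hlin_N [OF _ u_checks(5)]) (use N len 2 u in simp)
  show ?thesis
    using assms u 1 2 21 12 121 by auto
qed

text \<open>A substitute for the ideal property of \<open>N\<close>: \<open>Q\<close> is directly
  checked to be stable under left multiplication, lies in \<open>N\<close>, and contains every
  relation needed to compute with X.\<close>

definition Q :: "hecke set" where
  "Q = A_span ((\<lambda>k. e k \<star> gel) ` set sym_indices \<union> (\<lambda>k. e k \<star> uel) ` set sym_indices)"

lemma e_gel:
  assumes "k \<in> set sym_indices"
  shows "e k \<star> gel = hval (hword (word k) g_list)" "e k \<star> uel = hval (hword (word k) u_list)"
  using sym_indices_less [OF assms] hL_word letters_word by (simp_all add: hmult_e)

lemma word_sym: "k \<in> set sym_indices \<Longrightarrow> word k \<in> {[], [1], [2], [2, 1], [1, 2], [1, 2, 1]}"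
  by (auto simp: sym_indices_def word_simps)

lemma Q_subset: "Q \<subseteq> N"
  unfolding Q_def
proof (rule hecke.span_minimal)
  show "hecke.subspace N"
    by (auto simp: hecke.subspace_def N_simps)
  have "e k \<star> gel \<in> N" "e k \<star> uel \<in> N" if "k \<in> set sym_indices" for k
    unfolding e_gel [OF that] using gel_N [OF word_sym [OF that]] uel_N [OF word_sym [OF that]] by simp_all
  then show "(\<lambda>k. e k \<star> gel) ` set sym_indices \<union> (\<lambda>k. e k \<star> uel) ` set sym_indices \<subseteq> N"
    by blast
qed

lemma Q_simps: "0 \<in> Q" "g \<in> Q \<Longrightarrow> h \<in> Q \<Longrightarrow> g + h \<in> Q" "h \<in> Q \<Longrightarrow> smul c h \<in> Q" "g \<in> Q \<Longrightarrow> h \<in> Q \<Longrightarrow> g - h \<in> Q"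
  unfolding Q_def by (auto intro: hecke.span_zero hecke.span_add hecke.span_scale hecke.span_diff)

lemma Q_base: "k \<in> set sym_indices \<Longrightarrow> e k \<star> gel \<in> Q" "k \<in> set sym_indices \<Longrightarrow> e k \<star> uel \<in> Q"
  unfolding Q_def by (auto intro: hecke.span_base)

lemma Q_words:
  assumes "ws \<in> {[], [1], [2], [2, 1], [1, 2], [1, 2, 1]}"
  shows "length (hword ws g_list) = 48 \<and> hval (hword ws g_list) \<in> Q"
    "length (hword ws u_list) = 48 \<and> hval (hword ws u_list) \<in> Q"
proof -
  have "ws \<in> word ` set sym_indices"
    using assms by (simp add: sym_indices_def word_simps)
  then obtain k where k: "k \<in> set sym_indices" and ws: "ws = word k"
    by (rule imageE)
  note l = letters_word [OF sym_indices_less [OF k]]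
  show "length (hword ws g_list) = 48 \<and> hval (hword ws g_list) \<in> Q"
    unfolding ws using Q_base(1) [OF k] hL_word(1) [OF l] by (simp only: e_gel(1) [OF k] simp_thms)
  show "length (hword ws u_list) = 48 \<and> hval (hword ws u_list) \<in> Q"
    unfolding ws using Q_base(2) [OF k] hL_word(2) [OF l] by (simp only: e_gel(2) [OF k] simp_thms)
qed

lemma hlin_Q:
  assumes "\<forall>(c, xs)\<in>set l. length xs = 48 \<and> hval xs \<in> Q"
  shows "hval (hlin l) \<in> Q"
proof -
  have "(\<Sum>(c, xs)\<leftarrow>l. smul (pval c) (hval xs)) \<in> Q"
    using assms by (induction l) (auto simp: Q_simps)
  then show ?thesis
    using hlin [of l] assms by fastforce
qed

text \<open>For s_1 and s_2 stability is formal, as T_i T_w expands within the symmetric group. Only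
  T_t needs the computed identities.\<close>

lemma L_Q:
  assumes "i < 3" "q \<in> Q"
  shows "L i q \<in> Q"
proof -
  have sym: "L i (e k \<star> h) \<in> Q" if "h = gel \<or> h = uel" "k \<in> set sym_indices" "i \<noteq> 0" for h k
  proof -
    have "i \<in> {1, 2}" using assms(1) that(3) by auto
    then have k: "k < 48" "lmul i k \<in> set sym_indices" and h: "h \<in> H3"
      using that(1,2) perm_step [of i k] sym_indices_less by auto
    have "L i (e k \<star> h) = L i (e k) \<star> h"
      using k h assms(1) by (simp add: L_hmult)
    also have "\<dots> = e (lmul i k) \<star> h + (if ascent i k then 0 else smul (vv i) (e k \<star> h))"
      using k assms(1) by (simp add: L_e hmult_simps)
    also have "\<dots> \<in> Q"
      using that k(2) Q_base by (auto intro!: Q_simps)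
    finally show ?thesis .
  qed
  have t: "L 0 (hval (hword ws g_list)) \<in> Q" "L 0 (hval (hword ws u_list)) \<in> Q"
    if ws: "ws \<in> {[], [1], [2], [2, 1], [1, 2], [1, 2, 1]}" for ws
  proof -
    note * = Q_words [OF ws]
    have "hL 0 (hword ws u_list) = hscale [(1, 0, 1)] (hword ws u_list)"
      using t_checks_u ws by auto
    then have "hval (hL 0 (hword ws u_list)) \<in> Q"
      using * by (simp add: hval_hscale Q_simps)
    then show "L 0 (hval (hword ws u_list)) \<in> Q"
      by (simp add: hval_hL)
    consider "ws \<in> {[], [1], [2], [2, 1]}" | "ws = [1, 2]" | "ws = [1, 2, 1]"
      using ws by auto
    then have "hval (hL 0 (hword ws g_list)) \<in> Q"
    proof cases
      case 1
      then have "hL 0 (hword ws g_list) = hscale [(1, 0, 1)] (hword ws g_list)"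
        using t_checks_g(1-4) by auto
      then show ?thesis
        using * by (simp add: hval_hscale Q_simps)
    next
      case 2
      show ?thesis
        unfolding 2 t_checks_g(5)
        by (rule hlin_Q) (use Q_words [of "[]"] Q_words [of "[1]"] Q_words [of "[2]"] Q_words [of "[2, 1]"]
            Q_words [of "[1, 2]"] Q_words [of "[1, 2, 1]"] in simp)
    next
      case 3
      show ?thesis
        unfolding 3 t_checks_g(6)
        by (rule hlin_Q) (use Q_words [of "[]"] Q_words [of "[1]"] Q_words [of "[2]"] Q_words [of "[2, 1]"]
            Q_words [of "[1, 2]"] Q_words [of "[1, 2, 1]"] in simp)
    qed
    then show "L 0 (hval (hword ws g_list)) \<in> Q"
      by (simp add: hval_hL)
  qed
  have gens: "L i (e k \<star> h) \<in> Q" if "h = gel \<or> h = uel" "k \<in> set sym_indices" for h k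
    using sym [OF that] t [OF word_sym [OF that(2)]] e_gel [OF that(2)] that(1) by (cases "i = 0") auto
  show ?thesis
    using assms(2) unfolding Q_def [of]
  proof (induction rule: hecke.span_induct_alt)
    case (step c x y)
    then have "L i x \<in> Q" using gens by auto
    then show ?case
      using step Q_simps unfolding Q_def by (simp add: L_simps)
  qed (simp add: L_simps hecke.span_zero)
qed

section \<open>The left ideal generated by X, modulo \<open>Q\<close> and modulo
  \<open>N\<close>\<close>

definition lift :: "triple \<Rightarrow> hecke" where
  "lift = (\<lambda>(x, y, z). smul x X + smul y (L 1 X) + smul z (L 2 (L 1 X)))"

lemma lift_H3 [simp]: "lift t \<in> H3"
  by (cases t) (simp add: lift_def)

lemma lift_linear: "lift (s + t) = lift s + lift t" "lift (tscale c t) = smul c (lift t)"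
  by (cases s; cases t; simp add: lift_def hecke.scale_left_distrib hecke.scale_right_distrib)+

lemma L0_X: "L 0 X = smul VV X" and L2_X: "L 2 X = smul pp X"
  using hval_hL [of 0 x_list] hval_hL [of 2 x_list] list_checks x_checks(1,2)
  by (simp_all add: X_eq hval_hscale pval_Cons VV_def pp_def monom_def)

text \<open>The origin of the formula for \<open>rho 0\<close>. Since g = v^2 (1 + V T_1 T_t T_1) X,
  one has T_1 T_t T_1 X = -V^-1 X modulo g, and applying T_1^-1 = T_1 - (v - v^-1) gives T_t T_1
  X.\<close>

lemma L0_L1_X:
  "L 0 (L 1 X) - (smul (- Vi) (L 1 X) + smul (Vi * (pp - pm)) X) \<in> Q" (is "?d \<in> Q")
proof -
  have 1: "L 1 X = hval (hL 1 x_list)"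
    by (simp add: X_eq hval_hL)
  have p: "pval [(- 1, 0, - 1)] = - Vi" "pval [(- 1, - 1, - 1), (- 1, 1, 1)] = Vi * (pp - pm)"
    by (simp_all add: pval_Cons Vi_def pp_def pm_def monom_def mult_single single_uminus algebra_simps)
  have "L 0 (L 1 X) = hval (hL 0 (hL 1 x_list))"
    unfolding 1 by (simp add: hval_hL)
  also have "\<dots> = smul (- Vi) (L 1 X) + smul (Vi * (pp - pm)) X +
      hval (hlin [([(- 1, - 2, 1)], hword [1] g_list), ([(- 1, - 3, 1), (- 1, - 1, - 1)], g_list)])"
    unfolding x_checks(3) p [symmetric] 1 X_eq
    using hL_word(1) [of "[1]"] list_checks
    by (simp add: hlin length_hL hval_hL add.assoc del: hlin.simps)
  finally have "?d = hval (hlin [([(- 1, - 2, 1)], hword [1] g_list), ([(- 1, - 3, 1), (- 1, - 1, - 1)], g_list)])"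
    by simp
  then show ?thesis
    using hlin_Q [of "[([(- 1, - 2, 1)], hword [1] g_list), ([(- 1, - 3, 1), (- 1, - 1, - 1)], g_list)]"]
      Q_words(1) [of "[1]"] Q_words(1) [of "[]"] by simp
qed

lemma L_lift:
  assumes "i < 3"
  shows "L i (lift t) - lift (rho i t) \<in> Q"
proof -
  obtain x y z where t: "t = (x, y, z)" by (cases t) auto
  define Y where "Y = L 1 X"
  define Z where "Z = L 2 Y"
  have YZ: "Y \<in> H3" "Z \<in> H3" by (simp_all add: Y_def Z_def)
  have lift: "lift (x, y, z) = smul x X + smul y Y + smul z Z" for x y z
    by (simp add: lift_def Y_def Z_def)
  note distrib = hecke.scale_right_distrib hecke.scale_left_distrib hecke.scale_right_diff_distrib
    hecke.scale_left_diff_distrib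
  have "i = 0 \<or> i = 1 \<or> i = 2" using assms by auto
  then show ?thesis
  proof (elim disjE)
    assume i: "i = 0"
    have rho: "rho i t = (VV * x + Vi * (pp - pm) * (y + pp * z), - Vi * y, - Vi * z)"
      by (simp add: i t rho_def)
    have X: "L i X = smul VV X"
      by (simp add: i L0_X)
    obtain r where r: "r \<in> Q" "L i Y = r + (smul (- Vi) Y + smul (Vi * (pp - pm)) X)"
      using L0_L1_X unfolding i Y_def by (metis diff_add_cancel)
    \<comment> \<open>t and s_2 commute, so the third basis vector follows from the second, with T_2
      X = v X.\<close>
    have "L i Z = L 2 (L i Y)"
      using L_braid [of 0 2 Y] YZ by (simp add: braid_def i Z_def)
    also have "\<dots> = L 2 r + (smul (- Vi) Z + smul (Vi * (pp - pm) * pp) X)"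
      unfolding r(2) by (simp add: L_simps L2_X Z_def)
    finally have Z: "L i Z = L 2 r + (smul (- Vi) Z + smul (Vi * (pp - pm) * pp) X)" .
    have "L i (lift t) - lift (rho i t) = smul y r + smul z (L 2 r)"
      unfolding rho unfolding t lift
      by (simp add: L_simps X r(2) Z distrib algebra_simps)
    also have "\<dots> \<in> Q"
      using r(1) L_Q [of 2 r] by (simp add: Q_simps)
    finally show ?thesis .
  next
    assume i: "i = 1"
    have rho: "rho i t = (y, x + (pp - pm) * y, pp * z)"
      by (simp add: i t rho_def)
    have X: "L i X = Y" and Y: "L i Y = X + smul (pp - pm) Y"
      unfolding i Y_def using L_quadratic [of 1 X] by (simp_all add: vv_simps)
    have Z: "L i Z = smul pp Z"
      unfolding i Z_def Y_def using L_braid [of 1 2 X] by (simp add: braid_def L2_X L_simps)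
    have "L i (lift t) = lift (rho i t)"
      unfolding rho unfolding t lift by (simp add: L_simps X Y Z distrib algebra_simps)
    then show ?thesis by (simp add: Q_simps)
  next
    assume i: "i = 2"
    have rho: "rho i t = (pp * x, z, y + (pp - pm) * z)"
      by (simp add: i t rho_def)
    have X: "L i X = smul pp X" and Y: "L i Y = Z" and Z: "L i Z = Y + smul (pp - pm) Z"
      unfolding i Z_def using L_quadratic [of 2 Y] YZ by (simp_all add: vv_simps L2_X)
    have "L i (lift t) = lift (rho i t)"
      unfolding rho unfolding t lift by (simp add: L_simps X Y Z distrib algebra_simps)
    then show ?thesis by (simp add: Q_simps)
  qed
qed

text \<open>Follow a word letter by letter: each letter acts as \<open>rho\<close> up to an element
  of \<open>Q\<close>, and \<open>Q\<close> absorbs the errors made earlier.\<close>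

lemma hmult_X_lift:
  assumes "h \<in> H3"
  shows "h \<star> X - lift (act h (1, 0, 0)) \<in> Q"
proof -
  have words: "foldr L ws X - lift (foldr rho ws (1, 0, 0)) \<in> Q" if "ws \<in> lists {..<3}" for ws
    using that
  proof (induction ws rule: list.induct)
    case Nil
    then show ?case by (simp add: lift_def Q_simps)
  next
    case (Cons i ws)
    let ?t = "foldr rho ws (1, 0, 0)"
    have "L i (foldr L ws X) - lift (rho i ?t) =
        L i (foldr L ws X - lift ?t) + (L i (lift ?t) - lift (rho i ?t))"
      by (simp add: L_simps)
    also have "\<dots> \<in> Q"
      using Cons L_Q L_lift by (simp add: Q_simps)
    finally show ?case by simp
  qed
  have "e k \<star> X - lift (act (e k) (1, 0, 0)) \<in> Q" if "k < 48" for k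
    using words [OF letters_word [OF that]] that by (simp add: hmult_e act_e)
  then have "(\<Sum>k<48. smul (lookup h (cls k)) (e k \<star> X - lift (act (e k) (1, 0, 0)))) \<in> Q"
    unfolding Q_def by (intro hecke.span_sum hecke.span_scale) simp
  moreover have "lift (sum f A) = (\<Sum>a\<in>A. lift (f a))" for f :: "nat \<Rightarrow> triple" and A
  proof (induction A rule: infinite_finite_induct)
    case (insert a A)
    then show ?case by (simp add: lift_linear)
  qed (simp_all add: lift_def zero_prod_def)
  then have "(\<Sum>k<48. smul (lookup h (cls k)) (e k \<star> X - lift (act (e k) (1, 0, 0)))) =
      (\<Sum>k<48. smul (lookup h (cls k)) (e k)) \<star> X - lift (act (\<Sum>k<48. smul (lookup h (cls k)) (e k)) (1, 0, 0))"
    by (simp add: hmult_simps act_linear lift_linear hecke.scale_right_diff_distrib sum_subtractf)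
  ultimately show ?thesis
    using hecke_sum_e [OF assms] by simp
qed

text \<open>X multiplies the vector (1, 0, 0) by a cancellable scalar: its two factors contribute 1
  + V^2 and 1 + v^2. This lets information about h X descend to h.\<close>

lemma act_X: "act X (1, 0, 0) = tscale ((1 + VV * VV) * (1 + pp * pp)) (1, 0, 0)"
proof -
  have "X = uop 1 (rowsum ([1], [2]) \<star> e 0)"
    using x_elt(2) [OF bipartition_le [OF bipartitions_3(6)], of "e 0"] X_H3 by (simp add: X_def)
  moreover have "row_stabilizer 3 ([1], [2]) = cls ` set [0, 3]"
    using row_filters(6) unfolding row_stabilizer_eq row_ok_def [abs_def] by (metis set_filter)
  then have "rowsum ([1], [2]) = (\<Sum>k\<leftarrow>[0, 3]. smul (monom 0 (int (wlen k))) (e k))"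
    by (rule rowsum_eq) auto
  then have "rowsum ([1], [2]) = e 0 + smul pp (e 3)"
    by (simp add: wlen_def word_simps monom_def pp_def single_00)
  ultimately have X: "X = uop 1 (e 0 + smul pp (e 3))"
    by simp
  show ?thesis
    unfolding X by (simp add: act_uop act_linear act_e word_simps tword_simps rho_def monom_simps algebra_simps)
qed

lemma mult_eq_0: "c * ((1 + VV * VV) * (1 + pp * pp)) = 0 \<Longrightarrow> c = 0"
proof -
  have 1: "a = 0" if "a * (1 + VV * VV) = 0" for a
    by (rule shift_eq_0 [of _ "(2, 0)"])
      (use that in \<open>simp_all add: VV_def monom_def mult_single algebra_simps zero_prod_def\<close>)
  have 2: "a = 0" if "a * (1 + pp * pp) = 0" for a
    by (rule shift_eq_0 [of _ "(0, 2)"])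
      (use that in \<open>simp_all add: pp_def monom_def mult_single algebra_simps zero_prod_def\<close>)
  show "c * ((1 + VV * VV) * (1 + pp * pp)) = 0 \<Longrightarrow> c = 0"
    using 1 2 by (metis mult.assoc)
qed

text \<open>From left to right, elements of \<open>N\<close> act by zero, and h X acts on (1, 0, 0)
  as a cancellable multiple of h. From right to left, h X agrees modulo \<open>Q\<close> with the
  lift of the zero vector.\<close>

lemma hmult_X_N:
  assumes "h \<in> H3"
  shows "h \<star> X \<in> N \<longleftrightarrow> act h (1, 0, 0) = 0"
proof
  assume "h \<star> X \<in> N"
  then have "act (h \<star> X) (1, 0, 0) = 0"
    using N_hat_act by (simp add: N_def)
  then have "tscale ((1 + VV * VV) * (1 + pp * pp)) (act h (1, 0, 0)) = 0"
    using assms by (simp add: act_hmult act_X act_linear2(2) del: tscale.simps)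
  then show "act h (1, 0, 0) = 0"
    by (cases "act h (1, 0, 0)") (auto simp: zero_prod_def mult.commute dest: mult_eq_0)
next
  assume "act h (1, 0, 0) = 0"
  then have "h \<star> X \<in> Q"
    using hmult_X_lift [OF assms] by (simp add: lift_def zero_prod_def)
  then show "h \<star> X \<in> N" using Q_subset by auto
qed

section \<open>Comparison with left cell modules\<close>

text \<open>The specialization $V = 4i$, $v = 2$ kills $V + V^{-1} v^4$.\<close>

definition theta :: "laurent \<Rightarrow> complex" where
  "theta a = (\<Sum>k\<in>keys a. of_int (lookup a k) * ((4 * \<i>) powi fst k * 2 powi snd k))"

lemma theta_add: "theta (a + b) = theta a + theta b"
  unfolding theta_def by (rule setsum_keys_plus_distrib) (simp_all add: distrib_right)

lemma theta_single: "theta (Poly_Mapping.single k c) = of_int c * ((4 * \<i>) powi fst k * 2 powi snd k)"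
  by (simp add: theta_def)

lemma theta_0: "theta 0 = 0"
  by (simp add: theta_def)

lemma theta_mult: "theta (a * b) = theta a * theta b"
proof (induction a rule: laurent_induct)
  case (single k c)
  show ?case
  proof (induction b rule: laurent_induct)
    case (single l d)
    show ?case by (simp add: mult_single theta_single power_int_add)
  qed (simp_all add: theta_0 theta_add distrib_left)
qed (simp_all add: theta_0 theta_add distrib_right)

definition qq :: laurent where
  "qq = VV + Vi * (pp * pp * pp * pp)"

lemma theta_qq: "theta qq = 0"
  by (simp add: qq_def theta_add theta_mult VV_def Vi_def pp_def monom_def theta_single power_int_minus field_simps)

text \<open>Up to the unit V^-1 v^4, the element \<open>qq\<close> is 1 + V^2 v^-4, so
  \<open>shift_eq_0\<close> applies with shift (2, -4).\<close>

lemma qq_mult_eq_0: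
  assumes "a * qq = 0"
  shows "a = 0"
proof (rule shift_eq_0 [of _ "(2, - 4)"])
  have "Poly_Mapping.single (2, - 4) 1 = VV * VV * (pm * pm * pm * pm)"
    by (simp add: VV_def pm_def monom_def mult_single)
  then have "a + Poly_Mapping.single (2, - 4) 1 * a = VV * (pm * pm * pm * pm) * (a * qq)"
    by (simp add: qq_def algebra_simps unit_simps)
  then show "a + Poly_Mapping.single (2, - 4) 1 * a = 0"
    using assms by simp
qed (simp add: zero_prod_def)

lemma v_mult_eq_0:
  assumes "a * (pp + pm) = 0"
  shows "a = 0"
proof (rule shift_eq_0 [of _ "(0, 2)"])
  have "Poly_Mapping.single (0, 2) 1 = pp * pp"
    by (simp add: pp_def monom_def mult_single)
  then have "a + Poly_Mapping.single (0, 2) 1 * a = pp * (a * (pp + pm))"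
    by (simp add: algebra_simps unit_simps)
  then show "a + Poly_Mapping.single (0, 2) 1 * a = 0"
    using assms by simp
qed (simp add: zero_prod_def)

text \<open>Distinct first components ensure that each coordinate is a single listed coefficient and
  not a sum of several.\<close>

definition t_coeffs_ok :: "(nat \<times> lpol) list \<Rightarrow> bool" where
  "t_coeffs_ok ms \<longleftrightarrow> distinct (map fst ms) \<and>
     list_all (\<lambda>(z, m). m = [(0, 0, 1)] \<or> m = [(- 1, 1, 1), (1, - 1, 1)] \<or> m = [(- 1, 0, 1), (1, 0, 1)]) ms"

lemma t_coeffs_checks:
  "list_all (\<lambda>k. ascent 1 k \<or> ascent 2 k \<or> t_coeffs_ok (C_coeffs 0 k)) indices"
  unfolding C_coeffs_def KL_prod_def
  by (simp add: indices_def ascent_iff_less lmul_eval t_coeffs_ok_def mu_table_def vipol_def vpol_def)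

text \<open>The three values at V = 4i, v = 2 are 1, 3i/2 and 15i/4.\<close>

lemma theta_nonzero:
  "theta (pval [(0, 0, 1)]) \<noteq> 0" "theta (pval [(- 1, 1, 1), (1, - 1, 1)]) \<noteq> 0"
  "theta (pval [(- 1, 0, 1), (1, 0, 1)]) \<noteq> 0"
  by (simp_all add: pval_Cons theta_add theta_0 theta_single power_int_minus field_simps)

text \<open>When s_1 and s_2 are both descents of \<open>w\<close>, the coordinates of C_t C_w are
  zero or among three polynomials on which \<open>theta\<close> does not vanish. So vanishing can be
  tested after specialization.\<close>

lemma coord_t:
  assumes "w < 48" "\<not> ascent 1 w" "\<not> ascent 2 w" "z < 48" "theta (coord (C 0 (H w)) z) = 0"
  shows "coord (C 0 (H w)) z = 0"
proof -
  have ok: "t_coeffs_ok (C_coeffs 0 w)"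
    using all_indices [OF t_coeffs_checks assms(1)] assms by simp
  have sum: "(\<Sum>(z', m)\<leftarrow>ms. if z' = z then pval m else 0) = (case map_of ms z of None \<Rightarrow> 0 | Some m \<Rightarrow> pval m)"
    if "distinct (map fst ms)" for ms :: "(nat \<times> lpol) list"
    using that
  proof (induction ms)
    case (Cons p ms)
    obtain y m where p: "p = (y, m)" by (cases p)
    have "map_of ms y = None"
      using Cons.prems p by (simp add: map_of_eq_None_iff)
    then show ?case
      using Cons p by auto
  qed simp
  have "coord (C 0 (H w)) z = (case map_of (C_coeffs 0 w) z of None \<Rightarrow> 0 | Some m \<Rightarrow> pval m)"
    using C_H [of 0 w] coord_sum_list [OF assms(4), of "C_coeffs 0 w"] C_coeffs_entries(1) [of 0 w] assms(1)
      sum [of "C_coeffs 0 w"] ok by (simp add: t_coeffs_ok_def)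
  moreover have "theta (pval m) \<noteq> 0" if "map_of (C_coeffs 0 w) z = Some m" for m
    using map_of_SomeD [OF that] ok theta_nonzero by (auto simp: t_coeffs_ok_def list_all_iff)
  ultimately show ?thesis
    using assms(5) by (auto split: option.splits)
qed

text \<open>Every basis element occurring in a product C_i C_k has \<open>i\<close> as a left
  descent.\<close>

lemma coord_C_ascent:
  assumes "i < 3" "z < 48" "ascent i z" "h \<in> H3"
  shows "coord (C i h) z = 0"
proof -
  have "coord (C i (H k)) z = 0" if "k < 48" for k
  proof -
    have "(\<Sum>(z', m)\<leftarrow>ms. if z' = z then pval m else 0) = 0" if "\<forall>(z', m)\<in>set ms. z' \<noteq> z" for ms :: "(nat \<times> lpol) list"
      using that by (induction ms) auto
    moreover have "\<forall>(z', m)\<in>set (C_coeffs i k). z' \<noteq> z"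
      using C_coeffs_entries(2) [OF assms(1) that] assms(3) by auto
    ultimately show ?thesis
      using C_H [OF assms(1) that] coord_sum_list [OF assms(2), of "C_coeffs i k"] C_coeffs_entries(1) [OF assms(1) that]
      by simp
  qed
  moreover have "C i (comb (coord h)) = (\<Sum>k<48. smul (coord h k) (C i (H k)))"
    by (simp add: comb_def C_simps)
  then have "C i h = (\<Sum>k<48. smul (coord h k) (C i (H k)))"
    by (simp only: comb_coord [OF assms(4)])
  ultimately show ?thesis
    using assms by (simp add: coord_sum coord_simps)
qed

lemma C_hmult: "i < 3 \<Longrightarrow> g \<in> H3 \<Longrightarrow> h \<in> H3 \<Longrightarrow> C i g \<star> h = C i (g \<star> h)"
  by (simp add: C_def hmult_simps L_hmult)

lemma act_C: "i < 3 \<Longrightarrow> h \<in> H3 \<Longrightarrow> act (C i h) t = rho i (act h t) + tscale (v_gen_inv i) (act h t)"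
  by (simp add: C_def act_linear act_L)

lemma v_gen_simps: "v_gen 0 = VV" "v_gen_inv 0 = Vi" "0 < i \<Longrightarrow> v_gen i = pp" "0 < i \<Longrightarrow> v_gen_inv i = pm"
  by (simp_all add: v_gen_def v_gen_inv_def VV_def Vi_def pp_def pm_def)

text \<open>C_i - (v + v^-1) is T_i - v, so eigenvectors of C_i with eigenvalue v + v^-1 are those
  of T_i with eigenvalue v.\<close>

lemma act_eigenvector:
  assumes "i \<in> {1, 2}" "h \<in> H3"
  shows "act (C i h - smul (pp + pm) h) t = rho i (act h t) - tscale pp (act h t)"
proof -
  obtain x y z where h: "act h t = (x, y, z)" by (cases "act h t") auto
  have "i < 3" "0 < i" using assms(1) by auto
  then show ?thesis
    using assms(2) by (cases "rho i (x, y, z)") (simp add: act_linear act_C v_gen_simps h algebra_simps)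
qed

lemma rho_eigenvector:
  assumes "rho 1 t = tscale pp t" "rho 2 t = tscale pp t"
  obtains a where "t = (a, pp * a, pp * (pp * a))"
proof -
  obtain x y z where t: "t = (x, y, z)" by (cases t) auto
  have "y = pp * x" "z = pp * y"
    using assms by (simp_all add: t rho_def)
  then show ?thesis using that t by simp
qed

lemma rho_0_eigenvector:
  "rho 0 (a, pp * a, pp * (pp * a)) + tscale Vi (a, pp * a, pp * (pp * a)) = (a * qq, 0, 0)"
  by (simp add: rho_def qq_def algebra_simps unit_simps)

text \<open>A generator \<open>k\<close> of the cell module with the annihilator of $X$ would yield an element
  \<open>z\<close> of the cell with descents $s_1, s_2$ such that all coefficients of $C_t C_z$ in the cell are
  multiples of $V + V^{-1} v^4$, hence zero by inspection; but $C_t$ does not kill the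
  corresponding vector of the Specht module.\<close>

lemma no_common_annihilator:
  assumes D: "step_closed D" and D0: "step_closed D0" and k: "k \<in> H_span D"
    and gen: "\<And>y. y \<in> H_span D \<Longrightarrow> \<exists>h\<in>H3. y - h \<star> k \<in> H_span D0"
    and ann: "\<And>h. h \<in> H3 \<Longrightarrow> h \<star> k \<in> H_span D0 \<longleftrightarrow> act h (1, 0, 0) = 0"
  shows False
proof -
  have kH: "k \<in> H3" using k H_span_simps(5) by blast
  let ?v = "pp + pm"
  \<comment> \<open>The invariant vector is lifted to the algebra: the indices 2 and 7 stand for T_1
    and T_2 T_1.\<close>
  define m where "m = e 0 + smul pp (e 2) + smul (pp * pp) (e 7)"
  have m: "m \<in> H3" by (simp add: m_def)
  have act_m: "act m (1, 0, 0) = (1, pp, pp * pp)"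
    by (simp add: m_def act_linear act_e word_simps rho_def)
  have eig: "C i (h \<star> k) - smul ?v (h \<star> k) = (C i h - smul ?v h) \<star> k" if "i < 3" "h \<in> H3" for i h
    using that kH by (simp add: hmult_simps C_hmult)
  have "m \<star> k \<notin> H_span D0"
    using ann [OF m] act_m by (simp add: zero_prod_def)
  moreover have "m \<star> k \<in> H_span D"
    using D m k by (rule hmult_H_span)
  ultimately obtain z where z: "z < 48" "coord (m \<star> k) z \<noteq> 0" "z \<in> D" "z \<notin> D0"
    by (auto simp: H_span_def)
  \<comment> \<open>Modulo \<open>H_span D0\<close>, C_i multiplies m k by v + v^-1, yet the image
    of C_i has no component at an ascent of \<open>i\<close>. So a nonzero coordinate of m k outside
    \<open>D0\<close> can only sit at a descent.\<close>
  have desc: "\<not> ascent i z" if i: "i \<in> {1, 2}" for i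
  proof
    assume "ascent i z"
    have i3: "i < 3" using i by auto
    have "act (C i m - smul ?v m) (1, 0, 0) = rho i (1, pp, pp * pp) - tscale pp (1, pp, pp * pp)"
      unfolding act_eigenvector [OF i m] act_m ..
    also have "\<dots> = 0"
      using i by (auto simp: rho_def zero_prod_def algebra_simps unit_simps)
    finally have "C i (m \<star> k) - smul ?v (m \<star> k) \<in> H_span D0"
      using ann [of "C i m - smul ?v m"] eig [OF i3 m] m i3 by simp
    then have "coord (C i (m \<star> k) - smul ?v (m \<star> k)) z = 0"
      using z by (auto simp: H_span_def)
    then have "coord (m \<star> k) z * ?v = 0"
      using z(1) m kH i3 coord_C_ascent [OF i3 z(1) \<open>ascent i z\<close>, of "m \<star> k"]
      by (simp add: coord_simps mult.commute)
    then show False using v_mult_eq_0 z(2) by blast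
  qed
  have "H z \<in> H_span D"
    using z D by (auto simp: H_span_def coord_simps split: if_splits)
  then obtain h where h: "h \<in> H3" "H z - h \<star> k \<in> H_span D0"
    using gen by blast
  let ?t = "act h (1, 0, 0)" and ?r = "H z - h \<star> k"
  have hk: "h \<star> k \<in> H3" using h kH by simp
  \<comment> \<open>C_z is an eigenvector of C_1 and C_2, and h k agrees with it modulo
    \<open>H_span D0\<close>. The common annihilator carries the eigenvector equations over to the
    triple of h.\<close>
  have "rho i ?t = tscale pp ?t" if i: "i \<in> {1, 2}" for i
  proof -
    have i3: "i < 3" "v_gen i + v_gen_inv i = ?v"
      using i v_gen_simps by auto
    have "C i (h \<star> k) - smul ?v (h \<star> k) = smul ?v ?r - C i ?r"
      using C_H_descent [OF i3(1) z(1) desc [OF i]] i3(2)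
      by (simp add: C_simps hecke.scale_right_diff_distrib)
    also have "\<dots> \<in> H_span D0"
      by (rule H_span_simps(4) [OF H_span_simps(3) [OF h(2)] C_H_span [OF D0 i3(1) h(2)]])
    finally have "act (C i h - smul ?v h) (1, 0, 0) = 0"
      using ann [of "C i h - smul ?v h"] eig [OF i3(1) h(1)] h(1) i3(1) by simp
    then show ?thesis
      using act_eigenvector [OF i h(1)] by simp
  qed
  then obtain a where a: "?t = (a, pp * a, pp * (pp * a))"
    using rho_eigenvector [of ?t] by blast
  have act0: "act (C 0 h) (1, 0, 0) = (a * qq, 0, 0)"
    using act_C [of 0 h] h(1) a rho_0_eigenvector by (simp add: v_gen_simps)
  \<comment> \<open>\<open>C 0 h\<close> and the scalar \<open>a * qq\<close> send (1, 0, 0) to the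
    same triple, hence they agree on \<open>k\<close> modulo \<open>H_span D0\<close>.\<close>
  have "(C 0 h - smul (a * qq) (e 0)) \<star> k \<in> H_span D0"
    using ann [of "C 0 h - smul (a * qq) (e 0)"] h(1) act0
    by (simp add: act_linear act_e zero_prod_def)
  then have 1: "C 0 (h \<star> k) - smul (a * qq) k \<in> H_span D0"
    using h(1) kH by (simp add: hmult_simps C_hmult)
  have 2: "C 0 (H z) - C 0 (h \<star> k) \<in> H_span D0"
    using C_H_span [OF D0 _ h(2), of 0] by (simp add: C_simps)
  have 3: "C 0 (H z) - smul (a * qq) k \<in> H_span D0"
    using H_span_simps(2) [OF 1 2] by simp
  \<comment> \<open>All coordinates of C_t C_z outside \<open>D0\<close> are multiples of
    \<open>qq\<close>, so \<open>theta\<close> kills them and \<open>coord_t\<close> makes them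
    zero. This then forces \<open>a = 0\<close> and puts \<open>H z\<close> into
    \<open>H_span D0\<close>, against the choice of \<open>z\<close>.\<close>
  have "C 0 (H z) \<in> H_span D0"
    unfolding H_span_def
  proof (intro CollectI conjI allI impI)
    fix y assume y: "y < 48" "coord (C 0 (H z)) y \<noteq> 0"
    show "y \<in> D0"
    proof (rule ccontr)
      assume "y \<notin> D0"
      then have "coord (C 0 (H z) - smul (a * qq) k) y = 0"
        using 3 y by (auto simp: H_span_def)
      then have "coord (C 0 (H z)) y = qq * (a * coord k y)"
        using y(1) kH by (simp add: coord_simps algebra_simps)
      then have "theta (coord (C 0 (H z)) y) = 0"
        by (simp add: theta_mult theta_qq)
      then show False
        using coord_t [OF z(1) desc desc y(1)] y(2) by simp
    qed
  qed simp
  then have "C 0 h \<star> k \<in> H_span D0"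
    using H_span_simps(4) [OF _ 2] h(1) kH by (fastforce simp: C_hmult)
  then have "a * qq = 0"
    using ann [of "C 0 h"] h(1) act0 by (simp add: zero_prod_def)
  then have "a = 0"
    by (rule qq_mult_eq_0)
  then have "?t = 0"
    using a by (simp add: zero_prod_def)
  then have "h \<star> k \<in> H_span D0"
    using ann [OF h(1)] by simp
  then have "H z \<in> H_span D0"
    using H_span_simps(2) [OF h(2)] by fastforce
  then show False
    using z by (auto simp: H_span_def coord_simps)
qed

section \<open>Quotient modules and transport of the annihilator through an isomorphism\<close>

lemma add_coset_eq_iff:
  assumes "hecke.subspace N0"
  shows "add_coset N0 x = add_coset N0 y \<longleftrightarrow> x - y \<in> N0"
proof
  assume "add_coset N0 x = add_coset N0 y"
  moreover have "x \<in> add_coset N0 x"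
    using hecke.subspace_0 [OF assms] by (force simp: add_coset_def)
  ultimately show "x - y \<in> N0" by (auto simp: add_coset_def)
next
  assume *: "x - y \<in> N0"
  have sub: "add_coset N0 x \<subseteq> add_coset N0 y" if "x - y \<in> N0" for x y
  proof
    fix w assume "w \<in> add_coset N0 x"
    then obtain n where "n \<in> N0" "w = x + n" by (auto simp: add_coset_def)
    then have "(x - y) + n \<in> N0" "w = y + ((x - y) + n)"
      using hecke.subspace_add [OF assms that] by auto
    then show "w \<in> add_coset N0 y" unfolding add_coset_def by blast
  qed
  have "y - x \<in> N0"
    using hecke.subspace_neg [OF assms *] by simp
  then show "add_coset N0 x = add_coset N0 y"
    using sub * by blast
qed

text \<open>The action on cosets is defined as a set of sums; stability of \<open>N0\<close> under h
  makes that set a single coset.\<close>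

lemma action_add_coset:
  assumes "hecke.subspace N0" "\<And>n. n \<in> N0 \<Longrightarrow> h \<star> n \<in> N0"
  shows "action (quotient_module 3 M N0) h (add_coset N0 x) = add_coset N0 (h \<star> x)"
proof -
  have "{h \<star> x' + y |x' y. x' \<in> add_coset N0 x \<and> y \<in> N0} = add_coset N0 (h \<star> x)"
  proof (intro equalityI subsetI)
    fix w assume "w \<in> {h \<star> x' + y |x' y. x' \<in> add_coset N0 x \<and> y \<in> N0}"
    then obtain n y where n: "n \<in> N0" "y \<in> N0" "w = h \<star> (x + n) + y"
      by (auto simp: add_coset_def)
    then have "h \<star> n + y \<in> N0" "w = h \<star> x + (h \<star> n + y)"
      using hecke.subspace_add [OF assms(1) assms(2)] by (auto simp: hmult_simps2)
    then show "w \<in> add_coset N0 (h \<star> x)" unfolding add_coset_def by blast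
  next
    fix w assume "w \<in> add_coset N0 (h \<star> x)"
    then obtain y where "y \<in> N0" "w = h \<star> x + y" by (auto simp: add_coset_def)
    moreover have "x \<in> add_coset N0 x"
      using hecke.subspace_0 [OF assms(1)] by (force simp: add_coset_def)
    ultimately show "w \<in> {h \<star> x' + y |x' y. x' \<in> add_coset N0 x \<and> y \<in> N0}" by blast
  qed
  then show ?thesis by (simp add: quotient_module_def)
qed

theorem mainTheorem2:
  shows "\<forall>C \<in> left_cells wlex_less 3.
           \<not> module_iso 3 (specht_module 3 ([1], [2])) (cell_module wlex_less 3 C)"
proof (intro ballI notI)
  fix Y assume Y: "Y \<in> left_cells wlex_less 3"
    and iso: "module_iso 3 (specht_module 3 ([1], [2])) (cell_module wlex_less 3 Y)"
  obtain D D0 where D: "step_closed D" "step_closed D0"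
    and I: "cell_ideal wlex_less 3 Y = H_span D" "cell_ideal_hat wlex_less 3 Y = H_span D0"
    using left_cell_ideals [OF Y] by metis
  define N0 where "N0 = M_ideal 3 ([1], [2]) \<inter> N"
  have M: "M_ideal 3 ([1], [2]) = (\<lambda>h. h \<star> X) ` H3"
    by (simp add: M_ideal_def X_def)
  have N0_iff: "h \<star> X \<in> N0 \<longleftrightarrow> act h (1, 0, 0) = 0" if "h \<in> H3" for h
    unfolding N0_def M using that hmult_X_N by blast
  have N0: "hecke.subspace N0"
    unfolding hecke.subspace_def
  proof (intro conjI ballI allI)
    show "0 \<in> N0"
      unfolding N0_def M using hmult_simps(3) [of X] N_simps(1) H3_simps(1) by (metis IntI image_eqI)
    fix x y c assume "x \<in> N0" "y \<in> N0"
    then obtain g h where gh: "g \<in> H3" "h \<in> H3" "x = g \<star> X" "y = h \<star> X" "x \<in> N" "y \<in> N"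
      unfolding N0_def M by blast
    have "x + y = (g + h) \<star> X" "smul c x = smul c g \<star> X"
      using gh by (simp_all add: hmult_simps)
    then show "x + y \<in> N0" "smul c x \<in> N0"
      unfolding N0_def M using gh N_simps(2,3) H3_simps(2,3) by (metis IntI image_eqI)+
  qed
  \<comment> \<open>Stability comes from the description of \<open>N0\<close> as the multiples g X
    with g annihilating (1, 0, 0), since such g form a left ideal.\<close>
  have act_N0: "h \<star> n \<in> N0" if h: "h \<in> H3" and n: "n \<in> N0" for h n
  proof -
    obtain g where g: "g \<in> H3" "n = g \<star> X" using n unfolding N0_def M by blast
    then have "act g (1, 0, 0) = 0" using n N0_iff by simp
    then have "(h \<star> g) \<star> X \<in> N0" using h g by (simp add: N0_iff act_hmult)
    then show ?thesis using h g by (simp add: hmult_assoc)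
  qed
  have I0: "hecke.subspace (H_span D0)"
    by (auto simp: hecke.subspace_def H_span_simps)
  let ?S = "quotient_module 3 (M_ideal 3 ([1], [2])) N0" and ?C = "quotient_module 3 (H_span D) (H_span D0)"
  have "module_iso 3 ?S ?C"
    using iso by (simp add: specht_module_def cell_module_def I N0_def N_def)
  then obtain f where f: "bij_betw f (elts ?S) (elts ?C)"
    "\<And>h x. h \<in> H3 \<Longrightarrow> x \<in> elts ?S \<Longrightarrow> f (action ?S h x) = action ?C h (f x)"
    unfolding module_iso_def by blast
  have elts: "elts ?S = (\<lambda>h. add_coset N0 (h \<star> X)) ` H3" "elts ?C = add_coset (H_span D0) ` H_span D"
    unfolding quotient_module_def M by (simp_all add: image_image)
  have "add_coset N0 X \<in> elts ?S"
    unfolding elts using hmult_one [OF X_H3] by (metis H3_simps(5) image_eqI zero_less_numeral)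
  moreover from this have "f (add_coset N0 X) \<in> elts ?C"
    using f(1) by (meson bij_betwE)
  then obtain k where k: "k \<in> H_span D" "f (add_coset N0 X) = add_coset (H_span D0) k"
    unfolding elts by auto
  \<comment> \<open>The class of X generates the Specht module, so \<open>f\<close> is determined by
    the representative \<open>k\<close> of its image.\<close>
  ultimately have fh: "f (add_coset N0 (h \<star> X)) = add_coset (H_span D0) (h \<star> k)" if "h \<in> H3" for h
    using f(2) [OF that] that action_add_coset [OF N0 act_N0 [OF that]]
      action_add_coset [OF I0 hmult_H_span [OF D(2) that]] by metis
  show False
  proof (rule no_common_annihilator [OF D k(1)])
    fix y assume "y \<in> H_span D"
    then have "add_coset (H_span D0) y \<in> f ` elts ?S"
      using f(1) elts by (auto simp: bij_betw_def)
    then obtain h where "h \<in> H3" "add_coset (H_span D0) y = add_coset (H_span D0) (h \<star> k)"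
      unfolding elts using fh by auto
    then show "\<exists>h\<in>H3. y - h \<star> k \<in> H_span D0"
      using add_coset_eq_iff [OF I0] by blast
  next
    fix h assume h: "h \<in> H3"
    \<comment> \<open>The zero class is written as that of \<open>0 \<star> X\<close>, so that
      \<open>fh\<close> covers both sides and injectivity of \<open>f\<close> transfers the
      vanishing.\<close>
    have "h \<star> k \<in> H_span D0 \<longleftrightarrow> f (add_coset N0 (h \<star> X)) = f (add_coset N0 (0 \<star> X))"
      unfolding fh [OF h] fh [OF H3_simps(1)] by (simp add: add_coset_eq_iff [OF I0] hmult_simps(3))
    also have "\<dots> \<longleftrightarrow> add_coset N0 (h \<star> X) = add_coset N0 (0 \<star> X)"
      using f(1) h unfolding elts bij_betw_def by (metis (no_types, lifting) H3_simps(1) image_eqI inj_on_eq_iff)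
    also have "\<dots> \<longleftrightarrow> h \<star> X \<in> N0"
      using add_coset_eq_iff [OF N0] hmult_simps(3) by simp
    also have "\<dots> \<longleftrightarrow> act h (1, 0, 0) = 0"
      using N0_iff h by simp
    finally show "h \<star> k \<in> H_span D0 \<longleftrightarrow> act h (1, 0, 0) = 0" .
  qed
qed

end
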